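(* There is an absolute constant $C>0$ such that the following holds. Let $\mathbb{F}$ be $\mathbb{C}$ or $\mathbb{F}_p$ ($p$ prime). Let $Y$ be a finite subset of $\mathbb{F}$, let $0<\alpha\leq 1$, and let $L$ be a set of lines in $\mathbb{F}^2$ each of which is $\alpha$-rich in $Y\times Y$. Let $J>0$ be an integer such that $(\alpha/2)^{2^J}\geq 1/|Y|$. If $\mathbb{F}=\mathbb{C}$, then there is a subset $L'\subseteq L$ such that (1) the lines of $L'$ are either all parallel or all concurrent (pass through a common point), and (2) $|L'|\gg (\alpha/2)^{C\,2^J}|Y|^{-C/J}|L|$. If $\mathbb{F}=\mathbb{F}_p$, the same conclusion holds provided that $|Y|\leq(\alpha/2)^{2^J}p$.
   Context: A line $\ell$ in $\mathbb{F}^2$ is $\alpha$-rich in $Y\times Y$ if $|\ell\cap(Y\times Y)|\geq\alpha|Y|$. By the paper's convention, lines are graphs of affine maps $x\mapsto ax+b$ with $a,b\in\mathbb{F}$, $a\neq0$. The notation $f\gg g$ means $f\geq cg$ for an absolute constant $c>0$. *)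

theory Defs
  imports Complex_Main "HOL-Number_Theory.Residues"
begin

text \<open>
  The constants of the theorem must not depend on the field, so the quantification over
  \<^term>\<open>p\<close> has to happen inside a formula. Fields are therefore \<^term>\<open>carrier\<close>-based rings:
  \<^term>\<open>residue_ring (int p)\<close> is the prime field with \<^term>\<open>p\<close> elements, and the following is the
  field of complex numbers.
\<close>

definition complex_field :: "complex ring" where
  "complex_field = \<lparr>carrier = UNIV, monoid.mult = (*), one = 1, zero = 0, add = (+)\<rparr>"

lemma field_complex_field: "Ring.field complex_field"
proof -
  have "\<exists>y. y + x = 0 \<and> x + y = 0" for x :: complex
    by (rule exI[of _ "- x"]) simp
  then interpret cring complex_field
    by unfold_locales (auto simp: complex_field_def Units_def algebra_simps)
  show ?thesis
  proof (rule cring_fieldI)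
    have "\<exists>y. y * x = 1 \<and> x * y = 1" if "x \<noteq> 0" for x :: complex
      using that by (intro exI[of _ "inverse x"]) simp
    then show "Units complex_field = carrier complex_field - {\<zero>\<^bsub>complex_field\<^esub>}"
      by (auto simp: complex_field_def Units_def)
  qed
qed

definition line :: "('a, 'm) ring_scheme \<Rightarrow> 'a \<Rightarrow> 'a \<Rightarrow> ('a \<times> 'a) set" where
  "line F a b = {(x, a \<otimes>\<^bsub>F\<^esub> x \<oplus>\<^bsub>F\<^esub> b) | x. x \<in> carrier F}"

definition lines :: "('a, 'm) ring_scheme \<Rightarrow> ('a \<times> 'a) set set" where
  "lines F = {line F a b | a b. a \<in> carrier F \<and> a \<noteq> \<zero>\<^bsub>F\<^esub> \<and> b \<in> carrier F}"

definition rich :: "real \<Rightarrow> 'a set \<Rightarrow> ('a \<times> 'a) set \<Rightarrow> bool" where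
  "rich \<alpha> Y l \<longleftrightarrow> real (card (l \<inter> Y \<times> Y)) \<ge> \<alpha> * real (card Y)"

definition all_parallel :: "('a, 'm) ring_scheme \<Rightarrow> ('a \<times> 'a) set set \<Rightarrow> bool" where
  "all_parallel F L \<longleftrightarrow>
     (\<exists>a \<in> carrier F. a \<noteq> \<zero>\<^bsub>F\<^esub> \<and> (\<forall>l \<in> L. \<exists>b \<in> carrier F. l = line F a b))"

definition all_concurrent :: "('a, 'm) ring_scheme \<Rightarrow> ('a \<times> 'a) set set \<Rightarrow> bool" where
  "all_concurrent F L \<longleftrightarrow> (\<exists>P \<in> carrier F \<times> carrier F. \<forall>l \<in> L. P \<in> l)"

end

theory Submission
  imports Defs "HOL-Analysis.Convex" "HOL-Library.Indicator_Function"
begin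

text \<open>
  A line \<open>y = a x + b\<close> is an element of the affine group acting on the field, and being rich means
  that this element returns many points of \<open>Y\<close> to \<open>Y\<close>. Let \<open>\<mu>\<close> be the uniform measure on the given
  lines and square \<open>\<mu>\<^sup>- * \<mu>\<close> repeatedly. By Cauchy-Schwarz the average return rate after \<open>j\<close>
  squarings is still \<open>\<alpha>\<close> to the power \<open>2 ^ Suc j\<close>, and since two points determine a line this
  bounds the \<open>L\<^sup>2\<close> norms of the first \<open>J\<close> measures from below. So one of the steps loses only a
  factor \<open>K = |Y| powr (16 / J)\<close>, and the Balog-Szemeredi-Gowers theorem extracts from this step a
  symmetric set \<open>S\<close> of affine maps with \<open>|S ^ k| \<le> Q ^ c |S|\<close>, where
  \<open>Q = K / (\<alpha> / 2) ^ 2 ^ J\<close> absorbs all losses.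

  In the affine group such an \<open>S\<close> is concentrated on an abelian subgroup. Conjugating a map that has
  a fixed point \<open>x\<close> shows that \<open>S\<close> has about as many elements as there are pairs of a translation
  (by some \<open>b \<in> B\<close>) and a dilation about \<open>x\<close> (by some \<open>c \<in> C\<close>) among the short words in \<open>S\<close>, and
  \<open>B\<close> hardly grows when it is multiplied by \<open>C\<close> and added to itself. Consider the set of quotients
  \<open>(b1 - b2) / (c1 - c2)\<close>. If it is not invariant under adding elements of \<open>B\<close>, it yields a \<open>\<xi>\<close>
  for which \<open>b + c \<xi>\<close> takes \<open>|B| |C|\<close> values, all of them in a set not much larger than \<open>B\<close>, so
  \<open>C\<close> is small. If it is invariant and \<open>B\<close> is not \<open>{0}\<close>, it is the whole field, which is therefore
  finite, and counting over all \<open>\<xi>\<close> gives the same unless \<open>B\<close> has almost \<open>p\<close> elements. In that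
  last case the assumption \<open>|Y| \<le> (\<alpha> / 2) ^ 2 ^ J p\<close> enters: by a second moment
  computation over all lines it bounds the size of \<open>S\<close> by a multiple of \<open>p\<close>. The cosets of
  the translations and of the point stabilizers are the families of parallel and concurrent lines.
\<close>

section \<open>Balog-Szemeredi-Gowers in a non-abelian group\<close>

lemma card_fibres_le:
  assumes "finite T" and "\<And>w. w \<in> W \<Longrightarrow> m \<le> real (card {t \<in> T. h t = w})"
  shows "real (card W) * m \<le> real (card T)"
proof (cases "finite W")
  case True
  have "real (card W) * m = (\<Sum>w\<in>W. m)" by simp
  also have "\<dots> \<le> (\<Sum>w\<in>W. real (card {t \<in> T. h t = w}))"
    by (rule sum_mono) (use assms in auto)
  also have "\<dots> = real (card (\<Union>w\<in>W. {t \<in> T. h t = w}))"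
    by (subst card_UN_disjoint) (use True assms in auto)
  also have "\<dots> \<le> real (card T)"
    using assms(1) by (auto intro!: card_mono)
  finally show ?thesis .
qed simp

lemma sum_card_Collect_swap:
  assumes "finite A" "finite B"
  shows "(\<Sum>a\<in>A. card {b \<in> B. R a b}) = (\<Sum>b\<in>B. card {a \<in> A. R a b})"
  using sum.swap_restrict[OF assms, of "\<lambda>_ _. 1 :: nat" R] by simp

text \<open>Dependent random choice. Call a pair bad if it has few common neighbours. In the
  neighbourhood of a random vertex bad pairs are rare, because that vertex is itself a common
  neighbour. Keep those vertices of one good neighbourhood that are bad to at most a quarter of it:
  any two of them share half of the neighbourhood as midpoints \<open>z\<close> that are bad to
  neither, and each half of the path can then be completed in at least \<open>\<epsilon> * n\<close>
  ways.\<close>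

lemma dense_graph_many_paths:
  fixes V :: "'a set" and E :: "'a \<Rightarrow> 'a \<Rightarrow> bool" and n \<delta> :: real
  assumes fin: "finite V" and sym: "\<And>x y. E x y \<Longrightarrow> E y x"
    and n: "0 < n" "real (card V) \<le> n" and \<delta>: "0 < \<delta>"
    and dense: "\<delta> * n\<^sup>2 \<le> real (card {(x, y) \<in> V \<times> V. E x y})"
  obtains A where "A \<subseteq> V" "\<delta> * n / 4 \<le> real (card A)"
    "\<And>x y. x \<in> A \<Longrightarrow> y \<in> A \<Longrightarrow>
      \<delta> ^ 5 * n ^ 3 / 1024 \<le>
        real (card {(w, z, w'). w \<in> V \<and> z \<in> V \<and> w' \<in> V \<and> E x w \<and> E w z \<and> E z w' \<and> E w' y})"
proof -
  define N where "N v = {x \<in> V. E v x}" for v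
  define cd where "cd x y = card (N x \<inter> N y)" for x y
  \<comment> \<open>With the weight 8 put on bad pairs below, this \<open>\<epsilon>\<close> costs
    exactly half of the second moment \<open>\<delta>\<^sup>2 * n ^ 3\<close>.\<close>
  define \<epsilon> where "\<epsilon> = \<delta>\<^sup>2 / 16"
  define bad where "bad x y \<longleftrightarrow> real (cd x y) < \<epsilon> * n" for x y
  define B where "B v = {(x, y) \<in> N v \<times> N v. bad x y}" for v
  have \<epsilon>: "0 < \<epsilon>" using \<delta> by (simp add: \<epsilon>_def)
  have finN [simp]: "finite (N v)" for v using fin by (simp add: N_def)
  have NV: "N v \<subseteq> V" for v by (auto simp: N_def)
  have bad_sym: "bad x y \<longleftrightarrow> bad y x" for x y by (simp add: bad_def cd_def Int_commute)
  have "{(x, y) \<in> V \<times> V. E x y} = Sigma V N" by (auto simp: N_def)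
  hence edges: "\<delta> * n\<^sup>2 \<le> (\<Sum>v\<in>V. real (card (N v)))"
    using dense fin by simp
  have Vpos: "0 < card V"
  proof (rule ccontr)
    assume "\<not> 0 < card V"
    hence "V = {}" using fin by simp
    thus False using dense mult_pos_pos[OF \<delta> zero_less_power[OF n(1), of 2]] by simp
  qed
  have sq: "\<delta>\<^sup>2 * n ^ 3 \<le> (\<Sum>v\<in>V. (real (card (N v)))\<^sup>2)"
  proof -
    have "(\<delta> * n\<^sup>2)\<^sup>2 \<le> (\<Sum>v\<in>V. real (card (N v)))\<^sup>2"
      by (rule power_mono[OF edges]) (use \<delta> n in auto)
    also have "\<dots> \<le> (\<Sum>v\<in>V. (real (card (N v)))\<^sup>2) * real (card V)"
      by (rule sum_squared_le_sum_of_squares)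
    also have "\<dots> \<le> (\<Sum>v\<in>V. (real (card (N v)))\<^sup>2) * n"
      by (intro mult_left_mono n sum_nonneg) auto
    finally have "(\<delta>\<^sup>2 * n ^ 3) * n \<le> (\<Sum>v\<in>V. (real (card (N v)))\<^sup>2) * n"
      by (simp add: power2_eq_square power3_eq_cube algebra_simps)
    thus ?thesis using n by simp
  qed
  \<comment> \<open>A bad pair lies in the neighbourhoods of fewer than
    \<open>\<epsilon> * n\<close> vertices, and there are at most \<open>n\<^sup>2\<close>
    pairs.\<close>
  have sumB: "(\<Sum>v\<in>V. real (card (B v))) \<le> \<epsilon> * n ^ 3"
  proof -
    define P where "P = {(x, y) \<in> V \<times> V. bad x y}"
    have finP: "finite P" using fin unfolding P_def by (auto intro: finite_subset[of _ "V \<times> V"])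
    have "(\<Sum>v\<in>V. card (B v)) = (\<Sum>v\<in>V. card {p \<in> P. fst p \<in> N v \<and> snd p \<in> N v})"
      by (intro sum.cong arg_cong[where f = card]) (auto simp: B_def P_def N_def)
    also have "\<dots> = (\<Sum>p\<in>P. card {v \<in> V. fst p \<in> N v \<and> snd p \<in> N v})"
      by (rule sum_card_Collect_swap[OF fin finP])
    finally have "(\<Sum>v\<in>V. real (card (B v))) = (\<Sum>p\<in>P. real (card {v \<in> V. fst p \<in> N v \<and> snd p \<in> N v}))"
      unfolding of_nat_sum[symmetric] by (rule arg_cong)
    also have "\<dots> \<le> (\<Sum>p\<in>P. \<epsilon> * n)"
    proof (rule sum_mono)
      fix p assume p: "p \<in> P"
      have "{v \<in> V. fst p \<in> N v \<and> snd p \<in> N v} = N (fst p) \<inter> N (snd p)"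
        using p sym by (auto simp: N_def P_def)
      thus "real (card {v \<in> V. fst p \<in> N v \<and> snd p \<in> N v}) \<le> \<epsilon> * n"
        using p by (auto simp: P_def bad_def cd_def)
    qed
    also have "\<dots> = real (card P) * (\<epsilon> * n)" by simp
    also have "\<dots> \<le> n\<^sup>2 * (\<epsilon> * n)"
    proof (rule mult_right_mono)
      have "card P \<le> card (V \<times> V)" by (rule card_mono) (use fin P_def in auto)
      hence "real (card P) \<le> real (card V) * real (card V)"
        unfolding of_nat_mult[symmetric] of_nat_le_iff by (simp add: card_cartesian_product)
      also have "\<dots> \<le> n * n" by (intro mult_mono n) (use n in auto)
      finally show "real (card P) \<le> n\<^sup>2" by (simp add: power2_eq_square)
    qed (use \<epsilon> n in auto)
    finally show ?thesis by (simp add: power2_eq_square power3_eq_cube algebra_simps)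
  qed
  \<comment> \<open>Averaging over \<open>v\<close>. The weight 8 bounds the bad pairs by
    \<open>k\<^sup>2 / 8 = (k / 2) * (k / 4)\<close>, so that at most half of \<open>N v\<close> has
    more than \<open>k / 4\<close> bad partners.\<close>
  have "\<exists>v\<in>V. \<delta>\<^sup>2 * n\<^sup>2 / 2 \<le> (real (card (N v)))\<^sup>2 - 8 * real (card (B v))"
  proof (rule ccontr)
    assume "\<not> ?thesis"
    hence "(\<Sum>v\<in>V. (real (card (N v)))\<^sup>2 - 8 * real (card (B v))) < (\<Sum>v\<in>V. \<delta>\<^sup>2 * n\<^sup>2 / 2)"
      using fin Vpos by (intro sum_strict_mono) (auto simp: not_le)
    also have "\<dots> = real (card V) * (\<delta>\<^sup>2 * n\<^sup>2 / 2)" by simp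
    also have "\<dots> \<le> n * (\<delta>\<^sup>2 * n\<^sup>2 / 2)" by (intro mult_right_mono n) simp
    also have "\<dots> = \<delta>\<^sup>2 * n ^ 3 - 8 * (\<epsilon> * n ^ 3)"
      by (simp add: \<epsilon>_def power2_eq_square power3_eq_cube algebra_simps)
    also have "\<dots> \<le> (\<Sum>v\<in>V. (real (card (N v)))\<^sup>2) - 8 * (\<Sum>v\<in>V. real (card (B v)))"
      using sq sumB by linarith
    finally show False by (simp add: sum_subtractf sum_distrib_left)
  qed
  then obtain v where v: "v \<in> V"
    and good: "\<delta>\<^sup>2 * n\<^sup>2 / 2 \<le> (real (card (N v)))\<^sup>2 - 8 * real (card (B v))" by blast
  define k where "k = real (card (N v))"
  have k: "\<delta> * n / 2 \<le> k"
  proof -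
    have "(\<delta> * n / 2)\<^sup>2 \<le> \<delta>\<^sup>2 * n\<^sup>2 / 2" by (simp add: power_mult_distrib power_divide)
    also have "\<dots> \<le> k\<^sup>2" using good by (simp add: k_def)
    finally show ?thesis by (rule power2_le_imp_le) (simp add: k_def)
  qed
  have kpos: "0 < k" using k \<delta> n by (smt (verit) divide_pos_pos mult_pos_pos)
  have Bk: "real (card (B v)) \<le> k\<^sup>2 / 8"
    using good zero_le_power2[of "\<delta> * n"] unfolding k_def power_mult_distrib by linarith
  define A where "A = {x \<in> N v. real (card {y \<in> N v. bad x y}) \<le> k / 4}"
  have finA: "finite A" and AN: "A \<subseteq> N v" by (auto simp: A_def)
  have "real (card (N v - A)) * (k / 4) \<le> real (card (B v))"
  proof (rule card_fibres_le)
    show "finite (B v)" by (auto simp: B_def intro: finite_subset[of _ "N v \<times> N v"])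
    fix x assume x: "x \<in> N v - A"
    have "{t \<in> B v. fst t = x} = Pair x ` {y \<in> N v. bad x y}"
      using x by (auto simp: B_def)
    hence "card {t \<in> B v. fst t = x} = card {y \<in> N v. bad x y}"
      by (simp add: card_image inj_on_def)
    thus "k / 4 \<le> real (card {t \<in> B v. fst t = x})" using x by (auto simp: A_def)
  qed
  hence "real (card (N v - A)) * (k / 4) \<le> (k / 2) * (k / 4)"
    using Bk by (simp add: power2_eq_square field_simps)
  hence "real (card (N v - A)) \<le> k / 2" using kpos by (simp add: mult_le_cancel_right)
  moreover have "card (N v) = card (N v - A) + card A"
    using card_Diff_subset[OF finA] card_mono[OF finN] AN by (metis le_add_diff_inverse2)
  ultimately have A_large: "k / 2 \<le> real (card A)" by (simp add: k_def)
  show thesis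
  proof
    show "A \<subseteq> V" using NV by (auto simp: A_def)
    show "\<delta> * n / 4 \<le> real (card A)" using A_large k by linarith
    fix x y assume xy: "x \<in> A" "y \<in> A"
    define Z where "Z = {z \<in> N v. \<not> bad x z \<and> \<not> bad y z}"
    define X where "X u = {z \<in> N v. bad u z}" for u
    have "N v = Z \<union> (X x \<union> X y)" by (auto simp: Z_def X_def)
    hence "card (N v) = card (Z \<union> (X x \<union> X y))" by (rule arg_cong)
    hence "card (N v) \<le> card Z + (card (X x) + card (X y))"
      using card_Un_le[of Z "X x \<union> X y"] card_Un_le[of "X x" "X y"] by linarith
    hence Z: "k / 2 \<le> real (card Z)"
      using xy by (simp add: A_def k_def X_def)
    have finZ: "finite Z" by (simp add: Z_def)
    define T where
      "T = {(w, z, w'). w \<in> V \<and> z \<in> V \<and> w' \<in> V \<and> E x w \<and> E w z \<and> E z w' \<and> E w' y}"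
    have finT: "finite T"
      by (rule finite_subset[of _ "V \<times> V \<times> V"]) (use fin in \<open>auto simp: T_def\<close>)
    have "real (card Z) * ((\<epsilon> * n) * (\<epsilon> * n)) \<le> real (card T)"
    proof (rule card_fibres_le[OF finT])
      fix z assume z: "z \<in> Z"
      have "(\<lambda>(w, w'). (w, z, w')) ` ((N x \<inter> N z) \<times> (N y \<inter> N z)) \<subseteq> {t \<in> T. fst (snd t) = z}"
        using z sym by (auto simp: T_def Z_def N_def)
      hence "card ((N x \<inter> N z) \<times> (N y \<inter> N z)) \<le> card {t \<in> T. fst (snd t) = z}"
        using finT by (intro card_inj_on_le[where f = "\<lambda>(w, w'). (w, z, w')"]) (auto simp: inj_on_def)
      hence "real (cd x z) * real (cd y z) \<le> real (card {t \<in> T. fst (snd t) = z})"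
        unfolding of_nat_mult[symmetric] of_nat_le_iff by (simp add: card_cartesian_product cd_def)
      moreover have "(\<epsilon> * n) * (\<epsilon> * n) \<le> real (cd x z) * real (cd y z)"
        by (rule mult_mono) (use z \<epsilon> n in \<open>auto simp: Z_def bad_def\<close>)
      ultimately show "(\<epsilon> * n) * (\<epsilon> * n) \<le> real (card {t \<in> T. fst (snd t) = z})" by simp
    qed
    moreover have "(\<delta> * n / 4) * ((\<epsilon> * n) * (\<epsilon> * n)) \<le> real (card Z) * ((\<epsilon> * n) * (\<epsilon> * n))"
      by (rule mult_right_mono) (use Z k in auto)
    ultimately have "(\<delta> * n / 4) * ((\<epsilon> * n) * (\<epsilon> * n)) \<le> real (card T)" by linarith
    moreover have "\<delta> ^ 5 * n ^ 3 / 1024 = (\<delta> * n / 4) * ((\<epsilon> * n) * (\<epsilon> * n))"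
      by (simp add: \<epsilon>_def eval_nat_numeral)
    ultimately show "\<delta> ^ 5 * n ^ 3 / 1024 \<le> real (card T)"
      by (simp only:)
  qed
qed

section \<open>From many paths to a small quotient set\<close>

definition difs :: "'g::group_add set \<Rightarrow> 'g set" where
  "difs A = {- x + y | x y. x \<in> A \<and> y \<in> A}"

lemma difs_eq_image: "difs A = (\<lambda>(x, y). - x + y) ` (A \<times> A)"
  by (auto simp: difs_def)

lemma finite_difs: "finite A \<Longrightarrow> finite (difs A)"
  by (simp add: difs_eq_image)

lemma group_eq_iff_minus_add: "- x + y = z \<longleftrightarrow> y = x + z" for x y z :: "'g::group_add"
  by (metis add.assoc add.left_inverse add.left_neutral minus_add_cancel)

text \<open>In multiplicative notation \<open>difs A\<close> is the quotient set A^(-1) A in a group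
  that may be non-commutative. A path \<open>x, w, z, w', y\<close> writes \<open>- x + y\<close> as
  a telescoping sum of four elements of \<open>H\<close>, and different paths give different
  quadruples. There are at most \<open>n ^ 4\<close> quadruples, so many representations of every
  quotient mean few quotients.\<close>

lemma Balog_Szemeredi_Gowers:
  fixes V H :: "'g::group_add set" and n \<delta> :: real
  assumes fin: "finite V" "finite H" and symH: "\<And>h. h \<in> H \<Longrightarrow> - h \<in> H"
    and n: "0 < n" "real (card V) \<le> n" "real (card H) \<le> n" and \<delta>: "0 < \<delta>"
    and dense: "\<delta> * n\<^sup>2 \<le> real (card {(x, y) \<in> V \<times> V. - x + y \<in> H})"
  obtains A where "A \<subseteq> V" "\<delta> * n / 4 \<le> real (card A)"
    "real (card (difs A)) \<le> 1024 * n / \<delta> ^ 5"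
proof -
  have sym: "- y + x \<in> H" if "- x + y \<in> H" for x y
    using symH[OF that] by (simp add: minus_add)
  show thesis
  proof (rule dense_graph_many_paths[where E = "\<lambda>x y. - x + y \<in> H", OF fin(1) sym n(1,2) \<delta> dense])
    fix A
    assume A: "A \<subseteq> V" "\<delta> * n / 4 \<le> real (card A)"
      and paths: "\<And>x y. x \<in> A \<Longrightarrow> y \<in> A \<Longrightarrow>
        \<delta> ^ 5 * n ^ 3 / 1024 \<le> real (card {(w, z, w'). w \<in> V \<and> z \<in> V \<and> w' \<in> V \<and>
          - x + w \<in> H \<and> - w + z \<in> H \<and> - z + w' \<in> H \<and> - w' + y \<in> H})"
    have "real (card (difs A)) * (\<delta> ^ 5 * n ^ 3 / 1024) \<le> real (card (H \<times> H \<times> H \<times> H))"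
    proof (rule card_fibres_le[where h = "\<lambda>(a, b, c, d). a + b + c + d"])
      show "finite (H \<times> H \<times> H \<times> H)" using fin by simp
      fix s assume "s \<in> difs A"
      then obtain x y where s: "s = - x + y" "x \<in> A" "y \<in> A" by (auto simp: difs_def)
      define T where "T = {(w, z, w'). w \<in> V \<and> z \<in> V \<and> w' \<in> V \<and>
          - x + w \<in> H \<and> - w + z \<in> H \<and> - z + w' \<in> H \<and> - w' + y \<in> H}"
      have "card T \<le> card {t \<in> H \<times> H \<times> H \<times> H. (case t of (a, b, c, d) \<Rightarrow> a + b + c + d) = s}"
      proof (rule card_inj_on_le)
        show "inj_on (\<lambda>(w, z, w'). (- x + w, - w + z, - z + w', - w' + y)) T"
          by (rule inj_onI) auto
        have [simp]: "- x + w + (- w + z) + (- z + w') + (- w' + y) = - x + y" for w z w'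
          by (metis add.assoc add_minus_cancel)
        show "(\<lambda>(w, z, w'). (- x + w, - w + z, - z + w', - w' + y)) ` T
            \<subseteq> {t \<in> H \<times> H \<times> H \<times> H. (case t of (a, b, c, d) \<Rightarrow> a + b + c + d) = s}"
          by (clarsimp simp: T_def s(1))
        show "finite {t \<in> H \<times> H \<times> H \<times> H. (case t of (a, b, c, d) \<Rightarrow> a + b + c + d) = s}"
          using fin by simp
      qed
      thus "\<delta> ^ 5 * n ^ 3 / 1024
          \<le> real (card {t \<in> H \<times> H \<times> H \<times> H. (case t of (a, b, c, d) \<Rightarrow> a + b + c + d) = s})"
        using paths[OF s(2,3)] unfolding T_def by linarith
    qed
    also have "\<dots> = real (card H) ^ 4" by (simp add: card_cartesian_product eval_nat_numeral)
    also have "\<dots> \<le> n ^ 4" by (intro power_mono n) simp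
    also have "\<dots> = (1024 * n / \<delta> ^ 5) * (\<delta> ^ 5 * n ^ 3 / 1024)"
      using \<delta> by (simp add: eval_nat_numeral)
    finally have "real (card (difs A)) \<le> 1024 * n / \<delta> ^ 5"
      by (rule mult_right_le_imp_le) (use \<delta> n in auto)
    thus thesis using A that by blast
  qed
qed

section \<open>Product sets and approximate groups\<close>

primrec nfold :: "'g::group_add set \<Rightarrow> nat \<Rightarrow> 'g set" where
  "nfold S 0 = {0}"
| "nfold S (Suc k) = {x + s | x s. x \<in> nfold S k \<and> s \<in> S}"

lemma nfold_add: "x \<in> nfold S j \<Longrightarrow> y \<in> nfold S k \<Longrightarrow> x + y \<in> nfold S (j + k)"
proof (induction k arbitrary: y)
  case (Suc k)
  then obtain z s where "y = z + s" "z \<in> nfold S k" "s \<in> S" by auto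
  thus ?case using Suc.IH[of z] Suc.prems by (auto simp: add.assoc[symmetric])
qed simp

lemma nfold_1 [simp]: "nfold S (Suc 0) = S" by auto

lemma nfold_2I: "x \<in> S \<Longrightarrow> y \<in> S \<Longrightarrow> x + y \<in> nfold S 2"
  by (force simp: numeral_2_eq_2)

lemma nfold_mono: "0 \<in> S \<Longrightarrow> j \<le> k \<Longrightarrow> nfold S j \<subseteq> nfold S k"
proof -
  assume "0 \<in> S" and "j \<le> k"
  hence "nfold S i \<subseteq> nfold S (Suc i)" for i by force
  thus ?thesis using \<open>j \<le> k\<close> by (rule lift_Suc_mono_le)
qed

lemma nfold_uminus:
  assumes "\<And>s. s \<in> S \<Longrightarrow> - s \<in> S" "x \<in> nfold S k"
  shows "- x \<in> nfold S k"
  using assms(2)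
proof (induction k arbitrary: x)
  case (Suc k)
  then obtain z s where x: "x = z + s" "z \<in> nfold S k" "s \<in> S" by auto
  have "- s + - z \<in> nfold S (Suc 0 + k)"
    by (rule nfold_add) (use x Suc.IH assms(1) in auto)
  thus ?case by (simp add: x(1) minus_add)
qed simp

lemma finite_nfold: "finite S \<Longrightarrow> finite (nfold S k)"
proof (induction k)
  case (Suc k)
  have "nfold S (Suc k) = (\<lambda>(x, s). x + s) ` (nfold S k \<times> S)" by auto
  thus ?case using Suc by (metis finite_SigmaI finite_imageI)
qed simp

text \<open>This is A^(-1) S^k A. The outer factors make an induction on \<open>k\<close> possible:
  a letter u v^(-1) with u and v in A splits such a word into a word with one letter less and an
  element of \<open>difs A\<close>.\<close>

definition sandwich :: "'g::group_add set \<Rightarrow> 'g set \<Rightarrow> nat \<Rightarrow> 'g set" where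
  "sandwich A S k = {- a + x + b | a x b. a \<in> A \<and> x \<in> nfold S k \<and> b \<in> A}"

lemma finite_sandwich: "finite A \<Longrightarrow> finite S \<Longrightarrow> finite (sandwich A S k)"
proof -
  have "sandwich A S k = (\<lambda>(a, x, b). - a + x + b) ` (A \<times> nfold S k \<times> A)"
    by (force simp: sandwich_def)
  thus "finite A \<Longrightarrow> finite S \<Longrightarrow> ?thesis" by (simp add: finite_nfold)
qed

text \<open>Both sides are the energy of \<open>h\<close>, in the form in which Cauchy-Schwarz
  compares it with the size of the image.\<close>

lemma sum_fibre_squares:
  assumes "finite T"
  shows "(\<Sum>s\<in>h ` T. (card {t \<in> T. h t = s})\<^sup>2) = card {(t, u) \<in> T \<times> T. h t = h u}"
proof -
  have "{(t, u) \<in> T \<times> T. h t = h u} = (\<Union>s\<in>h ` T. {t \<in> T. h t = s} \<times> {t \<in> T. h t = s})"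
    by auto
  also have "card \<dots> = (\<Sum>s\<in>h ` T. card ({t \<in> T. h t = s} \<times> {t \<in> T. h t = s}))"
    by (rule card_UN_disjoint) (use assms in auto)
  finally show ?thesis by (simp add: card_cartesian_product power2_eq_square)
qed

lemma sum_fibres:
  assumes "finite T"
  shows "(\<Sum>s\<in>h ` T. card {t \<in> T. h t = s}) = card T"
proof -
  have "T = (\<Union>s\<in>h ` T. {t \<in> T. h t = s})"
    by auto
  also have "card \<dots> = (\<Sum>s\<in>h ` T. card {t \<in> T. h t = s})"
    by (rule card_UN_disjoint) (use assms in auto)
  finally show ?thesis by simp
qed

text \<open>\<open>S\<close> consists of the popular quotients x y^(-1), those with at least |A| /
  (2 M) representations. By Cauchy-Schwarz the smallness of A^(-1) A forces a large energy, the
  quotients x y^(-1) have the same energy, and the unpopular ones carry at most half of the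
  guaranteed amount. Replacing one letter at a time by its many representations then bounds the
  words of every length.\<close>

lemma small_difs_imp_approximate_group:
  fixes A :: "'g::group_add set" and M :: real
  assumes fin: "finite A" and ne: "A \<noteq> {}" and M: "real (card (difs A)) \<le> M * real (card A)"
  obtains S where "finite S" "0 \<in> S" "\<And>s. s \<in> S \<Longrightarrow> - s \<in> S" "S \<subseteq> (\<lambda>(x, y). x - y) ` (A \<times> A)"
    "real (card A) \<le> 2 * M * real (card S)"
    "\<And>k. real (card (sandwich A S k)) \<le> (2 * M\<^sup>2) ^ k * (M * real (card A))"
proof -
  define r where "r s = card {(x, y) \<in> A \<times> A. x - y = s}" for s
  define S where "S = {s. real (card A) / (2 * M) \<le> real (r s) \<and> s \<in> (\<lambda>(x, y). x - y) ` (A \<times> A)}"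
  have cA: "0 < card A" using fin ne by (simp add: card_gt_0_iff)
  have D_ne: "0 < card (difs A)"
    using fin ne finite_difs[OF fin] by (auto simp: card_gt_0_iff difs_def)
  have Mpos: "0 < M"
  proof (rule ccontr)
    assume "\<not> 0 < M"
    hence "M * real (card A) \<le> 0" by (simp add: mult_nonpos_nonneg)
    thus False using M D_ne by simp
  qed
  have cAD: "card A \<le> card (difs A)"
  proof -
    obtain a where "a \<in> A" using ne by blast
    hence "(\<lambda>y. - a + y) ` A \<subseteq> difs A" by (auto simp: difs_def)
    thus ?thesis by (rule card_inj_on_le[rotated]) (simp_all add: finite_difs fin)
  qed
  have M1: "1 \<le> M"
  proof -
    have "1 * real (card A) \<le> M * real (card A)" using cAD M by simp
    thus ?thesis using cA by (simp add: mult_le_cancel_right)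
  qed
  have finS: "finite S" using fin by (auto simp: S_def intro: finite_subset)
  have finAA: "finite {(x, y) \<in> A \<times> A. x - y = s}" for s
    by (rule finite_subset[of _ "A \<times> A"]) (use fin in auto)
  have r_le: "r s \<le> card A" for s
  proof -
    have "inj_on fst {(x, y) \<in> A \<times> A. x - y = s}"
      by (auto simp: inj_on_def) (metis diff_eq_eq add_left_cancel)
    thus ?thesis unfolding r_def by (rule card_inj_on_le) (use fin in auto)
  qed
  have zeroS: "0 \<in> S"
  proof -
    have "{(x, y) \<in> A \<times> A. x - y = 0} = (\<lambda>x. (x, x)) ` A" by auto
    hence "r 0 = card A" by (simp add: r_def card_image inj_on_def)
    moreover have "real (card A) / (2 * M) \<le> real (card A)"
      using M1 cA by (simp add: divide_le_eq)
    ultimately show ?thesis using ne by (force simp: S_def)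
  qed
  have symS: "- s \<in> S" if sS: "s \<in> S" for s
  proof -
    have "{(x, y) \<in> A \<times> A. x - y = - s} = prod.swap ` {(x, y) \<in> A \<times> A. x - y = s}"
    proof -
      have "x - y = - s \<longleftrightarrow> y - x = s" for x y by (metis minus_diff_eq minus_minus)
      thus ?thesis by auto
    qed
    hence "r (- s) = r s" by (simp add: r_def card_image)
    moreover have "- s \<in> (\<lambda>(x, y). x - y) ` (A \<times> A)"
    proof -
      obtain x y where "s = x - y" "x \<in> A" "y \<in> A" using sS by (auto simp: S_def)
      thus ?thesis by (intro image_eqI[of _ _ "(y, x)"]) auto
    qed
    ultimately show ?thesis using that by (simp add: S_def)
  qed
  have cardS: "real (card A) \<le> 2 * M * real (card S)"
  proof -
    define m where "m = real (card A)"
    define T where "T = A \<times> A"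
    define d :: "'g \<times> 'g \<Rightarrow> 'g" where "d = (\<lambda>(x, y). x - y)"
    define d' :: "'g \<times> 'g \<Rightarrow> 'g" where "d' = (\<lambda>(x, y). - x + y)"
    have mpos: "0 < m" using cA by (simp add: m_def)
    have finT: "finite T" and cT: "real (card T) = m\<^sup>2"
      using fin by (simp_all add: T_def m_def card_cartesian_product power2_eq_square)
    have r_alt: "r s = card {t \<in> T. d t = s}" for s
      unfolding r_def by (rule arg_cong[where f = card]) (auto simp: T_def d_def)
    have "difs A = d' ` T" by (simp add: difs_eq_image d'_def T_def)
    have "m ^ 4 = (\<Sum>s\<in>d' ` T. real (card {t \<in> T. d' t = s}))\<^sup>2"
      using sum_fibres[OF finT, of d'] cT by (simp flip: of_nat_sum power_mult)
    also have "\<dots> \<le> (\<Sum>s\<in>d' ` T. (real (card {t \<in> T. d' t = s}))\<^sup>2) * real (card (d' ` T))"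
      by (rule sum_squared_le_sum_of_squares)
    also have "(\<Sum>s\<in>d' ` T. (real (card {t \<in> T. d' t = s}))\<^sup>2) = real (card {(t, u) \<in> T \<times> T. d' t = d' u})"
      using sum_fibre_squares[OF finT, of d'] by (simp flip: of_nat_sum of_nat_power)
    \<comment> \<open>The equation x^(-1) y = u^(-1) v can be rearranged to y v^(-1) = x u^(-1), so
      both kinds of quotients have the same energy.\<close>
    also have "card {(t, u) \<in> T \<times> T. d' t = d' u} = card {(t, u) \<in> T \<times> T. d t = d u}"
    proof (rule bij_betw_same_card[of "\<lambda>((x, y), (u, v)). ((y, v), (x, u))"], rule bij_betwI[where g = "\<lambda>((x, y), (u, v)). ((u, x), (v, y))"])
      have key: "- x + y = - u + v \<longleftrightarrow> y - v = x - u" for x y u v :: 'g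
        unfolding group_eq_iff_minus_add diff_eq_eq
        by (simp add: diff_conv_add_uminus add.assoc del: add_uminus_conv_diff)
      show "(\<lambda>((x, y), (u, v)). ((y, v), (x, u))) \<in> {(t, u) \<in> T \<times> T. d' t = d' u} \<rightarrow> {(t, u) \<in> T \<times> T. d t = d u}"
        by (auto simp: T_def d_def d'_def key)
      show "(\<lambda>((x, y), (u, v)). ((u, x), (v, y))) \<in> {(t, u) \<in> T \<times> T. d t = d u} \<rightarrow> {(t, u) \<in> T \<times> T. d' t = d' u}"
        by (auto simp: T_def d_def d'_def key)
    qed auto
    also have "real (card {(t, u) \<in> T \<times> T. d t = d u}) = (\<Sum>s\<in>d ` T. (real (r s))\<^sup>2)"
      using sum_fibre_squares[OF finT, of d] unfolding r_alt by (simp flip: of_nat_sum of_nat_power)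
    also have "(\<Sum>s\<in>d ` T. (real (r s))\<^sup>2) * real (card (d' ` T)) \<le> (\<Sum>s\<in>d ` T. (real (r s))\<^sup>2) * (M * m)"
      by (rule mult_left_mono) (use M in \<open>auto simp: \<open>difs A = d' ` T\<close> m_def intro: sum_nonneg\<close>)
    finally have low: "m ^ 3 \<le> M * (\<Sum>s\<in>d ` T. (real (r s))\<^sup>2)"
      using mpos by (simp add: eval_nat_numeral mult_ac)
    \<comment> \<open>Each popular quotient contributes at most \<open>m\<^sup>2\<close>; the others
      together contribute at most the threshold times the number \<open>m\<^sup>2\<close> of
      pairs.\<close>
    have "(\<Sum>s\<in>d ` T. (real (r s))\<^sup>2) \<le> (\<Sum>s\<in>d ` T. (if s \<in> S then m\<^sup>2 else 0) + m / (2 * M) * real (r s))"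
    proof (rule sum_mono)
      fix s assume s: "s \<in> d ` T"
      show "(real (r s))\<^sup>2 \<le> (if s \<in> S then m\<^sup>2 else 0) + m / (2 * M) * real (r s)"
      proof (cases "s \<in> S")
        case True
        have "(real (r s))\<^sup>2 \<le> m\<^sup>2" using r_le[of s] by (simp add: m_def)
        thus ?thesis using True mpos Mpos by (simp add: add_increasing2)
      next
        case False
        hence "real (r s) \<le> m / (2 * M)" using s by (auto simp: S_def m_def d_def T_def)
        hence "real (r s) * real (r s) \<le> m / (2 * M) * real (r s)" by (rule mult_right_mono) simp
        thus ?thesis using False by (simp add: power2_eq_square)
      qed
    qed
    also have "\<dots> = m\<^sup>2 * real (card S) + m / (2 * M) * m\<^sup>2"
    proof -
      have "(\<Sum>s\<in>d ` T. real (r s)) = m\<^sup>2"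
        using sum_fibres[OF finT, of d] cT unfolding r_alt by (simp flip: of_nat_sum)
      moreover have "(\<Sum>s\<in>d ` T. if s \<in> S then m\<^sup>2 else 0) = m\<^sup>2 * real (card S)"
      proof -
        have "{s \<in> d ` T. s \<in> S} = S" by (auto simp: S_def d_def T_def)
        thus ?thesis using finT by (subst sum.inter_filter[symmetric]) auto
      qed
      ultimately show ?thesis by (simp only: sum.distrib sum_distrib_left[symmetric])
    qed
    finally have "M * (\<Sum>s\<in>d ` T. (real (r s))\<^sup>2) \<le> M * (m\<^sup>2 * real (card S) + m / (2 * M) * m\<^sup>2)"
      using Mpos by (simp add: mult_le_cancel_left)
    hence "m ^ 3 \<le> M * (m\<^sup>2 * real (card S) + m / (2 * M) * m\<^sup>2)" using low by linarith
    also have "\<dots> = m\<^sup>2 * (M * real (card S) + m / 2)"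
      using Mpos by (simp add: algebra_simps)
    finally have "m\<^sup>2 * m \<le> m\<^sup>2 * (M * real (card S) + m / 2)"
      by (simp add: eval_nat_numeral)
    hence "m \<le> M * real (card S) + m / 2" using mpos by (simp add: mult_le_cancel_left)
    thus ?thesis by (simp add: m_def)
  qed
  have "real (card (sandwich A S k)) \<le> (2 * M\<^sup>2) ^ k * (M * real (card A))" for k
  proof (induction k)
    case 0
    have "sandwich A S 0 = difs A" by (auto simp: sandwich_def difs_def)
    thus ?case using M by simp
  next
    case (Suc k)
    \<comment> \<open>If \<open>s = u - v\<close>, the word \<open>- a + x + s + b\<close> equals
      \<open>(- a + x + u) + (- v + b)\<close>, and a popular \<open>s\<close> offers at least |A| /
      (2 M) such splittings.\<close>
    have "real (card (sandwich A S (Suc k))) * (real (card A) / (2 * M))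
        \<le> real (card (sandwich A S k \<times> difs A))"
    proof (rule card_fibres_le[where h = "\<lambda>(u, d). u + d"])
      show "finite (sandwich A S k \<times> difs A)" using fin finS by (simp add: finite_sandwich finite_difs)
      fix w assume "w \<in> sandwich A S (Suc k)"
      then obtain a x s b where w: "w = - a + (x + s) + b" "a \<in> A" "b \<in> A" "x \<in> nfold S k" "s \<in> S"
        by (auto simp: sandwich_def)
      have eq: "- a + x + u + (- v + b) = w" if "u - v = s" for u v
      proof -
        have "u + (- v + b) = s + b" using that by (metis add.assoc diff_conv_add_uminus)
        thus ?thesis by (simp add: w(1) add.assoc)
      qed
      have "r s \<le> card {t \<in> sandwich A S k \<times> difs A. (case t of (u, d) \<Rightarrow> u + d) = w}"
        unfolding r_def
      proof (rule card_inj_on_le)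
        show "inj_on (\<lambda>(u, v). (- a + x + u, - v + b)) {(x, y) \<in> A \<times> A. x - y = s}"
          by (auto simp: inj_on_def)
        show "(\<lambda>(u, v). (- a + x + u, - v + b)) ` {(x, y) \<in> A \<times> A. x - y = s}
            \<subseteq> {t \<in> sandwich A S k \<times> difs A. (case t of (u, d) \<Rightarrow> u + d) = w}"
          using w eq by (auto simp: sandwich_def difs_def)
        show "finite {t \<in> sandwich A S k \<times> difs A. (case t of (u, d) \<Rightarrow> u + d) = w}"
          using fin finS by (simp add: finite_sandwich finite_difs)
      qed
      thus "real (card A) / (2 * M)
          \<le> real (card {t \<in> sandwich A S k \<times> difs A. (case t of (u, d) \<Rightarrow> u + d) = w})"
        using w(5) by (simp add: S_def)
    qed
    also have "\<dots> = real (card (sandwich A S k)) * real (card (difs A))"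
      by (simp add: card_cartesian_product)
    also have "\<dots> \<le> ((2 * M\<^sup>2) ^ k * (M * real (card A))) * (M * real (card A))"
      by (intro mult_mono Suc.IH M) (use Mpos in auto)
    also have "\<dots> = ((2 * M\<^sup>2) ^ Suc k * (M * real (card A))) * (real (card A) / (2 * M))"
      using Mpos by (simp add: power2_eq_square)
    finally show ?case by (rule mult_right_le_imp_le) (use Mpos cA in auto)
  qed
  with that[of S] finS zeroS symS cardS show thesis by (auto simp: S_def)
qed

section \<open>Convolution of finitely supported measures\<close>

definition supp :: "('g \<Rightarrow> real) \<Rightarrow> 'g set" where
  "supp f = {x. f x \<noteq> 0}"

definition prob :: "('g \<Rightarrow> real) \<Rightarrow> bool" where
  "prob f \<longleftrightarrow> finite (supp f) \<and> (\<forall>x. 0 \<le> f x) \<and> sum f (supp f) = 1"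

text \<open>The sum runs over the support because a \<open>sum\<close> over an infinite set is 0;
  for finitely supported functions this is the integral against the measure
  \<open>f\<close>.\<close>

definition integ :: "('g \<Rightarrow> real) \<Rightarrow> ('g \<Rightarrow> real) \<Rightarrow> real" where
  "integ f h = (\<Sum>x\<in>supp f. f x * h x)"

definition conv :: "('g::group_add \<Rightarrow> real) \<Rightarrow> ('g \<Rightarrow> real) \<Rightarrow> 'g \<Rightarrow> real" where
  "conv f g w = (\<Sum>y\<in>supp f. f y * g (- y + w))"

definition refl_fun :: "('g::group_add \<Rightarrow> real) \<Rightarrow> 'g \<Rightarrow> real" where
  "refl_fun f x = f (- x)"

lemma finite_supp: "prob f \<Longrightarrow> finite (supp f)"
  and prob_nonneg: "prob f \<Longrightarrow> 0 \<le> f x"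
  and prob_sum: "prob f \<Longrightarrow> sum f (supp f) = 1"
  by (auto simp: prob_def)

lemma integ_superset:
  assumes "finite D" "supp f \<subseteq> D"
  shows "integ f h = (\<Sum>x\<in>D. f x * h x)"
  unfolding integ_def using assms by (intro sum.mono_neutral_left) (auto simp: supp_def)

lemma integ_mono: "prob f \<Longrightarrow> (\<And>x. h x \<le> k x) \<Longrightarrow> integ f h \<le> integ f k"
  unfolding integ_def by (intro sum_mono mult_left_mono) (auto simp: prob_nonneg)

lemma integ_const: "prob f \<Longrightarrow> integ f (\<lambda>_. c) = c"
  unfolding integ_def by (simp add: prob_sum flip: sum_distrib_right)

lemma integ_nonneg: "prob f \<Longrightarrow> (\<And>x. 0 \<le> h x) \<Longrightarrow> 0 \<le> integ f h"
  unfolding integ_def by (intro sum_nonneg mult_nonneg_nonneg) (auto simp: prob_nonneg)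

lemma integ_mult_left: "integ f (\<lambda>x. c * h x) = c * integ f h"
  by (simp add: integ_def sum_distrib_left mult_ac)

lemma integ_mult_right: "integ f (\<lambda>x. h x * c) = integ f h * c"
  by (simp add: integ_def sum_distrib_left mult_ac)

lemma integ_sum: "integ f (\<lambda>x. \<Sum>i\<in>I. h i x) = (\<Sum>i\<in>I. integ f (h i))"
  unfolding integ_def sum_distrib_left by (rule sum.swap)

lemma integ_swap: "integ f (\<lambda>x. integ g (\<lambda>y. h x y)) = integ g (\<lambda>y. integ f (\<lambda>x. h x y))"
  unfolding integ_def sum_distrib_left by (subst sum.swap) (simp add: mult_ac)

lemma integ_indicator_single: "finite (supp f) \<Longrightarrow> integ f (\<lambda>x. if x = w then 1 else 0) = f w"
proof -
  assume "finite (supp f)"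
  hence "integ f (\<lambda>x. if x = w then 1 else 0) = (\<Sum>x\<in>insert w (supp f). f x * (if x = w then 1 else 0))"
    by (intro integ_superset) auto
  also have "\<dots> = f w" using \<open>finite (supp f)\<close> by (subst sum.remove[of _ w]) auto
  finally show ?thesis .
qed

lemma supp_refl_fun: "supp (refl_fun f) = uminus ` supp f" for f :: "'g::group_add \<Rightarrow> real"
proof
  show "supp (refl_fun f) \<subseteq> uminus ` supp f"
  proof
    fix x assume "x \<in> supp (refl_fun f)"
    hence "x = - (- x)" "- x \<in> supp f" by (auto simp: supp_def refl_fun_def)
    thus "x \<in> uminus ` supp f" by blast
  qed
qed (auto simp: supp_def refl_fun_def)

lemma integ_refl_fun: "integ (refl_fun f) h = integ f (\<lambda>x. h (- x))" for f :: "'g::group_add \<Rightarrow> real"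
  unfolding integ_def supp_refl_fun by (subst sum.reindex) (auto simp: refl_fun_def)

lemma prob_refl_fun: "prob f \<Longrightarrow> prob (refl_fun f)" for f :: "'g::group_add \<Rightarrow> real"
proof -
  assume f: "prob f"
  have "sum (refl_fun f) (supp (refl_fun f)) = sum f (supp f)"
    unfolding supp_refl_fun by (subst sum.reindex) (auto simp: refl_fun_def)
  thus ?thesis using f by (simp add: prob_def supp_refl_fun) (simp add: refl_fun_def)
qed

lemma supp_conv: "supp (conv f g) \<subseteq> (\<lambda>(y, z). y + z) ` (supp f \<times> supp g)"
proof
  fix w assume "w \<in> supp (conv f g)"
  hence "(\<Sum>y\<in>supp f. f y * g (- y + w)) \<noteq> 0" by (simp add: supp_def conv_def)
  then obtain y where "y \<in> supp f" "f y * g (- y + w) \<noteq> 0" by (meson sum.neutral)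
  thus "w \<in> (\<lambda>(y, z). y + z) ` (supp f \<times> supp g)"
    by (intro image_eqI[of _ _ "(y, - y + w)"]) (auto simp: supp_def)
qed

lemma finite_supp_conv: "finite (supp f) \<Longrightarrow> finite (supp g) \<Longrightarrow> finite (supp (conv f g))"
  by (rule finite_subset[OF supp_conv]) simp

lemma integ_conv:
  assumes "finite (supp f)" "finite (supp g)"
  shows "integ (conv f g) h = integ f (\<lambda>y. integ g (\<lambda>z. h (y + z)))"
proof -
  define D where "D = (\<lambda>(y, z). y + z) ` (supp f \<times> supp g)"
  have finD: "finite D" using assms by (simp add: D_def)
  have inner: "(\<Sum>w\<in>D. g (- y + w) * h w) = integ g (\<lambda>z. h (y + z))" if y: "y \<in> supp f" for y
  proof -
    have "(\<Sum>w\<in>D. g (- y + w) * h w) = (\<Sum>w\<in>(+) y ` supp g. g (- y + w) * h w)"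
    proof (rule sum.mono_neutral_right[OF finD])
      show "(+) y ` supp g \<subseteq> D" using y by (auto simp: D_def)
      show "\<forall>w\<in>D - (+) y ` supp g. g (- y + w) * h w = 0"
      proof
        fix w assume w: "w \<in> D - (+) y ` supp g"
        have "- y + w \<notin> supp g"
        proof
          assume "- y + w \<in> supp g"
          hence "y + (- y + w) \<in> (+) y ` supp g" by (rule imageI)
          thus False using w by (simp add: add.assoc[symmetric])
        qed
        thus "g (- y + w) * h w = 0" by (simp add: supp_def)
      qed
    qed
    also have "\<dots> = integ g (\<lambda>z. h (y + z))"
      unfolding integ_def by (subst sum.reindex) (auto simp: inj_on_def add.assoc[symmetric])
    finally show ?thesis .
  qed
  have "integ (conv f g) h = (\<Sum>w\<in>D. conv f g w * h w)"
    by (rule integ_superset) (use finD supp_conv in \<open>auto simp: D_def\<close>)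
  also have "\<dots> = (\<Sum>w\<in>D. \<Sum>y\<in>supp f. f y * (g (- y + w) * h w))"
    by (simp add: conv_def sum_distrib_right mult.assoc)
  also have "\<dots> = (\<Sum>y\<in>supp f. \<Sum>w\<in>D. f y * (g (- y + w) * h w))" by (rule sum.swap)
  also have "\<dots> = integ f (\<lambda>y. integ g (\<lambda>z. h (y + z)))"
    unfolding integ_def[of f] by (rule sum.cong) (simp_all add: inner flip: sum_distrib_left)
  finally show ?thesis .
qed

lemma conv_eq_integ:
  assumes "finite (supp f)" "finite (supp g)"
  shows "conv f g w = integ f (\<lambda>y. integ g (\<lambda>z. if y + z = w then 1 else 0))"
  using integ_indicator_single[OF finite_supp_conv[OF assms], of w] integ_conv[OF assms] by simp

lemma prob_conv:
  assumes "prob f" "prob g"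
  shows "prob (conv f g)"
proof -
  have "sum (conv f g) (supp (conv f g)) = integ (conv f g) (\<lambda>_. 1)" by (simp add: integ_def)
  also have "\<dots> = 1" using assms by (simp add: integ_conv finite_supp integ_const)
  finally have "sum (conv f g) (supp (conv f g)) = 1" .
  moreover have "0 \<le> conv f g w" for w
    unfolding conv_def by (intro sum_nonneg mult_nonneg_nonneg) (use assms in \<open>auto simp: prob_nonneg\<close>)
  ultimately show ?thesis using assms by (simp add: prob_def finite_supp_conv)
qed

text \<open>Inverting y^(-1) z gives z^(-1) y. With \<open>f = g\<close> this is the symmetry of the
  first measure of the walk, which carries over to all later ones.\<close>

lemma conv_refl_fun_uminus:
  fixes f g :: "'g::group_add \<Rightarrow> real"
  assumes "finite (supp f)" "finite (supp g)"
  shows "conv (refl_fun f) g (- w) = conv (refl_fun g) f w"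
proof -
  have eq: "- y + z = - w \<longleftrightarrow> - z + y = w" for y z
    by (metis minus_add minus_minus)
  have "conv (refl_fun f) g (- w) = integ f (\<lambda>y. integ g (\<lambda>z. if - y + z = - w then 1 else 0))"
    using assms by (simp add: conv_eq_integ supp_refl_fun integ_refl_fun)
  also have "\<dots> = integ g (\<lambda>z. integ f (\<lambda>y. if - z + y = w then 1 else 0))"
    unfolding eq by (rule integ_swap)
  also have "\<dots> = conv (refl_fun g) f w"
    using assms by (simp add: conv_eq_integ supp_refl_fun integ_refl_fun)
  finally show ?thesis .
qed

lemma sum_translate_le:
  fixes f :: "'g::group_add \<Rightarrow> real"
  assumes "finite (supp f)" "finite D" "\<And>x. 0 \<le> h (f x)" "h 0 = (0::real)" "inj \<phi>"
  shows "(\<Sum>y\<in>D. h (f (\<phi> y))) \<le> (\<Sum>x\<in>supp f. h (f x))"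
proof -
  have "(\<Sum>y\<in>D. h (f (\<phi> y))) = (\<Sum>x\<in>\<phi> ` D. h (f x))"
    using assms(5) by (subst sum.reindex) (auto intro: inj_on_subset)
  also have "\<dots> \<le> (\<Sum>x\<in>\<phi> ` D \<union> supp f. h (f x))"
    by (rule sum_mono2) (use assms in auto)
  also have "\<dots> = (\<Sum>x\<in>supp f. h (f x))"
    by (rule sum.mono_neutral_right) (use assms in \<open>auto simp: supp_def\<close>)
  finally show ?thesis .
qed

lemma inj_uminus_add_right: "inj (\<lambda>y. - y + w)" for w :: "'g::group_add"
  by (auto simp: inj_def)

text \<open>Each product is at most the mean of two squares, and both families of squares sum to at
  most the squared L2 norm. Hence one convolution turns an L2 bound into a supremum bound.\<close>

lemma conv_le_integ_self:
  assumes "prob f"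
  shows "conv f f w \<le> integ f f"
proof -
  have "conv f f w \<le> (\<Sum>y\<in>supp f. (f y)\<^sup>2 / 2 + (f (- y + w))\<^sup>2 / 2)"
    unfolding conv_def
  proof (rule sum_mono)
    fix y
    show "f y * f (- y + w) \<le> (f y)\<^sup>2 / 2 + (f (- y + w))\<^sup>2 / 2"
      using sum_squares_bound[of "f y" "f (- y + w)"] by simp
  qed
  also have "\<dots> = integ f f / 2 + (\<Sum>y\<in>supp f. (f (- y + w))\<^sup>2) / 2"
    by (simp add: sum.distrib integ_def power2_eq_square flip: sum_divide_distrib)
  also have "(\<Sum>y\<in>supp f. (f (- y + w))\<^sup>2) \<le> (\<Sum>y\<in>supp f. (f y)\<^sup>2)"
    by (rule sum_translate_le[where h = "\<lambda>x. x\<^sup>2"])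
       (use assms in \<open>auto simp: finite_supp inj_uminus_add_right\<close>)
  finally show ?thesis by (simp add: integ_def power2_eq_square)
qed

lemma card_superlevel_le:
  assumes "prob f" "0 < t"
  shows "finite {x. t \<le> f x}" "real (card {x. t \<le> f x}) \<le> 1 / t"
proof -
  have sub: "{x. t \<le> f x} \<subseteq> supp f" using assms(2) by (auto simp: supp_def)
  thus fin: "finite {x. t \<le> f x}" using assms(1) by (metis finite_subset finite_supp)
  have "real (card {x. t \<le> f x}) * t = (\<Sum>x\<in>{x. t \<le> f x}. t)" by simp
  also have "\<dots> \<le> sum f {x. t \<le> f x}" by (rule sum_mono) simp
  also have "\<dots> \<le> sum f (supp f)"
    by (rule sum_mono2) (use assms sub in \<open>auto simp: finite_supp prob_nonneg\<close>)
  finally show "real (card {x. t \<le> f x}) \<le> 1 / t"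
    using assms by (simp add: prob_sum field_simps)
qed

text \<open>Stability of the \<open>L\<^sup>2\<close> norm under convolution is turned into a dense graph on a level set.\<close>

lemma level_set_edges:
  fixes f :: "'g::group_add \<Rightarrow> real" and \<kappa> K :: real
  assumes f: "prob f" and sym: "\<And>x. f (- x) = f x"
    and \<kappa>: "0 < \<kappa>" "\<And>x. f x \<le> \<kappa>" "\<And>x. conv f f x \<le> \<kappa>" and K: "0 < K"
    and stable: "\<kappa> / K \<le> integ (conv f f) (conv f f)"
  defines "t \<equiv> \<kappa> / (6 * K)"
  shows "1 / (2 * K * \<kappa>\<^sup>2) \<le> real (card {(x, y) \<in> {x. t \<le> f x} \<times> {x. t \<le> f x}. - x + y \<in> {x. t \<le> conv f f x}})"
proof -
  define g where "g = conv f f"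
  define V where "V = {x. t \<le> f x}"
  define E where "E = {(x, y) \<in> V \<times> V. - x + y \<in> {x. t \<le> g x}}"
  have t: "0 < t" using \<kappa>(1) K by (simp add: t_def)
  have g: "prob g" unfolding g_def using f by (rule prob_conv[OF f])
  have VS: "V \<subseteq> supp f" using t by (auto simp: V_def supp_def)
  have fin: "finite (supp f)" using f by (rule finite_supp)
  have refl: "refl_fun f = f" by (rule ext) (simp add: refl_fun_def sym)
  have mass1: "(\<Sum>y\<in>supp f. g (- x + y)) \<le> 1" for x
    using sum_translate_le[where h = "\<lambda>x. x" and \<phi> = "\<lambda>y. - x + y", OF finite_supp[OF g] fin]
    by (simp add: prob_nonneg[OF g] prob_sum[OF g] inj_def)
  have mass2: "(\<Sum>x\<in>supp f. g (- x + y)) \<le> 1" for y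
    using sum_translate_le[where h = "\<lambda>x. x", OF finite_supp[OF g] fin _ _ inj_uminus_add_right]
    by (simp add: prob_nonneg[OF g] prob_sum[OF g])
  have "integ g g = integ (conv (refl_fun f) f) g" by (simp add: g_def refl)
  also have "\<dots> = integ f (\<lambda>x. integ f (\<lambda>y. g (- x + y)))"
    using fin by (simp add: integ_conv supp_refl_fun integ_refl_fun)
  also have "\<dots> = (\<Sum>x\<in>supp f. \<Sum>y\<in>supp f. f x * f y * g (- x + y))"
    by (simp add: integ_def sum_distrib_left mult.assoc)
  \<comment> \<open>On an edge all three factors are at most \<open>\<kappa>\<close>. Off the edges
    one factor is at most \<open>t\<close> and the other two have total mass at most 1, so the
    non-edges contribute at most \<open>3 * t = \<kappa> / (2 * K)\<close>, half of the assumed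
    lower bound.\<close>
  also have "\<dots> \<le> (\<Sum>x\<in>supp f. \<Sum>y\<in>supp f. (if (x, y) \<in> E then \<kappa> ^ 3 else 0)
      + (t * f y) * g (- x + y) + (t * f x) * g (- x + y) + (t * f x) * f y)"
  proof (intro sum_mono)
    fix x y
    have nn: "0 \<le> f x" "0 \<le> f y" "0 \<le> g (- x + y)" by (auto simp: prob_nonneg[OF f] prob_nonneg[OF g])
    show "f x * f y * g (- x + y) \<le> (if (x, y) \<in> E then \<kappa> ^ 3 else 0)
      + (t * f y) * g (- x + y) + (t * f x) * g (- x + y) + (t * f x) * f y"
    proof (cases "(x, y) \<in> E")
      case True
      have "f x * f y * g (- x + y) \<le> \<kappa> * \<kappa> * \<kappa>"
        by (intro mult_mono) (use nn \<kappa> in \<open>auto simp: g_def\<close>)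
      thus ?thesis using True nn t by (simp add: power3_eq_cube add_increasing2)
    next
      case False
      then consider "f x \<le> t" | "f y \<le> t" | "g (- x + y) \<le> t" by (fastforce simp: E_def V_def)
      thus ?thesis
      proof cases
        case 1
        have "f x * (f y * g (- x + y)) \<le> t * (f y * g (- x + y))"
          by (rule mult_right_mono[OF 1]) (use nn in simp)
        thus ?thesis using False nn t by (simp add: mult.assoc add_increasing2)
      next
        case 2
        have "f y * (f x * g (- x + y)) \<le> t * (f x * g (- x + y))"
          by (rule mult_right_mono[OF 2]) (use nn in simp)
        hence "f x * f y * g (- x + y) \<le> (t * f x) * g (- x + y)" by (simp add: mult_ac)
        moreover have "0 \<le> (t * f y) * g (- x + y)" "0 \<le> (t * f x) * f y" using nn t by simp_all
        ultimately show ?thesis using False by simp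
      next
        case 3
        have "g (- x + y) * (f x * f y) \<le> t * (f x * f y)"
          by (rule mult_right_mono[OF 3]) (use nn in simp)
        hence "f x * f y * g (- x + y) \<le> (t * f x) * f y" by (simp add: mult_ac)
        moreover have "0 \<le> (t * f y) * g (- x + y)" "0 \<le> (t * f x) * g (- x + y)" using nn t by simp_all
        ultimately show ?thesis using False by simp
      qed
    qed
  qed
  also have "\<dots> = \<kappa> ^ 3 * real (card E) + t * (\<Sum>y\<in>supp f. f y * (\<Sum>x\<in>supp f. g (- x + y)))
      + t * (\<Sum>x\<in>supp f. f x * (\<Sum>y\<in>supp f. g (- x + y))) + t * (\<Sum>x\<in>supp f. f x * (\<Sum>y\<in>supp f. f y))"
  proof -
    have "(\<Sum>x\<in>supp f. \<Sum>y\<in>supp f. if (x, y) \<in> E then \<kappa> ^ 3 else 0) = \<kappa> ^ 3 * real (card E)"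
    proof -
      have "(\<Sum>x\<in>supp f. \<Sum>y\<in>supp f. if (x, y) \<in> E then \<kappa> ^ 3 else 0)
          = (\<Sum>p\<in>supp f \<times> supp f. if p \<in> E then \<kappa> ^ 3 else 0)"
        by (simp add: sum.cartesian_product)
      also have "\<dots> = (\<Sum>p\<in>{p \<in> supp f \<times> supp f. p \<in> E}. \<kappa> ^ 3)"
        using fin by (intro sum.inter_filter[symmetric]) simp
      also have "{p \<in> supp f \<times> supp f. p \<in> E} = E" using VS by (auto simp: E_def)
      finally show ?thesis by simp
    qed
    moreover have "(\<Sum>x\<in>supp f. \<Sum>y\<in>supp f. (t * f y) * g (- x + y)) = t * (\<Sum>y\<in>supp f. f y * (\<Sum>x\<in>supp f. g (- x + y)))"
      by (subst sum.swap) (simp add: sum_distrib_left mult.assoc)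
    ultimately show ?thesis by (simp add: sum.distrib sum_distrib_left mult.assoc)
  qed
  also have "\<dots> \<le> \<kappa> ^ 3 * real (card E) + t * 1 + t * 1 + t * 1"
  proof -
    have "(\<Sum>x\<in>supp f. f x * w x) \<le> 1" if "\<And>x. w x \<le> 1" for w
    proof -
      have "(\<Sum>x\<in>supp f. f x * w x) \<le> (\<Sum>x\<in>supp f. f x * 1)"
        by (intro sum_mono mult_left_mono that) (simp add: prob_nonneg[OF f])
      thus ?thesis by (simp add: prob_sum[OF f])
    qed
    thus ?thesis using t mass1 mass2 prob_sum[OF f]
      by (intro add_mono mult_left_mono order_refl) auto
  qed
  finally have "\<kappa> / K \<le> \<kappa> ^ 3 * real (card E) + 3 * t" using stable by (simp add: g_def)
  hence "\<kappa> / (2 * K) \<le> \<kappa> ^ 3 * real (card E)" using K by (simp add: t_def field_simps)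
  hence "(1 / (2 * K * \<kappa>\<^sup>2)) * \<kappa> ^ 3 \<le> real (card E) * \<kappa> ^ 3"
    using \<kappa>(1) K by (simp add: power2_eq_square power3_eq_cube field_simps)
  hence "1 / (2 * K * \<kappa>\<^sup>2) \<le> real (card E)" by (rule mult_right_le_imp_le) (use \<kappa>(1) in simp)
  thus ?thesis by (simp add: E_def V_def g_def)
qed

section \<open>Mass on cosets\<close>

definition coset :: "'g::group_add \<Rightarrow> 'g set \<Rightarrow> 'g set" where
  "coset x H = {z. - x + z \<in> H}"

definition mass :: "('g \<Rightarrow> real) \<Rightarrow> 'g set \<Rightarrow> real" where
  "mass f X = integ f (indicator X)"

text \<open>Translating x H by y^(-1) gives another left coset, so the mass under the convolution is
  an \<open>f\<close>-average of coset masses under \<open>g\<close>. Thus convolving on the left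
  cannot raise the largest coset mass, and concentration found far along the walk is already present
  in the initial measure.\<close>

lemma mass_coset_conv_le:
  assumes "prob f" "prob g" "\<And>x. mass g (coset x H) \<le> s"
  shows "mass (conv f g) (coset x H) \<le> s"
proof -
  have "mass (conv f g) (coset x H) = integ f (\<lambda>y. mass g (coset (- y + x) H))"
    using assms(1,2)
    by (simp add: mass_def integ_conv finite_supp coset_def indicator_def[abs_def] minus_add add.assoc)
  also have "\<dots> \<le> integ f (\<lambda>_. s)" by (rule integ_mono) (use assms in auto)
  finally show ?thesis using assms(1) by (simp add: integ_const)
qed

lemma mass_nonneg: "prob f \<Longrightarrow> 0 \<le> mass f X"
  unfolding mass_def by (rule integ_nonneg) auto

lemma sum_le_mass:
  assumes "prob f" "finite X" "X \<subseteq> Z"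
  shows "sum f X \<le> mass f Z"
proof -
  have "sum f X \<le> (\<Sum>x\<in>supp f \<union> X. f x * indicator Z x)"
  proof -
    have "sum f X = (\<Sum>x\<in>X. f x * indicator Z x)" using assms(3) by (intro sum.cong) (auto simp: indicator_def)
    also have "\<dots> \<le> (\<Sum>x\<in>supp f \<union> X. f x * indicator Z x)"
      by (rule sum_mono2) (use assms in \<open>auto simp: finite_supp prob_nonneg\<close>)
    finally show ?thesis .
  qed
  also have "\<dots> = mass f Z" unfolding mass_def
    by (rule integ_superset[symmetric]) (use assms in \<open>auto simp: finite_supp\<close>)
  finally show ?thesis .
qed

text \<open>Covering without choosing coset representatives: count the pairs \<open>(x, b)\<close> by their sum.\<close>

lemma sum_le_mass_coset:
  fixes f :: "'g::group_add \<Rightarrow> real"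
  assumes f: "prob f" and fin: "finite X" "finite B" "finite W"
    and B: "\<And>b. b \<in> B \<Longrightarrow> - b \<in> H" and W: "\<And>x b. x \<in> X \<Longrightarrow> b \<in> B \<Longrightarrow> x + b \<in> W"
    and s: "\<And>x. mass f (coset x H) \<le> s"
  shows "sum f X * real (card B) \<le> s * real (card W)"
proof -
  have "sum f X * real (card B) = (\<Sum>x\<in>X. \<Sum>b\<in>B. f x)" by (simp add: sum_distrib_right mult.commute)
  also have "\<dots> = (\<Sum>p\<in>X \<times> B. f (fst p))"
    unfolding sum.cartesian_product by (rule sum.cong) auto
  also have "\<dots> = (\<Sum>w\<in>W. \<Sum>p\<in>{p \<in> X \<times> B. fst p + snd p = w}. f (fst p))"
    by (rule sum.group[symmetric]) (use fin W in auto)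
  also have "\<dots> \<le> (\<Sum>w\<in>W. s)"
  proof (rule sum_mono)
    fix w
    \<comment> \<open>For fixed \<open>w\<close> the element \<open>x\<close> determines
      \<open>b\<close>, so no \<open>x\<close> is counted twice; and all these \<open>x\<close> lie
      in the coset of \<open>w\<close>.\<close>
    have "(\<Sum>p\<in>{p \<in> X \<times> B. fst p + snd p = w}. f (fst p)) = sum f (fst ` {p \<in> X \<times> B. fst p + snd p = w})"
      by (subst sum.reindex) (auto simp: inj_on_def)
    also have "\<dots> \<le> mass f (coset w H)"
    proof (rule sum_le_mass[OF f])
      show "fst ` {p \<in> X \<times> B. fst p + snd p = w} \<subseteq> coset w H"
      proof clarsimp
        fix x b assume "x \<in> X" "b \<in> B"
        have "- (x + b) + x = - b" by (simp add: minus_add add.assoc)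
        thus "x \<in> coset (x + b) H" using B[OF \<open>b \<in> B\<close>] by (simp add: coset_def)
      qed
    qed (use fin in simp)
    also have "\<dots> \<le> s" by (rule s)
    finally show "(\<Sum>p\<in>{p \<in> X \<times> B. fst p + snd p = w}. f (fst p)) \<le> s" .
  qed
  finally show ?thesis by (simp add: mult.commute)
qed

section \<open>Return rates of bijections\<close>

text \<open>The fields are given by carriers, so their affine maps have no type of their own.
  Extended by the identity outside the carrier they become bijections of the whole type, and the
  results for the class of groups apply to them.\<close>

typedef 'a bijection = "{f :: 'a \<Rightarrow> 'a. bij f}" morphisms app Bijection
  by (rule exI[of _ id]) simp

lemma bij_app: "bij (app g)"
  using app[of g] by simp

text \<open>Composition is written additively because \<^class>\<open>group_add\<close> is the class of groups that need
  not be commutative.\<close>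

instantiation bijection :: (type) group_add
begin

definition "0 = Bijection id"
definition "g + h = Bijection (app g \<circ> app h)"
definition "- g = Bijection (inv_into UNIV (app g))"
definition "g - h = g + - h" for g h :: "'a bijection"

lemma app_zero_fun: "app 0 = id"
  by (simp add: zero_bijection_def Bijection_inverse)

lemma app_plus_fun: "app (g + h) = app g \<circ> app h"
  by (simp add: plus_bijection_def Bijection_inverse bij_app bij_comp)

lemma app_uminus_fun: "app (- g) = inv_into UNIV (app g)"
  by (simp add: uminus_bijection_def Bijection_inverse bij_app bij_imp_bij_inv)

instance
proof
  fix a b c :: "'a bijection"
  show "a + b + c = a + (b + c)"
    by (simp add: app_inject[symmetric] app_plus_fun comp_assoc)
  show "0 + a = a" "a + 0 = a"
    by (simp_all add: app_inject[symmetric] app_plus_fun app_zero_fun)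
  show "- a + a = 0"
    by (simp add: app_inject[symmetric] app_plus_fun app_zero_fun app_uminus_fun bij_is_inj bij_app)
  show "a + - b = a - b" by (simp add: minus_bijection_def)
qed

end

lemma app_zero [simp]: "app 0 x = x"
  by (simp add: app_zero_fun)

lemma app_plus [simp]: "app (g + h) x = app g (app h x)"
  by (simp add: app_plus_fun)

lemma app_uminus_app [simp]: "app (- g) (app g x) = x"
  by (metis app_plus app_zero ab_left_minus)

lemma app_app_uminus [simp]: "app g (app (- g) x) = x"
  by (metis app_plus app_zero add.right_inverse)

lemma app_eq_iff [simp]: "app g x = app g y \<longleftrightarrow> x = y"
  by (metis app_uminus_app)

lemma bijection_eqI: "(\<And>x. app g x = app h x) \<Longrightarrow> g = h"
  by (metis app_inject ext)

section \<open>Return rates and the walk obtained by repeated squaring\<close>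

definition returns :: "'a set \<Rightarrow> 'a bijection \<Rightarrow> real" where
  "returns Y g = real (card {y \<in> Y. app g y \<in> Y})"

lemma returns_alt: "finite Y \<Longrightarrow> returns Y g = (\<Sum>y\<in>Y. indicator Y (app g y))"
  by (simp add: returns_def indicator_def[abs_def] of_bool_def sum.If_cases Int_def)

lemma returns_uminus: "returns Y (- g) = returns Y g"
proof -
  have "{y \<in> Y. app (- g) y \<in> Y} = app g ` {y \<in> Y. app g y \<in> Y}"
    by (auto simp: image_iff) (metis app_app_uminus)
  thus ?thesis by (simp add: returns_def card_image inj_on_def)
qed

text \<open>Cauchy-Schwarz over the points \<open>w\<close> of \<open>Y\<close>. If z^(-1) w and
  z'^(-1) w both lie in \<open>Y\<close>, then z^(-1) z' takes the second to the first, so the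
  number of such \<open>w\<close> is at most the number of returns of z^(-1) z'.\<close>

lemma returns_conv_ge:
  assumes f: "prob f" and Y: "finite Y"
  shows "(integ f (returns Y))\<^sup>2 \<le> real (card Y) * integ (conv (refl_fun f) f) (returns Y)"
proof -
  define F where "F w = integ f (\<lambda>z. indicator Y (app (- z) w))" for w
  have "integ f (returns Y) = integ f (\<lambda>z. returns Y (- z))" by (simp add: returns_uminus)
  also have "\<dots> = (\<Sum>w\<in>Y. F w)" by (simp add: F_def returns_alt[OF Y] integ_sum)
  finally have "(integ f (returns Y))\<^sup>2 \<le> (\<Sum>w\<in>Y. (F w)\<^sup>2) * real (card Y)"
    by (simp add: sum_squared_le_sum_of_squares)
  moreover have "(\<Sum>w\<in>Y. (F w)\<^sup>2) \<le> integ (conv (refl_fun f) f) (returns Y)"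
  proof -
    have "(\<Sum>w\<in>Y. (F w)\<^sup>2) = (\<Sum>w\<in>Y. integ f (\<lambda>z. integ f (\<lambda>z'. indicator Y (app (- z) w) * indicator Y (app (- z') w))))"
      by (simp add: F_def power2_eq_square integ_mult_left integ_mult_right)
    also have "\<dots> = integ f (\<lambda>z. integ f (\<lambda>z'. \<Sum>w\<in>Y. indicator Y (app (- z) w) * indicator Y (app (- z') w)))"
      by (simp add: integ_sum)
    also have "\<dots> \<le> integ f (\<lambda>z. integ f (\<lambda>z'. returns Y (- z + z')))"
    proof (intro integ_mono f)
      fix z z'
      have "(\<Sum>w\<in>Y. indicator Y (app (- z) w) * indicator Y (app (- z') w) :: real)
          = real (card {w \<in> Y. app (- z) w \<in> Y \<and> app (- z') w \<in> Y})"
      proof -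
        have "(\<Sum>w\<in>Y. indicator Y (app (- z) w) * indicator Y (app (- z') w) :: real)
            = (\<Sum>w\<in>Y. if app (- z) w \<in> Y \<and> app (- z') w \<in> Y then 1 else 0)"
          by (rule sum.cong) (auto simp: indicator_def)
        thus ?thesis using Y by (simp add: sum.If_cases Int_def)
      qed
      also have "\<dots> \<le> returns Y (- z + z')"
        unfolding returns_def of_nat_le_iff
        by (rule card_inj_on_le[where f = "app (- z')"]) (use Y in \<open>auto simp: inj_on_def\<close>)
      finally show "(\<Sum>w\<in>Y. indicator Y (app (- z) w) * indicator Y (app (- z') w)) \<le> returns Y (- z + z')" .
    qed
    also have "\<dots> = integ (conv (refl_fun f) f) (returns Y)"
      using f by (simp add: integ_conv finite_supp prob_refl_fun integ_refl_fun)
    finally show ?thesis .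
  qed
  hence "(\<Sum>w\<in>Y. (F w)\<^sup>2) * real (card Y) \<le> integ (conv (refl_fun f) f) (returns Y) * real (card Y)"
    by (rule mult_right_mono) simp
  ultimately show ?thesis by (simp add: mult.commute)
qed

text \<open>\<open>walk \<mu> j\<close> is the convolution power of order \<open>2 ^ j\<close> of
  the symmetrized measure \<open>conv (refl_fun \<mu>) \<mu>\<close>. By symmetry every squaring is
  again of the form \<open>conv (refl_fun f) f\<close>, so \<open>returns_conv_ge\<close> applies at
  each step.\<close>

primrec walk :: "('g::group_add \<Rightarrow> real) \<Rightarrow> nat \<Rightarrow> 'g \<Rightarrow> real" where
  "walk \<mu> 0 = conv (refl_fun \<mu>) \<mu>"
| "walk \<mu> (Suc j) = conv (walk \<mu> j) (walk \<mu> j)"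

lemma prob_walk: "prob \<mu> \<Longrightarrow> prob (walk \<mu> j)"
  by (induction j) (simp_all add: prob_conv prob_refl_fun)

lemma refl_fun_walk: "prob \<mu> \<Longrightarrow> refl_fun (walk \<mu> j) = walk \<mu> j"
proof (induction j)
  case 0
  thus ?case by (intro ext) (simp add: refl_fun_def[of "conv _ _"] conv_refl_fun_uminus finite_supp)
next
  case (Suc j)
  have fin: "finite (supp (walk \<mu> j))" using Suc.prems by (simp add: prob_walk finite_supp)
  show ?case
    using conv_refl_fun_uminus[OF fin fin] Suc by (intro ext) (simp add: refl_fun_def[of "conv _ _"])
qed

lemma walk_uminus: "prob \<mu> \<Longrightarrow> walk \<mu> j (- x) = walk \<mu> j x"
  using refl_fun_walk[of \<mu> j] by (metis refl_fun_def)

lemma supp_walk_subset: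
  assumes G: "\<And>x. x \<in> G \<Longrightarrow> - x \<in> G" "\<And>x y. x \<in> G \<Longrightarrow> y \<in> G \<Longrightarrow> x + y \<in> G" and "supp \<mu> \<subseteq> G"
  shows "supp (walk \<mu> j) \<subseteq> G"
proof (induction j)
  case 0
  have "supp (conv (refl_fun \<mu>) \<mu>) \<subseteq> (\<lambda>(y, z). y + z) ` (uminus ` supp \<mu> \<times> supp \<mu>)"
    using supp_conv[of "refl_fun \<mu>" \<mu>] by (simp add: supp_refl_fun)
  also have "\<dots> \<subseteq> G" using assms by auto
  finally show ?case by simp
next
  case (Suc j)
  have "supp (walk \<mu> (Suc j)) \<subseteq> (\<lambda>(y, z). y + z) ` (supp (walk \<mu> j) \<times> supp (walk \<mu> j))"
    using supp_conv[of "walk \<mu> j" "walk \<mu> j"] by simp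
  also have "\<dots> \<subseteq> G" using Suc G(2) by (auto simp: subset_iff)
  finally show ?case .
qed

lemma mass_coset_walk_le:
  assumes "prob \<mu>" "\<And>x. mass \<mu> (coset x H) \<le> s"
  shows "mass (walk \<mu> j) (coset x H) \<le> s"
proof (induction j arbitrary: x)
  case 0
  show ?case using assms by (simp add: mass_coset_conv_le prob_refl_fun)
next
  case (Suc j)
  show ?case using assms(1) Suc by (simp add: mass_coset_conv_le prob_walk)
qed

lemma returns_walk_ge:
  assumes \<mu>: "prob \<mu>" and Y: "finite Y" and \<alpha>: "0 \<le> \<alpha>" "\<alpha> * real (card Y) \<le> integ \<mu> (returns Y)"
  shows "\<alpha> ^ 2 ^ Suc j * real (card Y) \<le> integ (walk \<mu> j) (returns Y)"
proof (cases "card Y = 0")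
  case True
  thus ?thesis using integ_nonneg[OF prob_walk[OF \<mu>], of "returns Y" j] by (simp add: returns_def)
next
  case False
  have step: "a\<^sup>2 * real (card Y) \<le> integ (conv (refl_fun f) f) (returns Y)"
    if "prob f" "0 \<le> a" "a * real (card Y) \<le> integ f (returns Y)" for f a
  proof -
    have "(a * real (card Y))\<^sup>2 \<le> (integ f (returns Y))\<^sup>2"
      using that by (intro power_mono) auto
    also have "\<dots> \<le> real (card Y) * integ (conv (refl_fun f) f) (returns Y)"
      by (rule returns_conv_ge[OF that(1) Y])
    finally have "real (card Y) * (a\<^sup>2 * real (card Y)) \<le> real (card Y) * integ (conv (refl_fun f) f) (returns Y)"
      by (simp add: power2_eq_square mult_ac)
    thus ?thesis using False by (simp add: mult_le_cancel_left)
  qed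
  show ?thesis
  proof (induction j)
    case 0
    show ?case using step[OF \<mu> \<alpha>] by simp
  next
    case (Suc j)
    have "(\<alpha> ^ 2 ^ Suc j)\<^sup>2 * real (card Y) \<le> integ (walk \<mu> (Suc j)) (returns Y)"
      using step[OF prob_walk[OF \<mu>] _ Suc.IH] \<alpha>(1) by (simp add: refl_fun_walk \<mu>)
    thus ?case by (simp flip: power_mult add: mult.commute)
  qed
qed

section \<open>Lower bounds for L2 norms from return rates\<close>

lemma integ_squared_le:
  assumes "finite D" "supp f \<subseteq> D"
  shows "(integ f h)\<^sup>2 \<le> integ f f * (\<Sum>x\<in>D. (h x)\<^sup>2)"
proof -
  have "(\<Sum>x\<in>D. f x * h x)\<^sup>2 \<le> (\<Sum>x\<in>D. (f x)\<^sup>2) * (\<Sum>x\<in>D. (h x)\<^sup>2)"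
    by (rule Cauchy_Schwarz_ineq_sum)
  thus ?thesis by (simp add: integ_superset[OF assms] power2_eq_square)
qed

text \<open>The summand counts ordered pairs of distinct returning points, and two distinct points
  of \<open>Y\<close> together with their images in \<open>Y\<close> determine
  \<open>g\<close>.\<close>

lemma sum_returns_le:
  fixes D :: "'a bijection set"
  assumes fin: "finite D" "finite Y"
    and D: "\<And>g h x y. g \<in> D \<Longrightarrow> h \<in> D \<Longrightarrow> x \<in> Y \<Longrightarrow> y \<in> Y \<Longrightarrow> x \<noteq> y \<Longrightarrow>
      app g x = app h x \<Longrightarrow> app g y = app h y \<Longrightarrow> g = h"
  shows "(\<Sum>g\<in>D. returns Y g * (returns Y g - 1)) \<le> (real (card Y) * (real (card Y) - 1))\<^sup>2"
proof -
  define P where "P = Y \<times> Y - Id"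
  have finP: "finite P" using fin by (simp add: P_def)
  have card_off: "real (card (Z \<times> Z - Id)) = real (card Z) * (real (card Z) - 1)" if "finite Z" for Z :: "'a set"
  proof -
    have "Z \<times> Z - Id = Z \<times> Z - (\<lambda>z. (z, z)) ` Z" by auto
    moreover have "card (Z \<times> Z - (\<lambda>z. (z, z)) ` Z) = card (Z \<times> Z) - card ((\<lambda>z. (z, z)) ` Z)"
      by (rule card_Diff_subset) (use that in auto)
    moreover have "card ((\<lambda>z. (z, z)) ` Z) = card Z" by (simp add: card_image inj_on_def)
    moreover have "card Z \<le> card Z * card Z" by (cases "card Z") auto
    ultimately show ?thesis
      by (simp add: card_cartesian_product of_nat_diff algebra_simps)
  qed
  define T where "T = (SIGMA g:D. {y \<in> Y. app g y \<in> Y} \<times> {y \<in> Y. app g y \<in> Y} - Id)"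
  have "(\<Sum>g\<in>D. returns Y g * (returns Y g - 1)) = real (card T)"
    unfolding T_def returns_def using fin by (simp add: card_off)
  also have "card T \<le> card (P \<times> P)"
  proof (rule card_inj_on_le)
    show "inj_on (\<lambda>(g, (x, y)). ((x, y), (app g x, app g y))) T"
      using D by (auto simp: inj_on_def T_def)
    show "(\<lambda>(g, (x, y)). ((x, y), (app g x, app g y))) ` T \<subseteq> P \<times> P"
      by (auto simp: T_def P_def)
    show "finite (P \<times> P)" using finP by simp
  qed
  also have "real (card (P \<times> P)) = (real (card Y) * (real (card Y) - 1))\<^sup>2"
    unfolding P_def card_cartesian_product of_nat_mult card_off[OF fin(2)] by (simp add: power2_eq_square)
  finally show ?thesis by simp
qed

text \<open>Elements with at most one return contribute at most 1 to the average, which is at most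
  \<theta> |Y|; the remaining part is at least 3 \<theta> |Y|. Cauchy-Schwarz compares it with the
  second moment of the return numbers, which is bounded because two points determine an
  element.\<close>

lemma integ_self_ge:
  fixes f :: "'a bijection \<Rightarrow> real"
  assumes f: "prob f" and Y: "finite Y"
    and D: "\<And>g h x y. g \<in> supp f \<Longrightarrow> h \<in> supp f \<Longrightarrow> x \<in> Y \<Longrightarrow> y \<in> Y \<Longrightarrow> x \<noteq> y \<Longrightarrow>
      app g x = app h x \<Longrightarrow> app g y = app h y \<Longrightarrow> g = h"
    and \<theta>: "1 \<le> \<theta> * real (card Y)" "4 * \<theta> * real (card Y) \<le> integ f (returns Y)"
  shows "\<theta>\<^sup>2 / (real (card Y))\<^sup>2 \<le> integ f f"
proof -
  define N where "N = real (card Y)"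
  define h where "h g = (if returns Y g \<le> 1 then 0 else returns Y g)" for g
  have N: "0 < N" using \<theta>(1) by (cases "card Y = 0") (auto simp: N_def)
  have "integ f (returns Y) \<le> integ f (\<lambda>g. 1 + h g)"
    by (rule integ_mono[OF f]) (simp add: h_def)
  also have "\<dots> = 1 + integ f h"
    using integ_const[OF f, of 1] by (simp add: integ_def algebra_simps sum.distrib)
  finally have "3 * (\<theta> * N) \<le> integ f h" using \<theta> by (simp add: N_def)
  hence "(3 * (\<theta> * N))\<^sup>2 \<le> (integ f h)\<^sup>2"
    using \<theta>(1) by (intro power_mono) (auto simp: N_def)
  also have "\<dots> \<le> integ f f * (\<Sum>g\<in>supp f. (h g)\<^sup>2)"
    by (rule integ_squared_le) (use f in \<open>auto simp: finite_supp\<close>)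
  also have "\<dots> \<le> integ f f * (2 * N ^ 4)"
  proof (rule mult_left_mono)
    \<comment> \<open>A number \<open>r \<ge> 2\<close> satisfies
      \<open>r * r \<le> 2 * (r * (r - 1))\<close>, which fails for \<open>r = 1\<close>; this is
      why single returns were discarded.\<close>
    have "(h g)\<^sup>2 \<le> 2 * (returns Y g * (returns Y g - 1))" for g
    proof (cases "returns Y g \<le> 1")
      case True
      hence "card {y \<in> Y. app g y \<in> Y} = 0 \<or> card {y \<in> Y. app g y \<in> Y} = 1"
        unfolding returns_def by linarith
      thus ?thesis by (auto simp: h_def returns_def)
    next
      case False
      hence "2 \<le> returns Y g" unfolding returns_def by (simp add: not_le)
      hence "returns Y g * 2 \<le> returns Y g * returns Y g" by (intro mult_left_mono) auto
      thus ?thesis using False by (simp add: h_def power2_eq_square algebra_simps)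
    qed
    hence "(\<Sum>g\<in>supp f. (h g)\<^sup>2) \<le> 2 * (\<Sum>g\<in>supp f. returns Y g * (returns Y g - 1))"
      unfolding sum_distrib_left by (intro sum_mono)
    also have "\<dots> \<le> 2 * (N * (N - 1))\<^sup>2"
      unfolding N_def using sum_returns_le[OF finite_supp[OF f] Y D] by simp
    also have "(N * (N - 1))\<^sup>2 \<le> (N * N)\<^sup>2"
    proof (rule power_mono)
      show "0 \<le> N * (N - 1)" using N by (cases "card Y") (auto simp: N_def)
    qed (use N in simp)
    finally show "(\<Sum>g\<in>supp f. (h g)\<^sup>2) \<le> 2 * N ^ 4" by (simp add: eval_nat_numeral)
    show "0 \<le> integ f f" by (rule integ_nonneg[OF f]) (rule prob_nonneg[OF f])
  qed
  finally have "9 * (\<theta>\<^sup>2 * N\<^sup>2) \<le> 2 * (integ f f * N\<^sup>2) * N\<^sup>2"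
    by (simp add: eval_nat_numeral algebra_simps)
  hence "9 * \<theta>\<^sup>2 \<le> 2 * (integ f f * N\<^sup>2)" using N by simp
  hence "\<theta>\<^sup>2 \<le> integ f f * N\<^sup>2" by (smt (verit) zero_le_power2)
  thus ?thesis using N by (simp add: N_def divide_le_eq)
qed

section \<open>Approximate subgroups of the affine group\<close>

lemma (in field) nonzero_Units: "a \<in> carrier R \<Longrightarrow> a \<noteq> \<zero> \<Longrightarrow> a \<in> Units R"
  by (simp add: field_Units)

lemma (in field) divide_eqI:
  assumes "x \<in> carrier R" "a \<in> carrier R" "c \<in> carrier R" "c \<noteq> \<zero>" "c \<otimes> x = a"
  shows "x = a \<otimes> inv c"
proof -
  have "c \<in> Units R" using assms by (simp add: nonzero_Units)
  hence "inv c \<otimes> c = \<one>" "inv c \<in> carrier R" by auto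
  moreover have "a \<otimes> inv c = (inv c \<otimes> c) \<otimes> x"
    using assms(1-3,5) calculation(2) by (metis m_assoc m_comm)
  ultimately show ?thesis using assms by simp
qed

text \<open>In a field these are the \<xi> for which two pairs with different \<open>c\<close> give
  the same value \<open>b \<oplus> c \<otimes> \<xi>\<close>.\<close>

definition (in ring) quotients :: "'a set \<Rightarrow> 'a set \<Rightarrow> 'a set" where
  "quotients B \<Lambda> = {(b1 \<ominus> b2) \<otimes> inv (c1 \<ominus> c2) | b1 b2 c1 c2.
     b1 \<in> B \<and> b2 \<in> B \<and> c1 \<in> \<Lambda> \<and> c2 \<in> \<Lambda> \<and> c1 \<noteq> c2}"

text \<open>The finite fields with this property are the prime fields, the infinite ones those of
  characteristic zero.\<close>

definition (in ring) translation_rigid :: bool where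
  "translation_rigid \<longleftrightarrow> (\<forall>X b. X \<subseteq> carrier R \<longrightarrow> finite X \<longrightarrow> X \<noteq> {} \<longrightarrow> b \<in> carrier R \<longrightarrow> b \<noteq> \<zero> \<longrightarrow>
     (\<forall>x\<in>X. x \<oplus> b \<in> X) \<longrightarrow> X = carrier R)"

context field
begin

lemma collision_imp_quotient:
  assumes "b \<in> carrier R" "b' \<in> carrier R" "c \<in> carrier R" "c' \<in> carrier R" "\<xi> \<in> carrier R" "c \<noteq> c'"
    and "b \<oplus> c \<otimes> \<xi> = b' \<oplus> c' \<otimes> \<xi>"
  shows "\<xi> = (b' \<ominus> b) \<otimes> inv (c \<ominus> c')"
proof (rule divide_eqI)
  have "(c \<ominus> c') \<otimes> \<xi> = (b \<oplus> c \<otimes> \<xi>) \<ominus> b \<ominus> c' \<otimes> \<xi>"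
    using assms(1-5) by algebra
  also have "\<dots> = b' \<ominus> b" unfolding assms(7)
    using assms(1-5) by algebra
  finally show "(c \<ominus> c') \<otimes> \<xi> = b' \<ominus> b" .
qed (use assms in auto)

text \<open>If the set \<open>Q\<close> of quotients is not closed under adding elements of
  \<open>B\<close>, some \<open>r \<oplus> b0\<close> lies outside it; then
  \<open>b \<oplus> c \<otimes> (r \<oplus> b0)\<close> determines \<open>(b, c)\<close>, and
  multiplying by the denominator of \<open>r\<close> moves these values into \<open>D\<close>.
  Otherwise rigidity makes \<open>Q\<close> the whole field, and the second alternative comes from
  averaging over all \<xi>: two different pairs collide for at most one \<xi>, so some image has
  size at least p |B| |\<Lambda>| / (p + |B| |\<Lambda>|), where p is the size of the field.\<close>

lemma pivot:
  assumes fin: "finite B" "finite \<Lambda>" "finite D" and sub: "B \<subseteq> carrier R" "\<Lambda> \<subseteq> carrier R"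
    and B: "\<zero> \<in> B" "B \<noteq> {\<zero>}" and \<Lambda>: "2 \<le> card \<Lambda>" and rigid: translation_rigid
    and D: "\<And>b b0 b1 b2 c c1 c2. b \<in> B \<Longrightarrow> b0 \<in> B \<Longrightarrow> b1 \<in> B \<Longrightarrow> b2 \<in> B \<Longrightarrow>
      c \<in> \<Lambda> \<Longrightarrow> c1 \<in> \<Lambda> \<Longrightarrow> c2 \<in> \<Lambda> \<Longrightarrow>
      (c1 \<ominus> c2) \<otimes> b \<oplus> c \<otimes> (b1 \<ominus> b2) \<oplus> c \<otimes> ((c1 \<ominus> c2) \<otimes> b0) \<in> D"
  shows "card B * card \<Lambda> \<le> card D \<or>
    finite (carrier R) \<and>
      card (carrier R) * (card B * card \<Lambda>) \<le> card D * (card (carrier R) + card B * card \<Lambda>)"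
proof -
  define Q where "Q = quotients B \<Lambda>"
  have finQ: "finite Q"
  proof -
    have "Q \<subseteq> (\<lambda>(b1, b2, c1, c2). (b1 \<ominus> b2) \<otimes> inv (c1 \<ominus> c2)) ` (B \<times> B \<times> \<Lambda> \<times> \<Lambda>)"
    proof
      fix x assume "x \<in> Q"
      then obtain b1 b2 c1 c2 where "b1 \<in> B" "b2 \<in> B" "c1 \<in> \<Lambda>" "c2 \<in> \<Lambda>" "x = (b1 \<ominus> b2) \<otimes> inv (c1 \<ominus> c2)"
        unfolding Q_def quotients_def by blast
      thus "x \<in> (\<lambda>(b1, b2, c1, c2). (b1 \<ominus> b2) \<otimes> inv (c1 \<ominus> c2)) ` (B \<times> B \<times> \<Lambda> \<times> \<Lambda>)"
        by (intro image_eqI[of _ _ "(b1, b2, c1, c2)"]) auto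
    qed
    thus ?thesis by (rule finite_subset) (use fin in simp)
  qed
  have diff: "c1 \<ominus> c2 \<in> carrier R" "c1 \<ominus> c2 \<noteq> \<zero>" "c1 \<ominus> c2 \<in> Units R"
    if "c1 \<in> \<Lambda>" "c2 \<in> \<Lambda>" "c1 \<noteq> c2" for c1 c2
  proof -
    have "c1 \<in> carrier R" "c2 \<in> carrier R" using that sub by auto
    thus "c1 \<ominus> c2 \<in> carrier R" "c1 \<ominus> c2 \<noteq> \<zero>" using that by simp_all
    thus "c1 \<ominus> c2 \<in> Units R" by (rule nonzero_Units)
  qed
  have Qsub: "Q \<subseteq> carrier R"
    using sub diff by (auto simp: Q_def quotients_def subset_iff)
  obtain d1 d2 where d: "d1 \<in> \<Lambda>" "d2 \<in> \<Lambda>" "d1 \<noteq> d2"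
    using \<Lambda> by (metis card_le_Suc0_iff_eq fin(2) not_less_eq_eq numeral_2_eq_2)
  have Qne: "Q \<noteq> {}" using B d by (auto simp: Q_def quotients_def)
  \<comment> \<open>Dilating by \<open>c1 \<ominus> c2\<close> turns \<open>B \<oplus> \<Lambda> \<otimes> \<xi>\<close> into a subset of \<open>D\<close> when \<open>\<xi> \<in> Q \<oplus> b0\<close>.\<close>
  have dilate: "(c1 \<ominus> c2) \<otimes> (b \<oplus> c \<otimes> (r \<oplus> b0)) \<in> D"
    if *: "b \<in> B" "b0 \<in> B" "b1 \<in> B" "b2 \<in> B" "c \<in> \<Lambda>" "c1 \<in> \<Lambda>" "c2 \<in> \<Lambda>" "c1 \<noteq> c2"
      "r = (b1 \<ominus> b2) \<otimes> inv (c1 \<ominus> c2)" for b b0 b1 b2 c c1 c2 r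
  proof -
    have mem: "b \<in> carrier R" "b0 \<in> carrier R" "b1 \<in> carrier R" "b2 \<in> carrier R"
      "c \<in> carrier R" "c1 \<in> carrier R" "c2 \<in> carrier R" using * sub by auto
    have u: "c1 \<ominus> c2 \<in> Units R" using * diff by simp
    define e where "e = inv (c1 \<ominus> c2)"
    have e: "e \<in> carrier R" "(c1 \<ominus> c2) \<otimes> e = \<one>" using u by (auto simp: e_def)
    have "(c1 \<ominus> c2) \<otimes> (b \<oplus> c \<otimes> ((b1 \<ominus> b2) \<otimes> e \<oplus> b0))
        = (c1 \<ominus> c2) \<otimes> b \<oplus> c \<otimes> (b1 \<ominus> b2) \<otimes> ((c1 \<ominus> c2) \<otimes> e) \<oplus> c \<otimes> ((c1 \<ominus> c2) \<otimes> b0)"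
      using mem e(1) by algebra
    also have "\<dots> = (c1 \<ominus> c2) \<otimes> b \<oplus> c \<otimes> (b1 \<ominus> b2) \<oplus> c \<otimes> ((c1 \<ominus> c2) \<otimes> b0)"
      using mem by (simp add: e(2))
    finally show ?thesis using D[OF *(1,2,3,4,5,6,7)] by (simp add: *(9) e_def)
  qed
  show ?thesis
  proof (cases "\<forall>r\<in>Q. \<forall>b0\<in>B. r \<oplus> b0 \<in> Q")
    case False
    then obtain r b0 where r: "r \<in> Q" "b0 \<in> B" "r \<oplus> b0 \<notin> Q" by blast
    then obtain b1 b2 c1 c2 where rep: "b1 \<in> B" "b2 \<in> B" "c1 \<in> \<Lambda>" "c2 \<in> \<Lambda>" "c1 \<noteq> c2"
      "r = (b1 \<ominus> b2) \<otimes> inv (c1 \<ominus> c2)" by (auto simp: Q_def quotients_def)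
    have \<xi>: "r \<oplus> b0 \<in> carrier R" using r Qsub sub by blast
    note c12 = diff[OF rep(3,4,5)]
    have "card (B \<times> \<Lambda>) \<le> card D"
    proof (rule card_inj_on_le)
      show "(\<lambda>(b, c). (c1 \<ominus> c2) \<otimes> (b \<oplus> c \<otimes> (r \<oplus> b0))) ` (B \<times> \<Lambda>) \<subseteq> D"
        using dilate r rep by auto
      show "inj_on (\<lambda>(b, c). (c1 \<ominus> c2) \<otimes> (b \<oplus> c \<otimes> (r \<oplus> b0))) (B \<times> \<Lambda>)"
      proof (rule inj_onI, clarify)
        fix b c b' c' assume mem: "b \<in> B" "c \<in> \<Lambda>" "b' \<in> B" "c' \<in> \<Lambda>"
          and eq: "(c1 \<ominus> c2) \<otimes> (b \<oplus> c \<otimes> (r \<oplus> b0)) = (c1 \<ominus> c2) \<otimes> (b' \<oplus> c' \<otimes> (r \<oplus> b0))"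
        have cl: "b \<in> carrier R" "c \<in> carrier R" "b' \<in> carrier R" "c' \<in> carrier R" using mem sub by auto
        have eq': "b \<oplus> c \<otimes> (r \<oplus> b0) = b' \<oplus> c' \<otimes> (r \<oplus> b0)"
          using eq cl \<xi> c12 m_lcancel[OF c12(2,1)] by (metis a_closed m_closed)
        have "c = c'"
        proof (rule ccontr)
          assume "c \<noteq> c'"
          hence "r \<oplus> b0 = (b' \<ominus> b) \<otimes> inv (c \<ominus> c')"
            using collision_imp_quotient[OF cl(1,3,2,4) \<xi> _ eq'] by simp
          hence "r \<oplus> b0 \<in> Q" using mem \<open>c \<noteq> c'\<close> unfolding Q_def quotients_def by blast
          thus False using r by simp
        qed
        moreover have "b = b'" using eq' cl \<xi> unfolding \<open>c = c'\<close> by (simp add: add.right_cancel)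
        ultimately show "b = b' \<and> c = c'" by simp
      qed
    qed (rule fin)
    thus ?thesis by (simp add: card_cartesian_product)
  next
    case True
    obtain b0 where b0: "b0 \<in> B" "b0 \<noteq> \<zero>" using B by blast
    have Q: "Q = carrier R"
      by (rule rigid[unfolded translation_rigid_def, rule_format, of _ b0]) (use Qsub finQ Qne b0 sub True in auto)
    hence finR: "finite (carrier R)" using finQ by simp
    define p where "p = card (carrier R)"
    define T where "T = B \<times> \<Lambda>"
    define h where "h \<xi> = (\<lambda>(b, c). b \<oplus> c \<otimes> \<xi>)" for \<xi>
    have finT: "finite T" using fin by (simp add: T_def)
    \<comment> \<open>Every \<xi> is now a quotient, so dilating with \<open>b0 = \<zero>\<close>
      embeds the image in \<open>D\<close>.\<close>
    have hD: "card (h \<xi> ` T) \<le> card D" if "\<xi> \<in> carrier R" for \<xi>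
    proof -
      have "\<xi> \<in> Q" using that Q by simp
      then obtain b1 b2 c1 c2 where rep: "b1 \<in> B" "b2 \<in> B" "c1 \<in> \<Lambda>" "c2 \<in> \<Lambda>" "c1 \<noteq> c2"
        "\<xi> = (b1 \<ominus> b2) \<otimes> inv (c1 \<ominus> c2)" by (auto simp: Q_def quotients_def)
      note c12 = diff[OF rep(3,4,5)]
      have hc: "h \<xi> ` T \<subseteq> carrier R" using sub that by (auto simp: h_def T_def)
      show ?thesis
      proof (rule card_inj_on_le[where f = "\<lambda>x. (c1 \<ominus> c2) \<otimes> x"])
        show "inj_on (\<lambda>x. (c1 \<ominus> c2) \<otimes> x) (h \<xi> ` T)"
          using hc c12 m_lcancel[OF c12(2,1)] by (auto simp: inj_on_def subset_iff)
        have "\<xi> = \<xi> \<oplus> \<zero>" using that by simp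
        thus "(\<lambda>x. (c1 \<ominus> c2) \<otimes> x) ` (h \<xi> ` T) \<subseteq> D"
          using dilate[OF _ B(1) rep(1,2) _ rep(3-6)] that by (auto simp: h_def T_def)
      qed (rule fin)
    qed
    \<comment> \<open>By Cauchy-Schwarz the number of collisions at \<xi> is at least |T|^2 divided
      by the size of the image, which is at most |D|.\<close>
    have cs: "(card T)\<^sup>2 \<le> card D * card {(t, u) \<in> T \<times> T. h \<xi> t = h \<xi> u}" if "\<xi> \<in> carrier R" for \<xi>
    proof -
      have "real ((card T)\<^sup>2) = (\<Sum>s\<in>h \<xi> ` T. real (card {t \<in> T. h \<xi> t = s}))\<^sup>2"
        using sum_fibres[OF finT, of "h \<xi>"] by (simp flip: of_nat_sum)
      also have "\<dots> \<le> (\<Sum>s\<in>h \<xi> ` T. (real (card {t \<in> T. h \<xi> t = s}))\<^sup>2) * real (card (h \<xi> ` T))"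
        by (rule sum_squared_le_sum_of_squares)
      also have "\<dots> = real (card {(t, u) \<in> T \<times> T. h \<xi> t = h \<xi> u} * card (h \<xi> ` T))"
        using sum_fibre_squares[OF finT, of "h \<xi>"] by (simp flip: of_nat_sum of_nat_power)
      finally have "(card T)\<^sup>2 \<le> card {(t, u) \<in> T \<times> T. h \<xi> t = h \<xi> u} * card (h \<xi> ` T)"
        by (simp only: of_nat_le_iff)
      also have "\<dots> \<le> card {(t, u) \<in> T \<times> T. h \<xi> t = h \<xi> u} * card D"
        by (rule mult_left_mono[OF hD[OF that]]) simp
      finally show ?thesis by (simp add: mult.commute)
    qed
    have "p * (card T)\<^sup>2 \<le> (\<Sum>\<xi>\<in>carrier R. card D * card {(t, u) \<in> T \<times> T. h \<xi> t = h \<xi> u})"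
      using sum_mono[OF cs, of "carrier R" "\<lambda>x. x"] by (simp add: p_def)
    also have "\<dots> = card D * (\<Sum>\<xi>\<in>carrier R. card {q \<in> T \<times> T. h \<xi> (fst q) = h \<xi> (snd q)})"
      unfolding sum_distrib_left case_prod_beta
      by (intro sum.cong refl arg_cong2[where f = "(*)"] arg_cong[where f = card]) auto
    also have "(\<Sum>\<xi>\<in>carrier R. card {q \<in> T \<times> T. h \<xi> (fst q) = h \<xi> (snd q)})
        = (\<Sum>q\<in>T \<times> T. card {\<xi> \<in> carrier R. h \<xi> (fst q) = h \<xi> (snd q)})"
      by (rule sum_card_Collect_swap[OF finR]) (use finT in simp)
    \<comment> \<open>A diagonal pair collides for all \<open>p\<close> values of \<xi>, any other
      pair for at most one.\<close>
    also have "\<dots> \<le> (\<Sum>q\<in>T \<times> T. (if fst q = snd q then p else 0) + 1)"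
    proof (rule sum_mono)
      fix q assume q: "q \<in> T \<times> T"
      then obtain b c b' c' where qq: "q = ((b, c), (b', c'))" "b \<in> B" "c \<in> \<Lambda>" "b' \<in> B" "c' \<in> \<Lambda>"
        by (auto simp: T_def)
      have cl: "b \<in> carrier R" "c \<in> carrier R" "b' \<in> carrier R" "c' \<in> carrier R" using qq sub by auto
      let ?X = "{\<xi> \<in> carrier R. h \<xi> (fst q) = h \<xi> (snd q)}"
      show "card ?X \<le> (if fst q = snd q then p else 0) + 1"
      proof (cases "fst q = snd q")
        case True
        have "card ?X \<le> p" unfolding p_def by (rule card_mono[OF finR]) auto
        thus ?thesis using True by simp
      next
        case False
        have "?X \<subseteq> {(b' \<ominus> b) \<otimes> inv (c \<ominus> c')}"
        proof
          fix \<xi> assume "\<xi> \<in> ?X"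
          hence \<xi>: "\<xi> \<in> carrier R" and eq: "b \<oplus> c \<otimes> \<xi> = b' \<oplus> c' \<otimes> \<xi>" by (auto simp: h_def qq(1))
          have "c \<noteq> c'"
          proof
            assume "c = c'"
            hence "b = b'" using eq cl \<xi> by (simp add: add.right_cancel)
            thus False using False \<open>c = c'\<close> by (simp add: qq(1))
          qed
          thus "\<xi> \<in> {(b' \<ominus> b) \<otimes> inv (c \<ominus> c')}"
            using collision_imp_quotient[OF cl(1,3,2,4) \<xi> _ eq] by simp
        qed
        hence "card ?X \<le> card {(b' \<ominus> b) \<otimes> inv (c \<ominus> c')}" by (rule card_mono[rotated]) simp
        thus ?thesis by simp
      qed
    qed
    also have "\<dots> = card T * p + (card T)\<^sup>2"
    proof -
      have "(\<Sum>q\<in>T \<times> T. if fst q = snd q then p else 0) = (\<Sum>q\<in>{q \<in> T \<times> T. fst q = snd q}. p)"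
        using finT by (intro sum.inter_filter[symmetric]) simp
      also have "{q \<in> T \<times> T. fst q = snd q} = (\<lambda>t. (t, t)) ` T" by auto
      finally show ?thesis
        unfolding sum.distrib using finT by (simp add: card_cartesian_product power2_eq_square card_image inj_on_def)
    qed
    finally have "p * (card T)\<^sup>2 \<le> card D * (card T * p + (card T)\<^sup>2)" by simp
    moreover have "card T * (p * card T) = p * (card T)\<^sup>2"
      and "card T * (card D * (p + card T)) = card D * (card T * p + (card T)\<^sup>2)"
      by (simp_all add: power2_eq_square algebra_simps)
    ultimately have "card T * (p * card T) \<le> card T * (card D * (p + card T))" by (simp only:)
    moreover have "0 < card T" using finT B(1) d(1) by (auto simp: T_def card_gt_0_iff)
    ultimately have "p * card T \<le> card D * (p + card T)" by (simp only: mult_le_cancel1)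
    thus ?thesis using finR by (simp add: p_def T_def card_cartesian_product)
  qed
qed


section \<open>The affine group as a group of bijections\<close>

definition aff :: "'a \<Rightarrow> 'a \<Rightarrow> 'a bijection" where
  "aff a b = Bijection (\<lambda>x. if x \<in> carrier R then a \<otimes> x \<oplus> b else x)"

definition Aff :: "'a bijection set" where
  "Aff = {aff a b | a b. a \<in> carrier R \<and> a \<noteq> \<zero> \<and> b \<in> carrier R}"

definition slope :: "'a bijection \<Rightarrow> 'a" where
  "slope g = app g \<one> \<ominus> app g \<zero>"

definition shifts :: "'a bijection set" where
  "shifts = aff \<one> ` carrier R"

definition stabilizer :: "'a \<Rightarrow> 'a bijection set" where
  "stabilizer x = {g \<in> Aff. app g x = x}"

lemma app_aff:
  assumes a: "a \<in> carrier R" "a \<noteq> \<zero>" and b: "b \<in> carrier R"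
  shows "app (aff a b) x = (if x \<in> carrier R then a \<otimes> x \<oplus> b else x)"
proof -
  have u: "a \<in> Units R" using a by (rule nonzero_Units)
  have inv: "inv a \<in> carrier R" "a \<otimes> inv a = \<one>" "inv a \<otimes> a = \<one>" using u by auto
  let ?f = "\<lambda>x. if x \<in> carrier R then a \<otimes> x \<oplus> b else x"
  let ?g = "\<lambda>x. if x \<in> carrier R then inv a \<otimes> (x \<ominus> b) else x"
  have "?g (?f x) = x" for x
  proof (cases "x \<in> carrier R")
    case True
    have "inv a \<otimes> (a \<otimes> x \<oplus> b \<ominus> b) = (inv a \<otimes> a) \<otimes> x"
    proof -
      have "a \<otimes> x \<oplus> b \<ominus> b = a \<otimes> x"
        using True a b by algebra
      thus ?thesis by (simp only: m_assoc[OF inv(1) a(1) True])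
    qed
    thus ?thesis using True a b inv by simp
  qed simp
  moreover have "?f (?g x) = x" for x
  proof (cases "x \<in> carrier R")
    case True
    have "a \<otimes> (inv a \<otimes> (x \<ominus> b)) \<oplus> b = (a \<otimes> inv a) \<otimes> (x \<ominus> b) \<oplus> b"
      by (subst m_assoc) (use True a b inv in simp_all)
    also have "\<dots> = (x \<ominus> b) \<oplus> b" using True b by (simp add: inv(2))
    also have "\<dots> = x"
      using True b by algebra
    finally show ?thesis using True b inv by simp
  qed simp
  ultimately have "bij ?f" by (intro o_bij[of ?g]) (auto simp: fun_eq_iff)
  thus ?thesis by (simp add: aff_def Bijection_inverse)
qed

lemma AffE:
  assumes "g \<in> Aff"
  obtains a b where "a \<in> carrier R" "a \<noteq> \<zero>" "b \<in> carrier R" "g = aff a b"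
  using assms by (auto simp: Aff_def)

lemma aff_in_Aff: "a \<in> carrier R \<Longrightarrow> a \<noteq> \<zero> \<Longrightarrow> b \<in> carrier R \<Longrightarrow> aff a b \<in> Aff"
  by (auto simp: Aff_def)

lemma app_closed: "g \<in> Aff \<Longrightarrow> x \<in> carrier R \<Longrightarrow> app g x \<in> carrier R"
  by (auto elim!: AffE simp: app_aff)

lemma slope_aff: "a \<in> carrier R \<Longrightarrow> a \<noteq> \<zero> \<Longrightarrow> b \<in> carrier R \<Longrightarrow> slope (aff a b) = a"
proof -
  assume a: "a \<in> carrier R" "a \<noteq> \<zero>" "b \<in> carrier R"
  have "a \<oplus> b \<ominus> b = a" using a by algebra
  thus ?thesis using a by (simp add: slope_def app_aff)
qed

lemma aff_eq_iff:
  assumes "a \<in> carrier R" "a \<noteq> \<zero>" "b \<in> carrier R" "c \<in> carrier R" "c \<noteq> \<zero>" "d \<in> carrier R"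
  shows "aff a b = aff c d \<longleftrightarrow> a = c \<and> b = d"
proof
  assume eq: "aff a b = aff c d"
  hence "a = c" using slope_aff assms by metis
  moreover have "app (aff a b) \<zero> = app (aff c d) \<zero>" using eq by simp
  ultimately show "a = c \<and> b = d" using assms by (simp add: app_aff)
qed simp

lemma aff_plus:
  assumes "a \<in> carrier R" "a \<noteq> \<zero>" "b \<in> carrier R" "c \<in> carrier R" "c \<noteq> \<zero>" "d \<in> carrier R"
  shows "aff a b + aff c d = aff (a \<otimes> c) (a \<otimes> d \<oplus> b)"
proof (rule bijection_eqI)
  fix x
  have ac: "a \<otimes> c \<noteq> \<zero>" using assms integral by blast
  have "a \<otimes> (c \<otimes> x \<oplus> d) \<oplus> b = a \<otimes> c \<otimes> x \<oplus> (a \<otimes> d \<oplus> b)" if "x \<in> carrier R"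
    using assms that by algebra
  thus "app (aff a b + aff c d) x = app (aff (a \<otimes> c) (a \<otimes> d \<oplus> b)) x"
    using assms ac by (simp add: app_aff)
qed

lemma aff_zero: "aff \<one> \<zero> = 0"
  by (rule bijection_eqI) (simp add: app_aff)

lemma Aff_zero: "0 \<in> Aff"
  using aff_in_Aff[of \<one> \<zero>] by (simp add: aff_zero)

lemma Aff_plus:
  assumes "g \<in> Aff" "h \<in> Aff"
  shows "g + h \<in> Aff" and "slope (g + h) = slope g \<otimes> slope h"
proof -
  obtain a b where g: "a \<in> carrier R" "a \<noteq> \<zero>" "b \<in> carrier R" "g = aff a b" by (rule AffE[OF assms(1)])
  obtain c d where h: "c \<in> carrier R" "c \<noteq> \<zero>" "d \<in> carrier R" "h = aff c d" by (rule AffE[OF assms(2)])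
  have ac: "a \<otimes> c \<noteq> \<zero>" using g h integral by blast
  show "g + h \<in> Aff" "slope (g + h) = slope g \<otimes> slope h"
    using g h ac by (simp_all add: aff_plus aff_in_Aff slope_aff)
qed

lemma Aff_uminus: "- g \<in> Aff" if g: "g \<in> Aff"
proof -
  obtain a b where ab: "a \<in> carrier R" "a \<noteq> \<zero>" "b \<in> carrier R" "g = aff a b" by (rule AffE[OF g])
  have u: "a \<in> Units R" using ab by (auto intro: nonzero_Units)
  have inv: "inv a \<in> carrier R" "a \<otimes> inv a = \<one>" using u by auto
  have ne: "inv a \<noteq> \<zero>" using inv ab by (metis r_null zero_not_one)
  define d where "d = \<ominus> (inv a \<otimes> b)"
  have d: "d \<in> carrier R" using inv ab by (simp add: d_def)
  have "a \<otimes> d \<oplus> b = \<ominus> ((a \<otimes> inv a) \<otimes> b) \<oplus> b"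
    unfolding m_assoc[OF ab(1) inv(1) ab(3)] using ab inv(1) by (simp add: d_def r_minus)
  hence "a \<otimes> d \<oplus> b = \<zero>" using ab by (simp add: inv(2) l_neg)
  hence "g + aff (inv a) d = 0" using ab inv ne d by (simp add: aff_plus aff_zero)
  hence "- g = aff (inv a) d" by (rule group_add_class.minus_unique)
  thus ?thesis using inv ne d by (simp add: aff_in_Aff)
qed

lemma slope_closed: "g \<in> Aff \<Longrightarrow> slope g \<in> carrier R" and slope_nonzero: "g \<in> Aff \<Longrightarrow> slope g \<noteq> \<zero>"
  by (auto elim!: AffE simp: slope_aff)

lemma slope_uminus: "g \<in> Aff \<Longrightarrow> slope (- g) \<otimes> slope g = \<one>"
  using Aff_plus(2)[of "- g" g] slope_aff[of \<one> \<zero>] by (simp add: Aff_uminus aff_zero)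

lemma shifts_iff: "g \<in> shifts \<longleftrightarrow> g \<in> Aff \<and> slope g = \<one>"
  by (auto simp: shifts_def aff_in_Aff slope_aff elim!: AffE)

lemma app_translation: "b \<in> carrier R \<Longrightarrow> x \<in> carrier R \<Longrightarrow> app (aff \<one> b) x = x \<oplus> b"
  by (simp add: app_aff)

lemma Aff_eqI:
  assumes "g \<in> Aff" "h \<in> Aff" "x \<in> carrier R" "y \<in> carrier R" "x \<noteq> y"
    and "app g x = app h x" "app g y = app h y"
  shows "g = h"
proof -
  obtain a b where g: "a \<in> carrier R" "a \<noteq> \<zero>" "b \<in> carrier R" "g = aff a b" by (rule AffE[OF assms(1)])
  obtain c d where h: "c \<in> carrier R" "c \<noteq> \<zero>" "d \<in> carrier R" "h = aff c d" by (rule AffE[OF assms(2)])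
  have 1: "a \<otimes> x \<oplus> b = c \<otimes> x \<oplus> d" "a \<otimes> y \<oplus> b = c \<otimes> y \<oplus> d"
    using assms g h by (simp_all add: app_aff)
  have "(a \<ominus> c) \<otimes> (x \<ominus> y) = (a \<otimes> x \<oplus> b) \<ominus> (a \<otimes> y \<oplus> b) \<ominus> ((c \<otimes> x \<oplus> d) \<ominus> (c \<otimes> y \<oplus> d))"
    using assms g h by algebra
  also have "\<dots> = \<zero>" unfolding 1 using g h assms by simp
  finally have "a = c" using integral[of "a \<ominus> c" "x \<ominus> y"] g h assms by auto
  moreover have "b = d" using 1(1) g h assms by (simp add: \<open>a = c\<close>)
  ultimately show ?thesis by (simp add: g h)
qed

lemma fixed_point_exists:
  assumes g: "g \<in> Aff" and ne: "slope g \<noteq> \<one>"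
  obtains x where "x \<in> carrier R" "app g x = x"
proof -
  obtain a b where ab: "a \<in> carrier R" "a \<noteq> \<zero>" "b \<in> carrier R" "g = aff a b" by (rule AffE[OF g])
  have a1: "\<one> \<ominus> a \<in> Units R" using ab ne by (intro nonzero_Units) (auto simp: slope_aff)
  define e where "e = inv (\<one> \<ominus> a)"
  have e: "e \<in> carrier R" "(\<one> \<ominus> a) \<otimes> e = \<one>" using a1 by (auto simp: e_def)
  \<comment> \<open>The fixed point is b / (1 - a); in this form the error term visibly
    vanishes.\<close>
  have "a \<otimes> (b \<otimes> e) \<oplus> b = b \<otimes> e \<oplus> b \<otimes> (\<one> \<ominus> (\<one> \<ominus> a) \<otimes> e)"
    using ab e(1) by algebra
  also have "\<dots> = b \<otimes> e" using ab e by (simp add: a_minus_def r_neg)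
  finally have "app g (b \<otimes> e) = b \<otimes> e" using ab e(1) by (simp add: app_aff)
  thus thesis using that[of "b \<otimes> e"] ab e(1) by simp
qed

lemma fixed_point_unique:
  assumes "g \<in> Aff" "slope g \<noteq> \<one>" "x \<in> carrier R" "y \<in> carrier R" "app g x = x" "app g y = y"
  shows "x = y"
proof (rule ccontr)
  assume "x \<noteq> y"
  hence "g = 0" using assms by (intro Aff_eqI[of g 0 x y]) (auto simp: Aff_zero)
  thus False using assms slope_aff[of \<one> \<zero>] by (simp add: aff_zero)
qed


text \<open>Through conjugation the slopes act on the translations by multiplication. This is how
  sums and products of field elements become short words in the group.\<close>

lemma conj_translation:
  assumes "t \<in> Aff" "b \<in> carrier R"
  shows "t + aff \<one> b - t = aff \<one> (slope t \<otimes> b)"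
proof -
  obtain a d where t: "a \<in> carrier R" "a \<noteq> \<zero>" "d \<in> carrier R" "t = aff a d" by (rule AffE[OF assms(1)])
  have "t + aff \<one> b = aff a (a \<otimes> b \<oplus> d)" using t assms by (simp add: aff_plus)
  also have "\<dots> = aff \<one> (a \<otimes> b) + t" using t assms by (simp add: aff_plus a_comm)
  finally show ?thesis using t by (simp add: slope_aff)
qed

text \<open>Conjugating a fixed \<open>g\<close> with fixed point \<open>x\<close> maps \<open>S\<close> into one coset of the translations, with
  fibres in cosets of the stabilizer of \<open>x\<close>.\<close>

lemma approximate_group_splitting:
  assumes S: "finite S" "0 \<in> S" "\<And>s. s \<in> S \<Longrightarrow> - s \<in> S" "S \<subseteq> Aff"
    and g: "g \<in> S" "slope g \<noteq> \<one>" and x: "x \<in> carrier R" "app g x = x"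
  shows "card S \<le> card (nfold S 4 \<inter> shifts) * card (nfold S 2 \<inter> stabilizer x)"
proof -
  define c where "c s = s + g - s" for s
  have gA: "g \<in> Aff" using g S by blast
  have fin: "finite (nfold S k)" for k using S(1) by (rule finite_nfold)
  have c_card: "card (c ` S) \<le> card (nfold S 4 \<inter> shifts)"
  proof (rule card_inj_on_le[where f = "\<lambda>z. - g + z"])
    \<comment> \<open>\<open>- g + c s\<close> is the commutator of \<open>- g\<close> and
      \<open>s\<close>, hence a word of four letters with slope 1.\<close>
    show "(\<lambda>z. - g + z) ` c ` S \<subseteq> nfold S 4 \<inter> shifts"
    proof clarify
      fix s assume s: "s \<in> S"
      have A: "s \<in> Aff" "- s \<in> Aff" "- g \<in> Aff" using s S gA Aff_uminus by auto
      have "(- g + s) + (g + - s) \<in> nfold S (2 + 2)"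
        using s g S(3) by (intro nfold_add nfold_2I) auto
      hence "- g + c s \<in> nfold S 4" by (simp only: c_def add.assoc diff_conv_add_uminus numeral_plus_numeral semiring_norm)
      moreover have "slope (- g + c s) = slope (- g) \<otimes> (slope s \<otimes> slope g \<otimes> slope (- s))"
        unfolding c_def diff_conv_add_uminus using A gA by (simp add: Aff_plus del: add_uminus_conv_diff)
      moreover have "\<dots> = (slope (- g) \<otimes> slope g) \<otimes> (slope (- s) \<otimes> slope s)"
      proof -
        have cl: "slope s \<in> carrier R" "slope g \<in> carrier R" "slope (- s) \<in> carrier R" "slope (- g) \<in> carrier R"
          using A gA by (auto intro: slope_closed)
        define a b a' b' where "a = slope s" "b = slope g" "a' = slope (- s)" "b' = slope (- g)"
        have cl': "a \<in> carrier R" "b \<in> carrier R" "a' \<in> carrier R" "b' \<in> carrier R"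
          using cl by (simp_all add: a_b_a'_b'_def)
        have "b' \<otimes> (a \<otimes> b \<otimes> a') = (b' \<otimes> b) \<otimes> (a' \<otimes> a)"
          using cl' by algebra
        thus ?thesis by (simp add: a_b_a'_b'_def)
      qed
      moreover have "- g + c s \<in> Aff"
        unfolding c_def diff_conv_add_uminus using A gA by (simp add: Aff_plus del: add_uminus_conv_diff)
      ultimately show "- g + c s \<in> nfold S 4 \<inter> shifts"
        using A gA by (simp add: shifts_iff slope_uminus)
    qed
  qed (use fin in \<open>auto simp: inj_on_def\<close>)
  have fibre: "card {s \<in> S. c s = w} \<le> card (nfold S 2 \<inter> stabilizer x)" if w: "w \<in> c ` S" for w
  proof -
    obtain s0 where s0: "s0 \<in> S" "w = c s0" using w by blast
    show ?thesis
    proof (rule card_inj_on_le[where f = "\<lambda>s. - s0 + s"])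
      \<comment> \<open>If \<open>s\<close> and \<open>s0\<close> conjugate \<open>g\<close> to the
        same element, then \<open>- s0 + s\<close> commutes with \<open>g\<close>; so it maps the
        unique fixed point of \<open>g\<close> to a fixed point of \<open>g\<close>, that is, to
        itself.\<close>
      show "(\<lambda>s. - s0 + s) ` {s \<in> S. c s = w} \<subseteq> nfold S 2 \<inter> stabilizer x"
      proof clarify
        fix s assume s: "s \<in> S" "w = c s"
        define h where "h = - s0 + s"
        have hA: "h \<in> Aff" using s s0 S(4) by (auto simp: h_def intro!: Aff_plus Aff_uminus)
        have eq: "s + g + - s = s0 + g + - s0" using s s0 by (simp add: c_def)
        have "g + h = - s0 + (s0 + g + - s0) + s" by (simp add: h_def add.assoc del: add_uminus_conv_diff)
        also have "\<dots> = - s0 + (s + g + - s) + s" by (simp only: eq)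
        also have "\<dots> = h + g" by (simp add: h_def add.assoc del: add_uminus_conv_diff)
        finally have "app g (app h x) = app h (app g x)" by (metis app_plus)
        hence "app g (app h x) = app h x" using x by simp
        hence "app h x = x" using fixed_point_unique[OF gA g(2) _ x(1)] hA x app_closed by blast
        moreover have "h \<in> nfold S 2"
          using s s0 S(3) by (simp add: h_def nfold_2I)
        ultimately show "- s0 + s \<in> nfold S 2 \<inter> stabilizer x"
          using hA by (simp add: h_def stabilizer_def)
      qed
    qed (use fin in \<open>auto simp: inj_on_def\<close>)
  qed
  have "card S = (\<Sum>w\<in>c ` S. card {s \<in> S. c s = w})" using sum_fibres[OF S(1), of c] by simp
  also have "\<dots> \<le> card (c ` S) * card (nfold S 2 \<inter> stabilizer x)"
    using sum_bounded_above[OF fibre] by simp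
  also have "\<dots> \<le> card (nfold S 4 \<inter> shifts) * card (nfold S 2 \<inter> stabilizer x)"
    by (rule mult_right_mono[OF c_card]) simp
  finally show ?thesis .
qed

text \<open>The estimate opposite to the splitting: \<open>u + t\<close> sends \<open>x\<close> to
  \<open>x \<oplus> b\<close>, from which the translation \<open>u\<close> and then \<open>t\<close>
  can be read off.\<close>

lemma shifts_stabilizer_le:
  assumes S: "finite S" and x: "x \<in> carrier R"
  shows "card (nfold S k \<inter> shifts) * card (nfold S j \<inter> stabilizer x) \<le> card (nfold S (k + j))"
proof -
  have "card ((nfold S k \<inter> shifts) \<times> (nfold S j \<inter> stabilizer x)) \<le> card (nfold S (k + j))"
  proof (rule card_inj_on_le[where f = "\<lambda>(u, t). u + t"])
    show "inj_on (\<lambda>(u, t). u + t) ((nfold S k \<inter> shifts) \<times> (nfold S j \<inter> stabilizer x))"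
    proof (rule inj_onI, clarsimp)
      fix u t u' t' assume *: "u \<in> shifts" "u' \<in> shifts" "t \<in> stabilizer x" "t' \<in> stabilizer x"
        and eq: "u + t = u' + t'"
      obtain b b' where b: "b \<in> carrier R" "b' \<in> carrier R" "u = aff \<one> b" "u' = aff \<one> b'"
        using * by (auto simp: shifts_def)
      have "app (u + t) x = app (u' + t') x" using eq by simp
      hence "x \<oplus> b = x \<oplus> b'" using * b x by (simp add: stabilizer_def app_translation)
      hence "u = u'" using b x by simp
      thus "u = u' \<and> t = t'" using eq by simp
    qed
    show "(\<lambda>(u, t). u + t) ` ((nfold S k \<inter> shifts) \<times> (nfold S j \<inter> stabilizer x)) \<subseteq> nfold S (k + j)"
      by (auto intro: nfold_add)
  qed (use S in \<open>simp add: finite_nfold\<close>)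
  thus ?thesis by (simp add: card_cartesian_product)
qed

section \<open>Translation amounts and word lengths\<close>

definition shift_amounts :: "'a bijection set \<Rightarrow> 'a set" where
  "shift_amounts X = {b \<in> carrier R. aff \<one> b \<in> X}"

lemma inj_on_aff_one: "inj_on (aff \<one>) (carrier R)"
  by (auto simp: inj_on_def aff_eq_iff)

lemma aff_image_shift_amounts: "aff \<one> ` shift_amounts X = X \<inter> shifts"
  by (auto simp: shift_amounts_def shifts_def)

lemma card_shift_amounts: "card (shift_amounts X) = card (X \<inter> shifts)"
proof -
  have "inj_on (aff \<one>) (shift_amounts X)"
    by (rule inj_on_subset[OF inj_on_aff_one]) (auto simp: shift_amounts_def)
  thus ?thesis using card_image aff_image_shift_amounts by metis
qed

lemma finite_shift_amounts: "finite X \<Longrightarrow> finite (shift_amounts X)"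
proof -
  assume "finite X"
  moreover have "inj_on (aff \<one>) (shift_amounts X)"
    by (rule inj_on_subset[OF inj_on_aff_one]) (auto simp: shift_amounts_def)
  ultimately show ?thesis using aff_image_shift_amounts finite_imageD by (metis finite_Int)
qed

lemma shift_amounts_add:
  assumes "b \<in> shift_amounts (nfold S j)" "d \<in> shift_amounts (nfold S k)"
  shows "b \<oplus> d \<in> shift_amounts (nfold S (j + k))"
proof -
  have "aff \<one> b + aff \<one> d = aff \<one> (b \<oplus> d)"
    using assms by (simp add: shift_amounts_def aff_plus a_comm)
  moreover have "aff \<one> b + aff \<one> d \<in> nfold S (j + k)"
    using assms by (intro nfold_add) (auto simp: shift_amounts_def)
  ultimately show ?thesis using assms by (simp add: shift_amounts_def)
qed

lemma shift_amounts_uminus: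
  assumes "\<And>s. s \<in> S \<Longrightarrow> - s \<in> S" "b \<in> shift_amounts (nfold S k)"
  shows "\<ominus> b \<in> shift_amounts (nfold S k)"
proof -
  have "aff \<one> b + aff \<one> (\<ominus> b) = 0"
    using assms(2) by (simp add: shift_amounts_def aff_plus l_neg aff_zero)
  hence "- aff \<one> b = aff \<one> (\<ominus> b)" by (rule group_add_class.minus_unique)
  moreover have "- aff \<one> b \<in> nfold S k"
    using assms by (intro nfold_uminus) (auto simp: shift_amounts_def)
  ultimately show ?thesis using assms(2) by (simp add: shift_amounts_def)
qed

text \<open>Multiplication by a slope is conjugation by \<open>t\<close>, which costs
  \<open>j\<close> letters on either side.\<close>

lemma shift_amounts_mult:
  assumes "\<And>s. s \<in> S \<Longrightarrow> - s \<in> S" "t \<in> nfold S j \<inter> Aff" "b \<in> shift_amounts (nfold S k)"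
  shows "slope t \<otimes> b \<in> shift_amounts (nfold S (k + 2 * j))"
proof -
  have "t + aff \<one> b + - t \<in> nfold S (j + k + j)"
    using assms nfold_uminus by (intro nfold_add) (auto simp: shift_amounts_def)
  thus ?thesis using assms conj_translation[of t b] slope_closed[of t]
    by (simp add: shift_amounts_def mult_2 add_ac)
qed

lemma inj_on_slope_stabilizer: "x \<in> carrier R \<Longrightarrow> inj_on slope (stabilizer x)"
proof (rule inj_onI)
  fix g h assume x: "x \<in> carrier R" and gh: "g \<in> stabilizer x" "h \<in> stabilizer x" "slope g = slope h"
  obtain a b where g: "a \<in> carrier R" "a \<noteq> \<zero>" "b \<in> carrier R" "g = aff a b"
    using gh by (auto simp: stabilizer_def elim: AffE)
  obtain c d where h: "c \<in> carrier R" "c \<noteq> \<zero>" "d \<in> carrier R" "h = aff c d"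
    using gh by (auto simp: stabilizer_def elim: AffE)
  have "a = c" using gh g h by (simp add: slope_aff)
  moreover have "a \<otimes> x \<oplus> b = c \<otimes> x \<oplus> d" using gh g h x by (simp add: stabilizer_def app_aff)
  ultimately show "g = h" using g h x by simp
qed

text \<open>The word lengths: a term \<open>c1 \<otimes> b\<close> costs \<open>4 + 2 \<sqdot> 2\<close> letters, \<open>c \<otimes> c1 \<otimes> b0\<close> costs \<open>12\<close>, so the
  six terms in the hypothesis of \<open>pivot\<close> need \<open>4 \<sqdot> 8 + 2 \<sqdot> 12 = 56\<close> letters.\<close>

lemma approximate_group_abelian:
  assumes S: "finite S" "0 \<in> S" "\<And>s. s \<in> S \<Longrightarrow> - s \<in> S" "S \<subseteq> Aff"
    and P: "real (card (nfold S 58)) \<le> P * real (card S)" and rigid: translation_rigid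
  obtains H B where "H = shifts \<or> (\<exists>x\<in>carrier R. H = stabilizer x)" "B \<subseteq> H \<inter> nfold S 4"
    "real (card S) \<le> 2 * P * real (card B) \<or>
     finite (carrier R) \<and> real (card (carrier R)) \<le> 2 * P * real (card B)"
proof -
  have fin: "finite (nfold S k)" for k using S(1) by (rule finite_nfold)
  have mono: "j \<le> k \<Longrightarrow> nfold S j \<subseteq> nfold S k" for j k using S(2) by (rule nfold_mono)
  have cS: "0 < card S" using S by (auto simp: card_gt_0_iff)
  have P1: "1 \<le> P"
  proof -
    have "card S \<le> card (nfold S 58)"
      using mono[of "Suc 0" 58] fin by (intro card_mono) auto
    hence "1 * real (card S) \<le> P * real (card S)" using P by linarith
    thus ?thesis using cS by (simp add: mult_le_cancel_right)
  qed
  show thesis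
  proof (cases "S \<subseteq> shifts")
    case True
    have "real (card S) \<le> 2 * P * real (card S)" using P1 by (simp add: mult_le_cancel_right1)
    thus thesis using that[of shifts S] True mono[of "Suc 0" 4] by auto
  next
    case False
    then obtain g where g: "g \<in> S" "slope g \<noteq> \<one>" using S(4) by (auto simp: shifts_iff subset_iff)
    hence "g \<in> Aff" using S(4) by blast
    then obtain x where x: "x \<in> carrier R" "app g x = x" using fixed_point_exists g(2) by blast
    define T where "T = nfold S 2 \<inter> stabilizer x"
    define \<Lambda> where "\<Lambda> = slope ` T"
    define B where "B = shift_amounts (nfold S 4)"
    define D where "D = shift_amounts (nfold S 56)"
    have finT: "finite T" using fin by (simp add: T_def)
    have TA: "T \<subseteq> nfold S 2 \<inter> Aff" by (auto simp: T_def stabilizer_def)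
    have cL: "card \<Lambda> = card T"
      unfolding \<Lambda>_def by (intro card_image inj_on_subset[OF inj_on_slope_stabilizer[OF x(1)]]) (auto simp: T_def)
    have low: "card S \<le> card B * card T"
      using approximate_group_splitting[OF S g x] by (simp add: B_def T_def card_shift_amounts)
    have lowR: "real (card S) \<le> real (card B) * real (card T)"
      using low unfolding of_nat_mult[symmetric] of_nat_le_iff .
    \<comment> \<open>The words of length 56 for \<open>D\<close> and of length 2 for
      \<open>T\<close> account for the 58 in the hypothesis.\<close>
    have up: "card D * card T \<le> card (nfold S 58)"
      using shifts_stabilizer_le[OF S(1) x(1), of 56 2] by (simp add: D_def T_def card_shift_amounts)
    have B0: "\<zero> \<in> B" using S(2) mono[of 0 4] by (auto simp: B_def shift_amounts_def aff_zero)
    have finB: "finite B" and finD: "finite D" using fin by (simp_all add: B_def D_def finite_shift_amounts)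
    have cT: "0 < card T" and cB: "0 < card B" using low cS by (auto intro!: Nat.gr0I)
    \<comment> \<open>|D| |T| \<le> |S^58| \<le> P |S| \<le> P |B| |T|, so the translation amounts
      grow by at most a factor \<open>P\<close>.\<close>
    have DB: "real (card D) \<le> P * real (card B)"
    proof -
      have "real (card D) * real (card T) \<le> P * real (card S)"
      proof -
        have "real (card D) * real (card T) \<le> real (card (nfold S 58))"
          using up unfolding of_nat_mult[symmetric] of_nat_le_iff .
        thus ?thesis using P by linarith
      qed
      also have "\<dots> \<le> P * (real (card B) * real (card T))"
        using lowR P1 by (intro mult_left_mono) simp_all
      finally show ?thesis using cT by (simp add: mult.assoc[symmetric])
    qed
    have shift_case: "real (card S) \<le> 2 * P * real (card (nfold S 4 \<inter> shifts))" if "real (card T) \<le> 2 * P"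
    proof -
      have "real (card S) \<le> real (card T) * real (card B)" using lowR by (simp add: mult.commute)
      also have "\<dots> \<le> 2 * P * real (card B)" using that by (rule mult_right_mono) simp
      finally show ?thesis by (simp add: B_def card_shift_amounts)
    qed
    show thesis
    \<comment> \<open>Three cases: without nonzero translation amounts \<open>S\<close> is no larger
      than \<open>T\<close>; with at most \<open>2 * P\<close> dilations \<open>S\<close> is not
      much larger than \<open>B\<close>; otherwise both are present in quantity and
      \<open>pivot\<close> applies.\<close>
    proof (cases "B = {\<zero>}")
      case True
      hence "card S \<le> card T" using low by simp
      hence "real (card S) \<le> 2 * P * real (card T)"
        using P1 mult_right_mono[of 1 "2 * P" "real (card T)"] by linarith
      thus thesis using that[of "stabilizer x" T] x(1) mono[of 2 4] by (auto simp: T_def)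
    next
      case Bne: False
      show thesis
      proof (cases "real (card T) \<le> 2 * P")
        case True
        thus thesis using that[of shifts "nfold S 4 \<inter> shifts"] shift_case by auto
      next
        case False
        hence T2: "2 \<le> card \<Lambda>" using P1 by (simp add: cL)
        have Lsub: "\<Lambda> \<subseteq> carrier R" using TA slope_closed by (auto simp: \<Lambda>_def)
        have Bsub: "B \<subseteq> carrier R" by (auto simp: B_def shift_amounts_def)
        have mul: "c \<otimes> b \<in> shift_amounts (nfold S (k + 4))" if "c \<in> \<Lambda>" "b \<in> shift_amounts (nfold S k)" for c b k
          using that TA shift_amounts_mult[OF S(3), of _ 2 b k] by (auto simp: \<Lambda>_def)
        have "card B * card \<Lambda> \<le> card D \<or> finite (carrier R) \<and>
          card (carrier R) * (card B * card \<Lambda>) \<le> card D * (card (carrier R) + card B * card \<Lambda>)"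
        proof (rule pivot[OF finB _ finD Bsub Lsub B0 Bne T2 rigid])
          show "finite \<Lambda>" using finT by (simp add: \<Lambda>_def)
          fix b b0 b1 b2 c c1 c2
          assume mem: "b \<in> B" "b0 \<in> B" "b1 \<in> B" "b2 \<in> B" "c \<in> \<Lambda>" "c1 \<in> \<Lambda>" "c2 \<in> \<Lambda>"
          have cl: "b \<in> carrier R" "b0 \<in> carrier R" "b1 \<in> carrier R" "b2 \<in> carrier R"
            "c \<in> carrier R" "c1 \<in> carrier R" "c2 \<in> carrier R" using mem Bsub Lsub by auto
          note B = mem(1-4)[unfolded B_def]
          note neg = shift_amounts_uminus[OF S(3)]
          have "c1 \<otimes> b \<oplus> \<ominus> (c2 \<otimes> b) \<oplus> c \<otimes> b1 \<oplus> \<ominus> (c \<otimes> b2) \<oplus> c \<otimes> (c1 \<otimes> b0) \<oplus> \<ominus> (c \<otimes> (c2 \<otimes> b0))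
              \<in> shift_amounts (nfold S ((4 + 4) + (4 + 4) + (4 + 4) + (4 + 4) + ((4 + 4) + 4) + ((4 + 4) + 4)))"
            by (intro shift_amounts_add neg mul mem(5-7) B)
          moreover have "(c1 \<ominus> c2) \<otimes> b \<oplus> c \<otimes> (b1 \<ominus> b2) \<oplus> c \<otimes> ((c1 \<ominus> c2) \<otimes> b0)
            = c1 \<otimes> b \<oplus> \<ominus> (c2 \<otimes> b) \<oplus> c \<otimes> b1 \<oplus> \<ominus> (c \<otimes> b2) \<oplus> c \<otimes> (c1 \<otimes> b0) \<oplus> \<ominus> (c \<otimes> (c2 \<otimes> b0))"
            using cl by algebra
          ultimately show "(c1 \<ominus> c2) \<otimes> b \<oplus> c \<otimes> (b1 \<ominus> b2) \<oplus> c \<otimes> ((c1 \<ominus> c2) \<otimes> b0) \<in> D"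
            by (simp add: D_def)
        qed
        thus thesis
        proof (elim disjE conjE)
          assume "card B * card \<Lambda> \<le> card D"
          hence "real (card B) * real (card T) \<le> P * real (card B)"
          proof -
            assume "card B * card \<Lambda> \<le> card D"
            hence "real (card B) * real (card T) \<le> real (card D)"
              unfolding cL of_nat_mult[symmetric] of_nat_le_iff .
            thus ?thesis using DB by linarith
          qed
          hence "real (card T) \<le> P" using cB by (simp add: mult.commute[of P])
          thus thesis using False P1 by linarith
        next
          assume finR: "finite (carrier R)"
            and "card (carrier R) * (card B * card \<Lambda>) \<le> card D * (card (carrier R) + card B * card \<Lambda>)"
          hence ineq: "real (card (carrier R)) * (real (card B) * real (card T))
              \<le> real (card D) * (real (card (carrier R)) + real (card B) * real (card T))"
            unfolding cL of_nat_mult[symmetric] of_nat_add[symmetric] of_nat_le_iff by blast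
          define p n d where "p = real (card (carrier R))" "n = real (card B) * real (card T)" "d = real (card D)"
          note defs = p_n_d_def
          have pos: "0 < p" "0 < n" using finR cB cT by (auto simp: defs card_gt_0_iff)
          \<comment> \<open>Otherwise \<open>2 * d < p\<close>, and together with
            \<open>2 * d \<le> n\<close> this contradicts
            \<open>p * n \<le> d * (p + n)\<close>.\<close>
          have "p \<le> 2 * P * real (card B)"
          proof (rule ccontr)
            assume "\<not> ?thesis"
            hence "2 * d < p" using DB by (simp add: defs)
            hence "n * (2 * d) < n * p" using pos by simp
            moreover have "2 * d \<le> n"
            proof -
              have "2 * d \<le> real (card B) * (2 * P)" using DB by (simp add: defs mult.commute)
              also have "\<dots> \<le> n" unfolding defs using False by (intro mult_left_mono) auto
              finally show ?thesis .
            qed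
            hence "p * (2 * d) \<le> p * n" using pos by simp
            ultimately have "2 * (d * (p + n)) < 2 * (p * n)" by (simp add: algebra_simps)
            thus False using ineq by (simp add: defs)
          qed
          hence "finite (carrier R) \<and> real (card (carrier R)) \<le> 2 * P * real (card (nfold S 4 \<inter> shifts))"
            using finR by (simp add: defs B_def card_shift_amounts)
          thus thesis using that[of shifts "nfold S 4 \<inter> shifts"] by blast
        qed
      qed
    qed
  qed
qed

end

section \<open>Concentration on a coset of an abelian subgroup\<close>

text \<open>If every double step lost more than the factor \<open>N powr (16 / J)\<close>, at least
  J / 4 double steps would bring the value below \<open>1 / N ^ 4\<close>. Steps are paired because
  the measure in the middle is the one to be examined: the norm at the start of the pair bounds its
  supremum, and the norm at the end is that of its convolution square.\<close>

lemma two_step_pigeonhole: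
  fixes a :: "nat \<Rightarrow> real" and N :: real
  assumes J: "3 \<le> J" and N: "1 \<le> N" and a0: "a 0 \<le> 1" and low: "\<And>i. i < J \<Longrightarrow> 1 / N ^ 4 \<le> a i"
  obtains j where "j + 2 < J" "a j / N powr (16 / real J) \<le> a (j + 2)"
proof -
  define K where "K = N powr (16 / real J)"
  have K: "1 \<le> K" using N by (simp add: K_def ge_one_powr_ge_zero)
  have "\<exists>j. j + 2 < J \<and> a j / K \<le> a (j + 2)"
  proof (rule ccontr)
    assume "\<not> ?thesis"
    hence step: "a (j + 2) < a j / K" if "j + 2 < J" for j using that by (auto simp: not_le)
    have dec: "a (2 * Suc i) < 1 / K ^ Suc i" if "2 * Suc i < J" for i
      using that
    proof (induction i)
      case 0
      have "a 2 < a 0 / K" using step[of 0] 0 by (simp add: numeral_2_eq_2)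
      also have "\<dots> \<le> 1 / K" using a0 K by (intro divide_right_mono) auto
      finally show ?case by (simp add: numeral_2_eq_2)
    next
      case (Suc i)
      have "a (2 * Suc i + 2) < a (2 * Suc i) / K" using step[of "2 * Suc i"] Suc.prems by simp
      also have "\<dots> \<le> (1 / K ^ Suc i) / K" using Suc K by (intro divide_right_mono) auto
      finally show ?case by (simp add: mult_ac)
    qed
    \<comment> \<open>Both \<open>2 * q < J\<close> and \<open>J \<le> 4 * q\<close> hold from
      \<open>J = 3\<close> on.\<close>
    define q where "q = (J - 1) div 2"
    have q: "2 * q \<le> J - 1" "J - 1 \<le> 2 * q + 1" unfolding q_def by simp_all
    define i where "i = q - 1"
    have "1 \<le> q" using J q by linarith
    hence "Suc i = q" by (simp add: i_def)
    hence i: "2 * Suc i < J" "J \<le> 4 * Suc i" using J q \<open>1 \<le> q\<close> by auto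
    have "N ^ 4 = N powr 4" using N by (simp add: powr_numeral)
    also have "\<dots> \<le> N powr (16 / real J * real (Suc i))"
    proof (rule powr_mono)
      have "4 * real J \<le> 16 * real (Suc i)" using i(2) by simp
      thus "4 \<le> 16 / real J * real (Suc i)" using J by (simp add: field_simps)
    qed (rule N)
    also have "\<dots> = K ^ Suc i" unfolding K_def by (subst powr_power) (use N in \<open>simp_all add: mult.commute\<close>)
    finally have "N ^ 4 \<le> K ^ Suc i" .
    hence "1 / K ^ Suc i \<le> 1 / N ^ 4" using K N by (intro divide_left_mono mult_pos_pos zero_less_power) auto
    thus False using dec[OF i(1)] low[OF i(1)] by linarith
  qed
  thus thesis using that by (auto simp: K_def)
qed

lemma prob_le_1:
  assumes "prob f"
  shows "f x \<le> 1"
proof (cases "x \<in> supp f")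
  case True
  have "f x \<le> sum f (supp f)"
    by (rule member_le_sum[OF True]) (use assms in \<open>auto simp: finite_supp prob_nonneg\<close>)
  thus ?thesis using assms by (simp add: prob_sum)
qed (simp add: supp_def)

lemma integ_self_le:
  assumes "prob f" "\<And>x. f x \<le> k"
  shows "integ f f \<le> k"
  using integ_mono[OF assms(1), of f "\<lambda>_. k"] assms by (simp add: integ_const)

lemma integ_diff_const: "prob f \<Longrightarrow> integ f (\<lambda>x. h x - c) = integ f h - c"
  using integ_const[of f c] by (simp add: integ_def right_diff_distrib sum_subtractf)

context field
begin

section \<open>Second moment of the return numbers over a finite affine group\<close>

lemma card_Aff_param:
  assumes "finite (carrier R)"
  shows "inj_on (\<lambda>(a, b). aff a b) ((carrier R - {\<zero>}) \<times> carrier R)"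
    and "Aff = (\<lambda>(a, b). aff a b) ` ((carrier R - {\<zero>}) \<times> carrier R)"
  by (auto simp: inj_on_def aff_eq_iff Aff_def)

text \<open>For every slope and every \<open>y\<close> in \<open>Y\<close> exactly |Y| constant
  terms make \<open>y\<close> return.\<close>

lemma sum_returns_Aff:
  assumes fin: "finite (carrier R)" and Y: "Y \<subseteq> carrier R"
  shows "(\<Sum>g\<in>Aff. returns Y g) = real (card (carrier R) - 1) * (real (card Y))\<^sup>2"
proof -
  have finY: "finite Y" using Y fin by (rule finite_subset)
  have row: "(\<Sum>b\<in>carrier R. returns Y (aff a b)) = (real (card Y))\<^sup>2" if a: "a \<in> carrier R" "a \<noteq> \<zero>" for a
  proof -
    have "(\<Sum>b\<in>carrier R. card {y \<in> Y. app (aff a b) y \<in> Y}) = (\<Sum>y\<in>Y. card {b \<in> carrier R. app (aff a b) y \<in> Y})"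
      by (rule sum_card_Collect_swap[OF fin finY])
    also have "\<dots> = (\<Sum>y\<in>Y. card Y)"
    proof (rule sum.cong[OF refl])
      fix y assume "y \<in> Y"
      hence y: "y \<in> carrier R" using Y by blast
      have "bij_betw (\<lambda>b. a \<otimes> y \<oplus> b) {b \<in> carrier R. app (aff a b) y \<in> Y} Y"
      proof (rule bij_betwI[where g = "\<lambda>z. z \<ominus> a \<otimes> y"])
        have 1: "z \<ominus> a \<otimes> y \<in> carrier R" "a \<otimes> y \<oplus> (z \<ominus> a \<otimes> y) = z" if "z \<in> carrier R" for z
        proof -
          show "a \<otimes> y \<oplus> (z \<ominus> a \<otimes> y) = z"
            using a y that by algebra
        qed (use a y that in simp)
        show "(\<lambda>z. z \<ominus> a \<otimes> y) \<in> Y \<rightarrow> {b \<in> carrier R. app (aff a b) y \<in> Y}"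
          using 1 Y a y by (auto simp: app_aff)
        show "a \<otimes> y \<oplus> (z \<ominus> a \<otimes> y) = z" if "z \<in> Y" for z using that Y 1 by blast
        show "(\<lambda>b. a \<otimes> y \<oplus> b) \<in> {b \<in> carrier R. app (aff a b) y \<in> Y} \<rightarrow> Y"
          using a y by (auto simp: app_aff)
        show "a \<otimes> y \<oplus> b \<ominus> a \<otimes> y = b" if "b \<in> {b \<in> carrier R. app (aff a b) y \<in> Y}" for b
        proof -
          have b: "b \<in> carrier R" using that by simp
          show ?thesis using a y b by algebra
        qed
      qed
      thus "card {b \<in> carrier R. app (aff a b) y \<in> Y} = card Y" by (rule bij_betw_same_card)
    qed
    also have "\<dots> = (card Y)\<^sup>2" by (simp add: power2_eq_square)
    finally show ?thesis by (simp add: returns_def flip: of_nat_sum of_nat_power)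
  qed
  have "(\<Sum>g\<in>Aff. returns Y g) = (\<Sum>(a, b)\<in>(carrier R - {\<zero>}) \<times> carrier R. returns Y (aff a b))"
    unfolding card_Aff_param(2)[OF fin] by (subst sum.reindex[OF card_Aff_param(1)[OF fin]]) (simp add: case_prod_beta)
  also have "\<dots> = (\<Sum>a\<in>carrier R - {\<zero>}. \<Sum>b\<in>carrier R. returns Y (aff a b))"
    by (simp add: sum.cartesian_product)
  also have "\<dots> = (\<Sum>a\<in>carrier R - {\<zero>}. (real (card Y))\<^sup>2)"
    by (intro sum.cong) (auto simp: row)
  finally show ?thesis using fin by (simp add: card_Diff_singleton)
qed

text \<open>The mean return number over the whole group is \<open>m = N\<^sup>2 / p\<close>, and the
  squared deviations sum to at most \<open>N\<^sup>2 * p\<close>. As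
  \<open>N \<le> \<theta> * p\<close>, the mean is at most \<open>\<theta> * N\<close>, so
  \<open>f\<close> sees an excess of at least \<open>3 * \<theta> * N\<close> over it, and
  Cauchy-Schwarz for this excess gives a bound in terms of \<open>p\<close> instead of
  \<open>N\<^sup>2\<close>.\<close>

lemma integ_self_ge_finite_field:
  assumes f: "prob f" "supp f \<subseteq> Aff" and fin: "finite (carrier R)" and Y: "Y \<subseteq> carrier R" "Y \<noteq> {}"
    and \<theta>: "0 < \<theta>" "real (card Y) \<le> \<theta> * real (card (carrier R))" "4 * \<theta> * real (card Y) \<le> integ f (returns Y)"
  shows "\<theta>\<^sup>2 / real (card (carrier R)) \<le> integ f f"
proof -
  define N p m where "N = real (card Y)" "p = real (card (carrier R))" "m = N\<^sup>2 / p"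
  note defs = N_p_m_def
  have finY: "finite Y" using Y fin by (auto intro: finite_subset)
  have finA: "finite Aff" using card_Aff_param(2)[OF fin] fin by simp
  have p0: "0 < card (carrier R)" using fin by (auto simp: card_gt_0_iff)
  hence p: "0 < p" "real (card (carrier R) - 1) = p - 1" by (simp_all add: defs of_nat_diff)
  have N: "0 < N" "N \<le> p" using Y finY fin by (auto simp: defs card_gt_0_iff intro: card_mono)
  have cA: "real (card Aff) = p * (p - 1)"
    using card_image[OF card_Aff_param(1)[OF fin]] card_Aff_param(2)[OF fin] fin p
    by (simp add: card_cartesian_product card_Diff_singleton defs(2))
  have S1: "(\<Sum>g\<in>Aff. returns Y g) = (p - 1) * N\<^sup>2"
    using sum_returns_Aff[OF fin Y(1)] p by (simp add: defs(1))
  have S2: "(\<Sum>g\<in>Aff. returns Y g * (returns Y g - 1)) \<le> (N * (N - 1))\<^sup>2"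
    unfolding defs(1) by (rule sum_returns_le[OF finA finY]) (use Y Aff_eqI in blast)
  have "(\<Sum>g\<in>Aff. (returns Y g - m)\<^sup>2)
      = (\<Sum>g\<in>Aff. returns Y g * (returns Y g - 1) + (1 - 2 * m) * returns Y g + m\<^sup>2)"
    by (intro sum.cong) (auto simp: power2_eq_square algebra_simps)
  also have "\<dots> = (\<Sum>g\<in>Aff. returns Y g * (returns Y g - 1)) + (1 - 2 * m) * ((p - 1) * N\<^sup>2) + m\<^sup>2 * (p * (p - 1))"
    by (simp add: sum.distrib cA S1 flip: sum_distrib_left)
  also have "\<dots> \<le> (N * (N - 1))\<^sup>2 + (1 - 2 * m) * ((p - 1) * N\<^sup>2) + m\<^sup>2 * (p * (p - 1))"
    using S2 by simp
  also have "\<dots> = N\<^sup>2 * (p - 2 * N + m)"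
  proof -
    have mp: "m * p = N\<^sup>2" using p by (simp add: defs)
    have "m\<^sup>2 * (p * (p - 1)) = m * (m * p) * (p - 1)" by (simp add: power2_eq_square)
    also have "\<dots> = m * N\<^sup>2 * (p - 1)" by (simp only: mp)
    finally have "(N * (N - 1))\<^sup>2 + (1 - 2 * m) * ((p - 1) * N\<^sup>2) + m\<^sup>2 * (p * (p - 1))
        = N\<^sup>2 * ((N - 1)\<^sup>2 + p - 1 - m * p + m)"
      unfolding power_mult_distrib by (simp add: algebra_simps)
    also have "(N - 1)\<^sup>2 + p - 1 - m * p + m = p - 2 * N + m"
      unfolding mp by (simp add: power2_eq_square algebra_simps)
    finally show ?thesis .
  qed
  also have "\<dots> \<le> N\<^sup>2 * p"
  proof (rule mult_left_mono)
    have "m \<le> N * p / p" unfolding defs(3)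
      by (rule divide_right_mono) (use N p in \<open>auto simp: power2_eq_square\<close>)
    thus "p - 2 * N + m \<le> p" using p N by simp
  qed simp
  finally have var: "(\<Sum>g\<in>Aff. (returns Y g - m)\<^sup>2) \<le> N\<^sup>2 * p" .
  have "m \<le> \<theta> * N"
  proof -
    have "N * N \<le> (\<theta> * p) * N" by (rule mult_right_mono) (use \<theta> N in \<open>auto simp: defs(1,2)\<close>)
    thus ?thesis using p by (simp add: defs(3) power2_eq_square divide_le_eq mult_ac)
  qed
  hence "3 * (\<theta> * N) \<le> integ f (\<lambda>g. returns Y g - m)"
    using \<theta>(3) by (simp add: integ_diff_const[OF f(1)] defs(1))
  hence "(3 * (\<theta> * N))\<^sup>2 \<le> (integ f (\<lambda>g. returns Y g - m))\<^sup>2"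
    using \<theta> N by (intro power_mono) auto
  also have "\<dots> \<le> integ f f * (\<Sum>g\<in>Aff. (returns Y g - m)\<^sup>2)"
    by (rule integ_squared_le[OF finA f(2)])
  also have "\<dots> \<le> integ f f * (N\<^sup>2 * p)"
    by (rule mult_left_mono[OF var]) (intro integ_nonneg prob_nonneg f)
  finally have "(9 * \<theta>\<^sup>2) * N\<^sup>2 \<le> (integ f f * p) * N\<^sup>2" by (simp add: power_mult_distrib mult_ac)
  hence "9 * \<theta>\<^sup>2 \<le> integ f f * p" using N by (simp add: mult_le_cancel_right)
  hence "\<theta>\<^sup>2 \<le> integ f f * p" by (smt (verit) zero_le_power2)
  thus ?thesis using p by (simp add: defs divide_le_eq)
qed

section \<open>From a stable measure to a coset of an abelian subgroup\<close>

definition abelian_type :: "'a bijection set \<Rightarrow> bool" where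
  "abelian_type H \<longleftrightarrow> H = shifts \<or> (\<exists>x\<in>carrier R. H = stabilizer x)"

lemma abelian_type_subgroup:
  assumes "abelian_type H"
  shows "h \<in> H \<Longrightarrow> - h \<in> H" "h \<in> H \<Longrightarrow> k \<in> H \<Longrightarrow> h + k \<in> H"
proof -
  show "- h \<in> H" if "h \<in> H"
  proof (cases "H = shifts")
    case True
    hence "slope (- h) = \<one>" "- h \<in> Aff"
      using that slope_uminus[of h] slope_closed[of "- h"] by (auto simp: shifts_iff Aff_uminus)
    thus ?thesis using True by (simp add: shifts_iff)
  next
    case False
    then obtain x where "H = stabilizer x" using assms by (auto simp: abelian_type_def)
    thus ?thesis using that app_uminus_app[of h x] by (auto simp: stabilizer_def Aff_uminus)
  qed
  show "h + k \<in> H" if "h \<in> H" "k \<in> H"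
    using assms that by (auto simp: abelian_type_def shifts_iff stabilizer_def Aff_plus)
qed

text \<open>A level set of \<open>f\<close> carries a dense graph whose edges are quotients in a
  level set of \<open>conv f f\<close>. Balog-Szemeredi-Gowers gives a set \<open>A\<close> in it,
  the popular quotients of \<open>A\<close> form an approximate group \<open>S\<close>, and S^4
  contains a large part \<open>B\<close> of an abelian subgroup \<open>H\<close>. Then A^(-1) B is
  not much larger than \<open>B\<close>, so few cosets of \<open>H\<close> cover A^(-1), which has
  mass at least \<open>1 / Q ^ 8\<close>. Numerical constants are absorbed by
  \<open>Q \<ge> 4\<close>. Quantifying over upper bounds \<open>s\<close> replaces speaking of a
  largest coset mass.\<close>

lemma stable_measure_concentrates:
  fixes f :: "'a bijection \<Rightarrow> real" and Q \<kappa> K :: real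
  assumes f: "prob f" "\<And>x. f (- x) = f x" "\<And>x. conv f f (- x) = conv f f x" "supp f \<subseteq> Aff"
    and \<kappa>: "0 < \<kappa>" "\<And>x. f x \<le> \<kappa>" "\<And>x. conv f f x \<le> \<kappa>"
    and stable: "\<kappa> / K \<le> integ (conv f f) (conv f f)"
    and rigid: translation_rigid and Q: "4 \<le> Q" and K: "1 \<le> K" "K \<le> Q"
    and fin: "finite (carrier R) \<Longrightarrow> 1 \<le> Q\<^sup>2 * \<kappa> * real (card (carrier R))"
  obtains H where "abelian_type H" "\<And>s. (\<And>x. mass f (coset x H) \<le> s) \<Longrightarrow> 1 / Q ^ 6217 \<le> s"
proof -
  define t where "t = \<kappa> / (6 * K)"
  \<comment> \<open>\<open>n = 1 / t\<close> bounds the size of both level sets, and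
    \<open>\<delta>\<close> is chosen such that \<open>\<delta> * n\<^sup>2\<close> is the lower
    bound of \<open>level_set_edges\<close>.\<close>
  define n where "n = 6 * K / \<kappa>"
  define \<delta> where "\<delta> = 1 / (72 * K ^ 3)"
  define V where "V = {x. t \<le> f x}"
  define H0 where "H0 = {x. t \<le> conv f f x}"
  have t: "0 < t" and n: "0 < n" and \<delta>: "0 < \<delta>" and nt: "n = 1 / t"
    using \<kappa> K by (simp_all add: t_def n_def \<delta>_def)
  have Q4: "4 ^ i \<le> Q ^ i" for i using Q by (intro power_mono) auto
  have Qpos: "0 < Q ^ i" for i using Q by simp
  have V: "finite V" "real (card V) \<le> n" "finite H0" "real (card H0) \<le> n"
    using card_superlevel_le[OF f(1) t] card_superlevel_le[OF prob_conv[OF f(1) f(1)] t]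
    by (simp_all add: V_def H0_def nt)
  have "\<delta> * n\<^sup>2 = 1 / (2 * K * \<kappa>\<^sup>2)"
    using \<kappa>(1) K by (simp add: \<delta>_def n_def power2_eq_square power3_eq_cube)
  hence edges: "\<delta> * n\<^sup>2 \<le> real (card {(x, y) \<in> V \<times> V. - x + y \<in> H0})"
    using level_set_edges[OF f(1,2) \<kappa> _ stable] K by (simp add: V_def H0_def t_def)
  obtain A where A: "A \<subseteq> V" "\<delta> * n / 4 \<le> real (card A)" "real (card (difs A)) \<le> 1024 * n / \<delta> ^ 5"
    by (rule Balog_Szemeredi_Gowers[OF V(1,3) _ n V(2,4) \<delta> edges]) (auto simp: H0_def f(3))
  have finA: "finite A" using A V by (auto intro: finite_subset)
  have "0 < real (card A)" using A(2) \<delta> n by (smt (verit) divide_pos_pos mult_pos_pos)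
  hence Ane: "A \<noteq> {}" and cA: "0 < real (card A)" by auto
  have \<delta>Q: "1 / \<delta> \<le> Q ^ 7"
  proof -
    have "1 / \<delta> = 72 * K ^ 3" by (simp add: \<delta>_def)
    also have "\<dots> \<le> Q ^ 4 * Q ^ 3"
      by (intro mult_mono power_mono) (use Q4[of 4] K Q in auto)
    finally show ?thesis by (simp flip: power_add)
  qed
  have difs: "real (card (difs A)) \<le> Q ^ 48 * real (card A)"
  proof -
    \<comment> \<open>Rewritten in terms of the lower bound \<open>\<delta> * n / 4\<close> for |A|;
      the constant 4096 is \<open>4 ^ 6\<close>.\<close>
    have "1024 * n / \<delta> ^ 5 = 4096 * (1 / \<delta>) ^ 6 * (\<delta> * n / 4)"
      using \<delta> by (simp add: eval_nat_numeral)
    also have "\<dots> \<le> (Q ^ 6 * (Q ^ 7) ^ 6) * real (card A)"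
      by (intro mult_mono power_mono \<delta>Q A(2)) (use Q4[of 6] \<delta> n Q in auto)
    finally show ?thesis using A(3) by (simp flip: power_add power_mult)
  qed
  obtain S where S: "finite S" "0 \<in> S" "\<And>s. s \<in> S \<Longrightarrow> - s \<in> S" "S \<subseteq> (\<lambda>(x, y). x - y) ` (A \<times> A)"
    "real (card A) \<le> 2 * Q ^ 48 * real (card S)"
    "\<And>k. real (card (sandwich A S k)) \<le> (2 * (Q ^ 48)\<^sup>2) ^ k * (Q ^ 48 * real (card A))"
    by (rule small_difs_imp_approximate_group[OF finA Ane difs]) blast
  have "A \<subseteq> Aff" using A(1) f(4) t by (auto simp: V_def supp_def subset_iff)
  hence SA: "S \<subseteq> Aff"
    using S(4) by (auto simp: subset_iff diff_conv_add_uminus simp del: add_uminus_conv_diff intro!: Aff_plus Aff_uminus)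
  have AS: "real (card A) \<le> Q ^ 49 * real (card S)"
  proof -
    have "2 * Q ^ 48 * real (card S) \<le> Q * Q ^ 48 * real (card S)"
      by (intro mult_right_mono) (use Q in auto)
    thus ?thesis using S(5) by (simp flip: power_Suc)
  qed
  have sand: "real (card (sandwich A S k)) \<le> Q ^ (97 * k + 48) * real (card A)" for k
  proof -
    have "2 * (Q ^ 48)\<^sup>2 \<le> Q * Q ^ 96" by (intro mult_mono) (use Q in \<open>auto simp flip: power_mult\<close>)
    hence "(2 * (Q ^ 48)\<^sup>2) ^ k \<le> (Q ^ 97) ^ k" using Q by (intro power_mono) (auto simp flip: power_Suc)
    hence "(2 * (Q ^ 48)\<^sup>2) ^ k * (Q ^ 48 * real (card A)) \<le> (Q ^ 97) ^ k * (Q ^ 48 * real (card A))"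
      by (rule mult_right_mono) (use Q in auto)
    thus ?thesis using S(6)[of k] by (simp add: power_add power_mult mult.assoc)
  qed
  obtain a0 where a0: "a0 \<in> A" using Ane by blast
  \<comment> \<open>The exponent is (97 * 58 + 48) + 49, from the growth of the sandwich sets and
    the comparison of |A| with |S|.\<close>
  have "real (card (nfold S 58)) \<le> Q ^ 5723 * real (card S)"
  proof -
    have "card (nfold S 58) \<le> card (sandwich A S 58)"
      by (rule card_inj_on_le[where f = "\<lambda>x. - a0 + x + a0"])
         (use a0 finite_sandwich[OF finA S(1)] in \<open>auto simp: inj_on_def sandwich_def\<close>)
    hence "real (card (nfold S 58)) \<le> Q ^ (97 * 58 + 48) * real (card A)" using sand[of 58] by linarith
    also have "\<dots> \<le> Q ^ (97 * 58 + 48) * (Q ^ 49 * real (card S))"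
      by (rule mult_left_mono[OF AS]) (use Q in simp)
    also have "\<dots> = Q ^ 5723 * real (card S)" by (simp add: mult.assoc[symmetric] flip: power_add)
    finally show ?thesis .
  qed
  then obtain H B where H: "H = shifts \<or> (\<exists>x\<in>carrier R. H = stabilizer x)" "B \<subseteq> H \<inter> nfold S 4"
    and HB: "real (card S) \<le> 2 * Q ^ 5723 * real (card B) \<or>
     finite (carrier R) \<and> real (card (carrier R)) \<le> 2 * Q ^ 5723 * real (card B)"
    using approximate_group_abelian[OF S(1,2,3) SA _ rigid] by blast
  have H': "abelian_type H" using H(1) by (simp add: abelian_type_def)
  have finB: "finite B" using H(2) finite_nfold[OF S(1)] by (auto intro: finite_subset)
  have two: "2 * Q ^ 5723 * real (card B) \<le> Q ^ 5724 * real (card B)"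
  proof -
    have "2 * Q ^ 5723 * real (card B) \<le> Q * Q ^ 5723 * real (card B)"
      by (intro mult_right_mono) (use Q in auto)
    thus ?thesis by (simp flip: power_Suc)
  qed
  have AB: "real (card A) \<le> Q ^ 5773 * real (card B)"
    using HB
  proof (elim disjE conjE)
    assume "real (card S) \<le> 2 * Q ^ 5723 * real (card B)"
    hence "Q ^ 49 * real (card S) \<le> Q ^ 49 * (Q ^ 5724 * real (card B))"
      using two Qpos[of 49] by (intro mult_left_mono) auto
    also have "\<dots> = Q ^ 5773 * real (card B)" by (simp add: mult.assoc[symmetric] flip: power_add)
    finally show ?thesis using AS by linarith
  next
    \<comment> \<open>Here \<open>B\<close> fills much of the field. The level set has at most
      \<open>n = 6 * K / \<kappa>\<close> elements, and the hypothesis on finite fields bounds this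
      by a multiple of \<open>p\<close>.\<close>
    define p where "p = real (card (carrier R))"
    assume finR: "finite (carrier R)" and "real (card (carrier R)) \<le> 2 * Q ^ 5723 * real (card B)"
    hence pB: "p \<le> Q ^ 5724 * real (card B)" using two by (simp add: p_def)
    have "card A \<le> card V" by (rule card_mono[OF V(1) A(1)])
    hence "real (card A) \<le> n" using V(2) by linarith
    also have "n = (6 * K / \<kappa>) * 1" by (simp add: n_def)
    also have "\<dots> \<le> (6 * K / \<kappa>) * (Q\<^sup>2 * \<kappa> * p)"
      unfolding p_def by (rule mult_left_mono[OF fin[OF finR]]) (use \<kappa>(1) K in simp)
    also have "\<dots> = 6 * (K * (Q\<^sup>2 * p))" using \<kappa>(1) by simp
    also have "\<dots> \<le> Q\<^sup>2 * (Q * (Q\<^sup>2 * p))"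
      by (intro mult_mono) (use Q4[of 2] K Q in \<open>auto simp: p_def\<close>)
    also have "\<dots> = Q ^ 5 * p" by (simp add: eval_nat_numeral)
    also have "\<dots> \<le> Q ^ 5 * (Q ^ 5724 * real (card B))"
      by (rule mult_left_mono[OF pB]) (use Q in simp)
    also have "\<dots> = Q ^ 5729 * real (card B)" by (simp add: mult.assoc[symmetric] flip: power_add)
    also have "\<dots> \<le> Q ^ 5773 * real (card B)"
      by (intro mult_right_mono power_increasing) (use Q in auto)
    finally show ?thesis .
  qed
  have cB: "0 < real (card B)"
  proof (rule ccontr)
    assume "\<not> 0 < real (card B)"
    hence "real (card B) = 0" by simp
    thus False using AB cA by simp
  qed
  show thesis
  proof (rule that[OF H'])
    fix s assume s: "\<And>x. mass f (coset x H) \<le> s"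
    define W where "W = (\<lambda>(a, b). - a + b) ` (A \<times> B)"
    have finW: "finite W" using finA finB by (simp add: W_def)
    have "0 \<le> mass f (coset 0 H)" by (rule mass_nonneg[OF f(1)])
    hence s0: "0 \<le> s" using s[of 0] by linarith
    have cW: "real (card W) \<le> Q ^ 436 * real (card A)"
    proof -
      have "card W \<le> card (sandwich A S 4)"
      proof (rule card_inj_on_le[where f = "\<lambda>x. x + a0"])
        show "(\<lambda>x. x + a0) ` W \<subseteq> sandwich A S 4"
        proof clarify
          fix w assume "w \<in> W"
          then obtain a b where "w = - a + b" "a \<in> A" "b \<in> nfold S 4" using H(2) by (auto simp: W_def)
          thus "w + a0 \<in> sandwich A S 4" using a0 unfolding sandwich_def by blast
        qed
        show "inj_on (\<lambda>x. x + a0) W" by (simp add: inj_on_def)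
      qed (rule finite_sandwich[OF finA S(1)])
      thus ?thesis using sand[of 4] by simp
    qed
    have "sum f (uminus ` A) * real (card B) \<le> s * real (card W)"
    proof (rule sum_le_mass_coset[OF f(1) _ finB finW _ _ s])
      show "x + b \<in> W" if "x \<in> uminus ` A" "b \<in> B" for x b using that by (auto simp: W_def)
      show "- b \<in> H" if "b \<in> B" for b using that H(2) abelian_type_subgroup(1)[OF H'] by blast
    qed (use finA in simp)
    also have "sum f (uminus ` A) = sum f A" by (subst sum.reindex) (auto simp: f(2))
    finally have fB: "sum f A * real (card B) \<le> s * real (card W)" .
    have "1 \<le> Q ^ 8 * sum f A"
    proof -
      \<comment> \<open>As \<open>t = 1 / n\<close>, at least \<open>\<delta> * n / 4\<close> points
        of height at least \<open>t\<close> have mass at least \<open>\<delta> / 4\<close>.\<close>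
      have "1 = 4 * (1 / \<delta>) * (\<delta> * n / 4) * t" using \<delta> t by (simp add: nt)
      also have "\<dots> \<le> Q * Q ^ 7 * real (card A) * t"
        by (intro mult_right_mono mult_mono \<delta>Q A(2)) (use Q t \<delta> n in auto)
      also have "\<dots> = Q ^ 8 * (real (card A) * t)" by (simp flip: power_Suc)
      also have "\<dots> \<le> Q ^ 8 * sum f A"
      proof (rule mult_left_mono)
        have "(\<Sum>x\<in>A. t) \<le> sum f A" by (rule sum_mono) (use A(1) in \<open>auto simp: V_def\<close>)
        thus "real (card A) * t \<le> sum f A" by simp
      qed (use Q in simp)
      finally show ?thesis .
    qed
    hence "1 * real (card B) \<le> (Q ^ 8 * sum f A) * real (card B)" by (rule mult_right_mono) simp
    also have "\<dots> = Q ^ 8 * (sum f A * real (card B))" by simp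
    also have "\<dots> \<le> Q ^ 8 * (s * (Q ^ 436 * (Q ^ 5773 * real (card B))))"
    proof (rule mult_left_mono)
      have "s * real (card W) \<le> s * (Q ^ 436 * (Q ^ 5773 * real (card B)))"
      proof (rule mult_left_mono[OF _ s0])
        have "Q ^ 436 * real (card A) \<le> Q ^ 436 * (Q ^ 5773 * real (card B))"
          by (rule mult_left_mono[OF AB]) (use Q in simp)
        thus "real (card W) \<le> Q ^ 436 * (Q ^ 5773 * real (card B))" using cW by linarith
      qed
      thus "sum f A * real (card B) \<le> s * (Q ^ 436 * (Q ^ 5773 * real (card B)))" using fB by linarith
    qed (use Q in simp)
    also have "\<dots> = (s * (Q ^ 8 * (Q ^ 436 * Q ^ 5773))) * real (card B)" by (simp only: mult_ac)
    \<comment> \<open>The three exponents come from the mass of \<open>A\<close>, the size of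
      \<open>W\<close> and the comparison of |A| with |B|.\<close>
    also have "Q ^ 8 * (Q ^ 436 * Q ^ 5773) = Q ^ 6217" by (simp flip: power_add)
    finally have "1 \<le> s * Q ^ 6217" by (rule mult_right_le_imp_le) (rule cB)
    thus "1 / Q ^ 6217 \<le> s" using Qpos[of 6217] by (simp add: divide_le_eq)
  qed
qed


text \<open>Returns along the walk bound its L2 norms from below, the pigeonhole lemma finds a
  stable pair of steps, and the measure in the middle cannot have small mass on all cosets of some
  \<open>H\<close>; hence neither can the uniform measure on \<open>A\<close>. The constant 99488 is
  16 * 6218: the exponent 16 / J in \<open>K\<close> times the lost power of
  \<open>Q\<close>.\<close>

lemma affine_maps_concentrate:
  fixes \<alpha> :: real and J :: nat
  assumes A: "finite A" "A \<noteq> {}" "A \<subseteq> Aff" and Y: "finite Y" "Y \<subseteq> carrier R" "Y \<noteq> {}"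
    and \<alpha>: "0 < \<alpha>" "\<alpha> \<le> 1" and rich: "\<And>g. g \<in> A \<Longrightarrow> \<alpha> * real (card Y) \<le> returns Y g"
    and J: "0 < J" and big: "1 / real (card Y) \<le> (\<alpha> / 2) ^ (2 ^ J)"
    and rigid: translation_rigid
    and small: "finite (carrier R) \<Longrightarrow> real (card Y) \<le> (\<alpha> / 2) ^ (2 ^ J) * real (card (carrier R))"
  obtains H x where "abelian_type H"
    "(\<alpha> / 2) powr (99488 * 2 ^ J) * real (card Y) powr (- 99488 / real J) * real (card A)
      \<le> real (card (A \<inter> coset x H))" "A \<inter> coset x H \<noteq> {}"
proof -
  define N where "N = real (card Y)"
  define \<theta> where "\<theta> = (\<alpha> / 2) ^ (2 ^ J)"
  have \<theta>0: "0 < \<theta>" using \<alpha> by (simp add: \<theta>_def)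
  have two_J: "2 \<le> (2::nat) ^ J" using J by (cases J) auto
  have \<theta>4: "\<theta> \<le> 1 / 4"
  proof -
    have "\<theta> \<le> (\<alpha> / 2)\<^sup>2" unfolding \<theta>_def by (rule power_decreasing[OF two_J]) (use \<alpha> in auto)
    also have "\<dots> \<le> (1 / 2)\<^sup>2" by (rule power_mono) (use \<alpha> in auto)
    finally show ?thesis by (simp add: power2_eq_square)
  qed
  have Y0: "0 < card Y" using Y by (simp add: card_gt_0_iff)
  have N0: "0 < N" using Y0 by (simp add: N_def)
  have \<theta>N: "1 \<le> \<theta> * N" 
  proof -
    have "1 / N \<le> \<theta>" using big by (simp only: \<theta>_def N_def)
    thus ?thesis using N0 by (simp add: divide_le_eq)
  qed
  have N4: "4 \<le> N" using \<theta>N mult_right_mono[OF \<theta>4 less_imp_le[OF N0]] by simp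
  \<comment> \<open>Halving \<alpha> in \<theta> pays for the factor 4 in the norm bounds, because
    \<open>2 ^ 2 ^ J \<ge> 4\<close>.\<close>
  have \<alpha>\<theta>: "4 * \<theta> \<le> \<alpha> ^ k" if "k \<le> 2 ^ J" for k
  proof -
    have "4 * \<theta> \<le> 2 ^ (2 ^ J) * \<theta>"
    proof (rule mult_right_mono)
      have "(2::real)\<^sup>2 \<le> 2 ^ (2 ^ J)" by (rule power_increasing[OF two_J]) simp
      thus "(4::real) \<le> 2 ^ (2 ^ J)" by simp
    qed (use \<theta>0 in simp)
    also have "\<dots> = \<alpha> ^ (2 ^ J)" by (simp add: \<theta>_def power_divide)
    also have "\<dots> \<le> \<alpha> ^ k" by (rule power_decreasing[OF that]) (use \<alpha> in auto)
    finally show ?thesis .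
  qed
  define \<mu> where "\<mu> g = (if g \<in> A then 1 / real (card A) else 0)" for g
  have cA: "0 < card A" using A by (simp add: card_gt_0_iff)
  have supp: "supp \<mu> = A" using cA by (auto simp: supp_def \<mu>_def)
  have \<mu>: "prob \<mu>"
  proof -
    have "sum \<mu> A = (\<Sum>g\<in>A. 1 / real (card A))" by (intro sum.cong) (auto simp: \<mu>_def)
    also have "\<dots> = 1" using cA by simp
    finally show ?thesis using A by (simp add: prob_def supp) (simp add: \<mu>_def)
  qed
  have integ_\<mu>: "integ \<mu> h = (\<Sum>g\<in>A. h g) / real (card A)" for h
    unfolding integ_def supp sum_divide_distrib by (intro sum.cong) (auto simp: \<mu>_def)
  have mass_\<mu>: "mass \<mu> X = real (card (A \<inter> X)) / real (card A)" for X
    unfolding mass_def integ_\<mu> using A(1) by (simp add: indicator_def[abs_def] of_bool_def sum.If_cases Int_def)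
  have ret_\<mu>: "\<alpha> * N \<le> integ \<mu> (returns Y)"
  proof -
    have "\<alpha> * N = integ \<mu> (\<lambda>_. \<alpha> * N)" using \<mu> by (simp add: integ_const)
    also have "\<dots> \<le> integ \<mu> (returns Y)"
      unfolding integ_\<mu> by (intro divide_right_mono sum_mono) (use rich in \<open>auto simp: N_def\<close>)
    finally show ?thesis .
  qed
  have det: "g = h" if "g \<in> Aff" "h \<in> Aff" "x \<in> Y" "y \<in> Y" "x \<noteq> y" "app g x = app h x" "app g y = app h y" for g h x y
    using that Y(2) by (intro Aff_eqI[of g h x y]) auto
  have norm_ge: "1 / N ^ 4 \<le> integ f f"
    if f: "prob f" "supp f \<subseteq> Aff" "4 * \<theta> * N \<le> integ f (returns Y)" for f
  proof -
    have "1 / N ^ 4 = (1 / N)\<^sup>2 / N\<^sup>2" by (simp add: power_divide flip: power_add)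
    also have "\<dots> \<le> \<theta>\<^sup>2 / N\<^sup>2"
      by (intro divide_right_mono power_mono) (use big N0 in \<open>auto simp: \<theta>_def N_def\<close>)
    also have "\<dots> \<le> integ f f"
      unfolding N_def
      by (rule integ_self_ge[OF f(1) Y(1)]) (use f \<theta>N det in \<open>auto simp: N_def subset_iff\<close>)
    finally show ?thesis .
  qed
  have \<theta>_powr: "(\<alpha> / 2) powr (99488 * 2 ^ J) = \<theta> ^ 99488"
    using \<alpha> by (simp add: \<theta>_def powr_realpow[symmetric] powr_powr powr_power mult.commute flip: power_mult)
  show thesis
  \<comment> \<open>For \<open>J \<le> 2\<close> the power of |Y| in the claim is at most |Y|^(-4),
    while the norm bound for \<mu> gives |A| \<le> |Y|^4, so a single map is enough.\<close>
  proof (cases "J \<le> 2")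
    case True
    obtain g where g: "g \<in> A" using A by blast
    have "real (card A) \<le> N ^ 4"
    proof -
      have "4 * \<theta> * N \<le> \<alpha> * N" using \<alpha>\<theta>[of 1] N0 by (intro mult_right_mono) auto
      hence "1 / N ^ 4 \<le> integ \<mu> \<mu>" using ret_\<mu> A by (intro norm_ge \<mu>) (auto simp: supp)
      also have "\<dots> = 1 / real (card A)" using cA by (simp add: integ_\<mu> \<mu>_def)
      finally show ?thesis using cA N0 by (simp add: field_simps)
    qed
    have "(\<alpha> / 2) powr (99488 * 2 ^ J) * N powr (- 99488 / real J) * real (card A) \<le> 1 * N powr (- 4) * N ^ 4"
    proof (intro mult_mono)
      show "(\<alpha> / 2) powr (99488 * 2 ^ J) \<le> 1"
        unfolding \<theta>_powr using \<theta>0 \<theta>4 by (intro power_le_one) auto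
      have "99488 / 2 \<le> 99488 / real J" using True J by (intro divide_left_mono) auto
      thus "N powr (- 99488 / real J) \<le> N powr (- 4)" using N4 by (intro powr_mono) auto
    qed (use \<open>real (card A) \<le> N ^ 4\<close> in auto)
    also have "\<dots> = 1" using N0 by (simp add: powr_minus_divide powr_numeral)
    also have "1 \<le> real (card (A \<inter> coset g shifts))"
    proof -
      have "g \<in> A \<inter> coset g shifts"
        using g slope_aff[of \<one> \<zero>] by (simp add: coset_def shifts_iff Aff_zero aff_zero)
      hence "0 < card (A \<inter> coset g shifts)" using A(1) by (auto simp: card_gt_0_iff)
      thus ?thesis by simp
    qed
    finally have "(\<alpha> / 2) powr (99488 * 2 ^ J) * N powr (- 99488 / real J) * real (card A)
      \<le> real (card (A \<inter> coset g shifts))" .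
    moreover have "A \<inter> coset g shifts \<noteq> {}"
      using g slope_aff[of \<one> \<zero>] by (auto simp: coset_def shifts_iff Aff_zero aff_zero)
    ultimately show thesis using that[of shifts g] by (simp add: abelian_type_def N_def)
  next
    case False
    hence J3: "3 \<le> J" by simp
    define a where "a j = integ (walk \<mu> j) (walk \<mu> j)" for j
    have P: "prob (walk \<mu> j)" for j using \<mu> by (rule prob_walk)
    have SA: "supp (walk \<mu> j) \<subseteq> Aff" for j
      by (rule supp_walk_subset) (use A supp in \<open>auto intro: Aff_plus Aff_uminus\<close>)
    have ret: "4 * \<theta> * N \<le> integ (walk \<mu> j) (returns Y)" if "j < J" for j
    proof -
      have "(2::nat) ^ Suc j \<le> 2 ^ J" using that by (intro power_increasing) auto
      hence "4 * \<theta> * N \<le> \<alpha> ^ 2 ^ Suc j * N" using \<alpha>\<theta> N0 by (intro mult_right_mono) auto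
      also have "\<dots> \<le> integ (walk \<mu> j) (returns Y)"
        unfolding N_def by (rule returns_walk_ge[OF \<mu> Y(1)]) (use \<alpha> ret_\<mu> in \<open>auto simp: N_def\<close>)
      finally show ?thesis .
    qed
    have a_low: "1 / N ^ 4 \<le> a j" if "j < J" for j
      unfolding a_def by (rule norm_ge[OF P SA ret[OF that]])
    have a0: "a 0 \<le> 1" unfolding a_def by (rule integ_self_le[OF P]) (rule prob_le_1[OF P])
    define K where "K = N powr (16 / real J)"
    have K1: "1 \<le> K" using N4 by (simp add: K_def ge_one_powr_ge_zero)
    obtain j where j: "j + 2 < J" "a j / K \<le> a (j + 2)"
      using two_step_pigeonhole[of J N a, OF J3 _ a0 a_low] N4 unfolding K_def by auto
    define Q where "Q = K / \<theta>"
    have Q\<theta>: "1 / \<theta> \<le> Q" using K1 \<theta>0 by (simp add: Q_def divide_right_mono)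
    have Q4: "4 \<le> Q" using Q\<theta> \<theta>4 \<theta>0 by (smt (verit) le_divide_eq mult.commute nonzero_mult_div_cancel_right)
    have KQ: "K \<le> Q"
    proof -
      have "K * 1 \<le> K * (1 / \<theta>)" using \<theta>0 \<theta>4 K1 by (intro mult_left_mono) auto
      thus ?thesis by (simp add: Q_def)
    qed
    \<comment> \<open>\<open>f\<close> is the middle measure of the pair: \<open>a j\<close> bounds
      the suprema of \<open>f\<close> and of its convolution square, and \<open>a (j + 2)\<close> is
      the squared norm of the latter.\<close>
    define f where "f = walk \<mu> (Suc j)"
    have conv_f: "conv f f = walk \<mu> (j + 2)" by (simp add: f_def)
    have f: "prob f" unfolding f_def by (rule P)
    have f_le: "f x \<le> a j" for x unfolding f_def a_def using conv_le_integ_self[OF P] by simp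
    have ff_le: "conv f f x \<le> a j" for x
      using conv_le_integ_self[OF f, of x] integ_self_le[OF f f_le] by linarith
    have aj: "0 < a j"
    proof -
      have "0 < 1 / N ^ 4" using N0 by simp
      thus ?thesis using a_low[of j] j by linarith
    qed
    obtain H where H: "abelian_type H" "\<And>s. (\<And>x. mass f (coset x H) \<le> s) \<Longrightarrow> 1 / Q ^ 6217 \<le> s"
    proof (rule stable_measure_concentrates[of f "a j" K Q])
      show "f (- x) = f x" "conv f f (- x) = conv f f x" for x
        unfolding conv_f unfolding f_def by (rule walk_uminus[OF \<mu>])+
      show "a j / K \<le> integ (conv f f) (conv f f)" using j(2) by (simp add: conv_f a_def)
      show "supp f \<subseteq> Aff" unfolding f_def by (rule SA)
      \<comment> \<open>This is where the size of \<open>Y\<close> is compared with that of the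
        field: \<open>a j\<close> is at least \<open>\<theta>\<^sup>2 / p\<close>, and
        \<open>Q \<ge> 1 / \<theta>\<close>.\<close>
      show "1 \<le> Q\<^sup>2 * a j * real (card (carrier R))" if fin: "finite (carrier R)"
      proof -
        define p where "p = real (card (carrier R))"
        have p: "0 < p" using fin by (auto simp: p_def card_gt_0_iff)
        have "\<theta>\<^sup>2 / p \<le> a j"
          unfolding a_def p_def
          by (rule integ_self_ge_finite_field[OF P SA fin Y(2) _ \<theta>0])
             (use Y0 small[OF fin] ret[of j] j in \<open>auto simp: \<theta>_def N_def\<close>)
        hence "(1 / \<theta>)\<^sup>2 * (\<theta>\<^sup>2 / p) \<le> Q\<^sup>2 * a j"
          by (intro mult_mono power_mono Q\<theta>) (use \<theta>0 p in auto)
        hence "1 / p \<le> Q\<^sup>2 * a j" using \<theta>0 by (simp add: power_divide)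
        thus ?thesis using p by (simp add: p_def[symmetric] divide_le_eq)
      qed
    qed (use f f_le ff_le aj rigid Q4 K1 KQ in auto)
    \<comment> \<open>One more power of \<open>Q\<close> gives the slack by which a single heavy
      coset can be named, although the previous step speaks only of upper bounds for all
      cosets.\<close>
    have "\<exists>x. 1 / Q ^ 6218 < mass \<mu> (coset x H)"
    proof (rule ccontr)
      assume "\<not> ?thesis"
      hence "mass f (coset x H) \<le> 1 / Q ^ 6218" for x
        unfolding f_def by (intro mass_coset_walk_le[OF \<mu>]) (simp add: not_less)
      hence "1 / Q ^ 6217 \<le> 1 / Q ^ 6218" by (rule H(2))
      moreover have "Q ^ 6217 < Q ^ 6218" using Q4 by (intro power_strict_increasing) auto
      moreover have "0 < Q ^ 6217" "0 < Q ^ 6218" using Q4 by simp_all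
      ultimately show False by (simp add: divide_simps)
    qed
    then obtain x where x: "1 / Q ^ 6218 < mass \<mu> (coset x H)" by blast
    have "\<theta> ^ 99488 * N powr (- 99488 / real J) \<le> 1 / Q ^ 6218"
    proof -
      have "K ^ 6218 = N powr (99488 / real J)"
        using N0 by (simp add: K_def powr_power)
      hence "N powr (- 99488 / real J) = 1 / K ^ 6218"
        by (simp add: powr_minus_divide flip: minus_divide_left)
      moreover have "1 / Q ^ 6218 = \<theta> ^ 6218 / K ^ 6218" by (simp add: Q_def power_divide)
      ultimately have "1 / Q ^ 6218 = \<theta> ^ 6218 * N powr (- 99488 / real J)" by simp
      \<comment> \<open>Enlarging the exponent of \<theta> lets the same constant serve for both
        factors of the bound.\<close>
      moreover have "\<theta> ^ 99488 \<le> \<theta> ^ 6218" using \<theta>0 \<theta>4 by (intro power_decreasing) auto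
      ultimately show ?thesis by (simp add: mult_right_mono)
    qed
    hence "\<theta> ^ 99488 * N powr (- 99488 / real J) \<le> real (card (A \<inter> coset x H)) / real (card A)"
      using x by (simp add: mass_\<mu>)
    hence main: "\<theta> ^ 99488 * N powr (- 99488 / real J) * real (card A) \<le> real (card (A \<inter> coset x H))"
      using cA by (simp add: le_divide_eq)
    have "A \<inter> coset x H \<noteq> {}"
    proof
      assume "A \<inter> coset x H = {}"
      hence "1 / Q ^ 6218 < 0" using x by (simp add: mass_\<mu>)
      thus False using Q4 by simp
    qed
    thus thesis using that[OF H(1)] main by (simp add: \<theta>_powr N_def)
  qed
qed

section \<open>From affine maps back to lines\<close>

definition graph_of :: "'a bijection \<Rightarrow> ('a \<times> 'a) set" where
  "graph_of g = {(x, app g x) | x. x \<in> carrier R}"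

lemma line_eq_graph_of: "a \<in> carrier R \<Longrightarrow> a \<noteq> \<zero> \<Longrightarrow> b \<in> carrier R \<Longrightarrow> line R a b = graph_of (aff a b)"
  by (auto simp: line_def graph_of_def app_aff)

lemma lines_eq_graphs_of: "lines R = graph_of ` Aff"
proof (intro equalityI subsetI)
  fix l assume "l \<in> lines R"
  then obtain a b where "a \<in> carrier R" "a \<noteq> \<zero>" "b \<in> carrier R" "l = line R a b"
    by (auto simp: lines_def)
  thus "l \<in> graph_of ` Aff" using line_eq_graph_of aff_in_Aff by blast
next
  fix l assume "l \<in> graph_of ` Aff"
  then obtain a b where "a \<in> carrier R" "a \<noteq> \<zero>" "b \<in> carrier R" "l = graph_of (aff a b)"
    by (auto elim: AffE)
  thus "l \<in> lines R" using line_eq_graph_of unfolding lines_def by blast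
qed

lemma inj_on_graph_of: "inj_on graph_of Aff"
proof (rule inj_onI)
  fix g h assume gh: "g \<in> Aff" "h \<in> Aff" "graph_of g = graph_of h"
  have "app g x = app h x" if "x \<in> carrier R" for x
  proof -
    have "(x, app g x) \<in> graph_of h" using that gh(3) by (auto simp: graph_of_def)
    thus ?thesis by (auto simp: graph_of_def)
  qed
  thus "g = h" using Aff_eqI[OF gh(1,2), of \<zero> \<one>] by simp
qed

lemma returns_eq_card_graph_of:
  assumes "Y \<subseteq> carrier R"
  shows "returns Y g = real (card (graph_of g \<inter> Y \<times> Y))"
proof -
  have "graph_of g \<inter> Y \<times> Y = (\<lambda>y. (y, app g y)) ` {y \<in> Y. app g y \<in> Y}"
    using assms by (auto simp: graph_of_def)
  thus ?thesis by (simp add: returns_def card_image inj_on_def)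
qed

text \<open>Two maps \<open>g\<close> and \<open>h\<close> in one coset differ by the element
  \<open>- g + h\<close> of \<open>H\<close>. If it is a translation, the slopes agree; if it fixes
  \<open>y\<close>, both graphs contain the point \<open>(y, app g y)\<close>.\<close>

lemma coset_lines:
  assumes H: "abelian_type H" and X: "X \<subseteq> Aff \<inter> coset x H" "X \<noteq> {}"
  shows "all_parallel R (graph_of ` X) \<or> all_concurrent R (graph_of ` X)"
proof -
  obtain g where g: "g \<in> X" using X by blast
  have gA: "g \<in> Aff" using g X by blast
  have diff: "- g + h \<in> H" if "h \<in> X" for h
  proof -
    have "- x + g \<in> H" "- x + h \<in> H" using that g X(1) by (auto simp: coset_def)
    hence "- (- x + g) + (- x + h) \<in> H"
      using abelian_type_subgroup(1)[OF H, of "- x + g"] abelian_type_subgroup(2)[OF H] by blast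
    moreover have "- (- x + g) + (- x + h) = - g + h" 
      by (simp add: group_add_class.minus_add add.assoc)
    ultimately show ?thesis by simp
  qed
  from H consider "H = shifts" | y where "y \<in> carrier R" "H = stabilizer y"
    by (auto simp: abelian_type_def)
  thus ?thesis
  proof cases
    case 1
    have "\<exists>b\<in>carrier R. l = line R (slope g) b" if l: "l \<in> graph_of ` X" for l
    proof -
      obtain h where h: "h \<in> X" "l = graph_of h" using l by blast
      have hA: "h \<in> Aff" using h X by blast
      have "slope h = slope (g + (- g + h))" by (simp add: add.assoc[symmetric])
      also have "\<dots> = slope g \<otimes> slope (- g + h)" by (rule Aff_plus(2)) (use gA hA in \<open>auto intro: Aff_plus Aff_uminus\<close>)
      also have "slope (- g + h) = \<one>" using diff[OF h(1)] 1 by (simp add: shifts_iff)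
      finally have sl: "slope h = slope g" using gA slope_closed by simp
      obtain a b where "a \<in> carrier R" "a \<noteq> \<zero>" "b \<in> carrier R" "h = aff a b" by (rule AffE[OF hA])
      thus ?thesis using sl h(2) by (auto simp: slope_aff line_eq_graph_of)
    qed
    thus ?thesis unfolding all_parallel_def using gA slope_closed slope_nonzero by blast
  next
    case 2
    have "(y, app g y) \<in> l" if l: "l \<in> graph_of ` X" for l
    proof -
      obtain h where h: "h \<in> X" "l = graph_of h" using l by blast
      have "app (- g) (app h y) = y" using diff[OF h(1)] 2 by (simp add: stabilizer_def)
      hence "app h y = app g y" by (metis app_app_uminus)
      thus ?thesis using 2 h by (auto simp: graph_of_def)
    qed
    moreover have "(y, app g y) \<in> carrier R \<times> carrier R" using 2 gA app_closed by simp
    ultimately show ?thesis unfolding all_concurrent_def by blast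
  qed
qed

text \<open>Transport along the bijection between affine maps and their graphs, under which the
  points of a line in the grid are the returns of the map.\<close>

lemma rich_lines:
  fixes \<alpha> :: real and J :: nat
  assumes Y: "finite Y" "Y \<subseteq> carrier R" and \<alpha>: "0 < \<alpha>" "\<alpha> \<le> 1"
    and L: "L \<subseteq> lines R" "\<forall>l\<in>L. rich \<alpha> Y l"
    and J: "0 < J" and big: "1 / real (card Y) \<le> (\<alpha> / 2) ^ (2 ^ J)"
    and rigid: translation_rigid
    and small: "finite (carrier R) \<Longrightarrow> real (card Y) \<le> (\<alpha> / 2) ^ (2 ^ J) * real (card (carrier R))"
  shows "\<exists>L'\<subseteq>L. (all_parallel R L' \<or> all_concurrent R L') \<and>
    real (card L') \<ge> 1 * ((\<alpha> / 2) powr (99488 * 2 ^ J) * real (card Y) powr (- 99488 / real J) * real (card L))"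
proof (cases "card L = 0 \<or> Y = {}")
  case True
  \<comment> \<open>The bound is \<open>0\<close>; for \<open>Y = {}\<close> because \<open>0 powr a = 0\<close>.\<close>
  thus ?thesis by (intro exI[of _ "{}"]) (auto simp: all_concurrent_def)
next
  case False
  define A where "A = {g \<in> Aff. graph_of g \<in> L}"
  have LA: "L = graph_of ` A" using L(1) by (auto simp: A_def lines_eq_graphs_of)
  have inj: "inj_on graph_of A" by (rule inj_on_subset[OF inj_on_graph_of]) (auto simp: A_def)
  have cL: "card L = card A" unfolding LA by (rule card_image[OF inj])
  hence finA: "finite A" "A \<noteq> {}" using False by (auto intro: card_ge_0_finite)
  have richA: "\<alpha> * real (card Y) \<le> returns Y g" if "g \<in> A" for g
    using L(2) that by (simp add: A_def rich_def returns_eq_card_graph_of[OF Y(2)])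
  obtain H x where H: "abelian_type H"
    "(\<alpha> / 2) powr (99488 * 2 ^ J) * real (card Y) powr (- 99488 / real J) * real (card A)
      \<le> real (card (A \<inter> coset x H))" "A \<inter> coset x H \<noteq> {}"
    by (rule affine_maps_concentrate[OF finA _ Y _ \<alpha> richA J big rigid small]) (use False in \<open>auto simp: A_def\<close>)
  have "card (graph_of ` (A \<inter> coset x H)) = card (A \<inter> coset x H)"
    by (rule card_image) (rule inj_on_subset[OF inj], simp)
  moreover have "all_parallel R (graph_of ` (A \<inter> coset x H)) \<or> all_concurrent R (graph_of ` (A \<inter> coset x H))"
    by (rule coset_lines[OF H(1) _ H(3)]) (auto simp: A_def)
  ultimately show ?thesis using H(2) cL
    by (intro exI[of _ "graph_of ` (A \<inter> coset x H)"]) (auto simp: LA)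
qed

end

section \<open>Translation rigidity of the complex numbers and of the prime fields\<close>

lemma translation_rigid_complex: "ring.translation_rigid complex_field"
proof -
  interpret field complex_field by (rule field_complex_field)
  show ?thesis unfolding translation_rigid_def
  proof (intro allI impI)
    fix X and b :: complex
    assume X: "X \<subseteq> carrier complex_field" "finite X" "X \<noteq> {}" "b \<noteq> \<zero>\<^bsub>complex_field\<^esub>"
      and inv: "\<forall>x\<in>X. x \<oplus>\<^bsub>complex_field\<^esub> b \<in> X"
    obtain x where x: "x \<in> X" using X by blast
    \<comment> \<open>In characteristic zero the points x + n b are pairwise distinct, so a finite
      \<open>X\<close> cannot contain them all and the assumptions are contradictory.\<close>
    have "x + of_nat n * b \<in> X" for n
    proof (induction n)
      case (Suc n)
      thus ?case using inv by (auto simp: complex_field_def algebra_simps)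
    qed (simp add: x)
    hence "range (\<lambda>n. x + of_nat n * b) \<subseteq> X" by blast
    moreover have "inj (\<lambda>n. x + of_nat n * b)" using X(4) by (auto simp: inj_def complex_field_def)
    ultimately have "infinite X" using range_inj_infinite finite_subset by blast
    thus "X = carrier complex_field" using X by simp
  qed
qed

lemma translation_rigid_residue:
  assumes "prime p"
  shows "ring.translation_rigid (residue_ring (int p))"
proof -
  interpret residues_prime p "residue_ring (int p)"
    using assms by unfold_locales auto
  show ?thesis unfolding translation_rigid_def
  proof (intro allI impI)
    fix X b
    assume X: "X \<subseteq> carrier (residue_ring (int p))" "finite X" "X \<noteq> {}" "b \<in> carrier (residue_ring (int p))"
        "b \<noteq> \<zero>\<^bsub>residue_ring (int p)\<^esub>"
      and inv: "\<forall>x\<in>X. x \<oplus>\<^bsub>residue_ring (int p)\<^esub> b \<in> X"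
    have p: "1 < int p" using prime_gt_1_nat[OF assms] by simp
    obtain x where x: "x \<in> X" using X by blast
    have orbit: "(x + int n * b) mod int p \<in> X" for n
    proof (induction n)
      case 0
      have "x mod int p = x" using x X(1) by (auto simp: res_carrier_eq)
      thus ?case using x by simp
    next
      case (Suc n)
      have "((x + int n * b) mod int p + b) mod int p \<in> X" using inv Suc by (simp add: res_add_eq)
      thus ?case unfolding mod_add_left_eq by (simp add: algebra_simps)
    qed
    \<comment> \<open>Since \<open>b\<close> is invertible modulo \<open>p\<close>, every residue
      \<open>y\<close> is reached from \<open>x\<close> after (y - x) / b steps.\<close>
    have "coprime b (int p)"
    proof -
      have "0 < b" "b < int p" using X(4,5) by (auto simp: res_carrier_eq res_zero_eq)
      hence "\<not> int p dvd b" using zdvd_not_zless by blast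
      thus ?thesis using assms prime_imp_coprime[of "int p" b] by (simp add: coprime_commute)
    qed
    then obtain c where c: "[b * c = 1] (mod int p)" using cong_solve_coprime_int by blast
    show "X = carrier (residue_ring (int p))"
    proof
      show "carrier (residue_ring (int p)) \<subseteq> X"
      proof
        fix y assume y: "y \<in> carrier (residue_ring (int p))"
        define n where "n = nat (((y - x) * c) mod int p)"
        have n: "int n = ((y - x) * c) mod int p" using p by (simp add: n_def)
        have "[int n * b = ((y - x) * c) * b] (mod int p)" unfolding n by (simp add: cong_def mod_mult_left_eq)
        also have "((y - x) * c) * b = (y - x) * (b * c)" by (simp add: mult_ac)
        also have "[(y - x) * (b * c) = (y - x) * 1] (mod int p)" by (rule cong_scalar_left[OF c])
        finally have "[x + int n * b = x + (y - x)] (mod int p)" by (intro cong_add) auto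
        hence "(x + int n * b) mod int p = y mod int p" by (simp add: cong_def)
        also have "\<dots> = y" using y by (auto simp: res_carrier_eq)
        finally show "y \<in> X" using orbit[of n] by simp
      qed
    qed (rule X(1))
  qed
qed

theorem theorem1p4:
  shows "\<exists>C > (0::real). \<exists>c > (0::real).
    (\<forall>(Y :: complex set) (\<alpha> :: real) (L :: (complex \<times> complex) set set) (J :: nat).
       finite Y \<longrightarrow> 0 < \<alpha> \<longrightarrow> \<alpha> \<le> 1 \<longrightarrow>
       L \<subseteq> lines complex_field \<longrightarrow> (\<forall>l \<in> L. rich \<alpha> Y l) \<longrightarrow>
       J > 0 \<longrightarrow> (\<alpha> / 2) ^ (2 ^ J) \<ge> 1 / real (card Y) \<longrightarrow>
       (\<exists>L' \<subseteq> L.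
          (all_parallel complex_field L' \<or> all_concurrent complex_field L') \<and>
          real (card L') \<ge>
            c * ((\<alpha> / 2) powr (C * 2 ^ J) * real (card Y) powr (- C / real J) * real (card L))))
    \<and>
    (\<forall>(p :: nat) (Y :: int set) (\<alpha> :: real) (L :: (int \<times> int) set set) (J :: nat).
       prime p \<longrightarrow>
       Y \<subseteq> carrier (residue_ring (int p)) \<longrightarrow> finite Y \<longrightarrow> 0 < \<alpha> \<longrightarrow> \<alpha> \<le> 1 \<longrightarrow>
       L \<subseteq> lines (residue_ring (int p)) \<longrightarrow> (\<forall>l \<in> L. rich \<alpha> Y l) \<longrightarrow>
       J > 0 \<longrightarrow> (\<alpha> / 2) ^ (2 ^ J) \<ge> 1 / real (card Y) \<longrightarrow>
       real (card Y) \<le> (\<alpha> / 2) ^ (2 ^ J) * real p \<longrightarrow>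
       (\<exists>L' \<subseteq> L.
          (all_parallel (residue_ring (int p)) L' \<or> all_concurrent (residue_ring (int p)) L') \<and>
          real (card L') \<ge>
            c * ((\<alpha> / 2) powr (C * 2 ^ J) * real (card Y) powr (- C / real J) * real (card L))))"
proof (rule exI[of _ 99488], rule conjI, simp, rule exI[of _ 1], rule conjI, simp, intro conjI allI impI)
  fix Y :: "complex set" and \<alpha> :: real and L :: "(complex \<times> complex) set set" and J :: nat
  assume *: "finite Y" "0 < \<alpha>" "\<alpha> \<le> 1" "L \<subseteq> lines complex_field" "\<forall>l\<in>L. rich \<alpha> Y l" "0 < J"
    "1 / real (card Y) \<le> (\<alpha> / 2) ^ 2 ^ J"
  \<comment> \<open>The field being infinite, the condition on finite carriers holds
    vacuously.\<close>
  have "infinite (carrier complex_field)" "Y \<subseteq> carrier complex_field"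
    by (simp_all add: complex_field_def infinite_UNIV_char_0)
  thus "\<exists>L'\<subseteq>L. (all_parallel complex_field L' \<or> all_concurrent complex_field L') \<and>
      1 * ((\<alpha> / 2) powr (99488 * 2 ^ J) * real (card Y) powr (- 99488 / real J) * real (card L)) \<le> real (card L')"
    using field.rich_lines[OF field_complex_field *(1) _ *(2-7) translation_rigid_complex] by blast
next
  fix p :: nat and Y :: "int set" and \<alpha> :: real and L :: "(int \<times> int) set set" and J :: nat
  assume *: "prime p" "Y \<subseteq> carrier (residue_ring (int p))" "finite Y" "0 < \<alpha>" "\<alpha> \<le> 1"
    "L \<subseteq> lines (residue_ring (int p))" "\<forall>l\<in>L. rich \<alpha> Y l" "0 < J"
    "1 / real (card Y) \<le> (\<alpha> / 2) ^ 2 ^ J" "real (card Y) \<le> (\<alpha> / 2) ^ 2 ^ J * real p"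
  interpret residues_prime p "residue_ring (int p)"
    using *(1) by unfold_locales auto
  have "card (carrier (residue_ring (int p))) = p" by (simp add: res_carrier_eq)
  thus "\<exists>L'\<subseteq>L. (all_parallel (residue_ring (int p)) L' \<or> all_concurrent (residue_ring (int p)) L') \<and>
      1 * ((\<alpha> / 2) powr (99488 * 2 ^ J) * real (card Y) powr (- 99488 / real J) * real (card L)) \<le> real (card L')"
    using field.rich_lines[OF is_field *(3,2,4-9) translation_rigid_residue[OF *(1)]] *(10) by simp
qed

end
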